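(* Let $d\ge 1$ and $l\ge 1$ be integers and let $F$ be the free soluble profinite group of rank $d$ and derived length $l$. Then $d_I(F)=l(d-1)+1$.
   Context: The free soluble profinite group of rank $d$ and derived length $l$ is the free object on $d$ generators in the category of profinite groups that are soluble of derived length at most $l$; equivalently, it is the quotient of the free profinite group of rank $d$ by the closure of the $l$-th term of its derived series (where the first term is the commutator subgroup). For a profinite group $G$, generation is understood topologically. A subset $S\subseteq G$ invariably generates $G$ if, for every choice of elements $g(s)\in G$ ($s\in S$), the set $\{s^{g(s)} \mid s\in S\}$ (where $s^{g}=g^{-1}sg$) topologically generates $G$. $d_I(G)$ denotes the smallest cardinality of a subset that invariably generates $G$. *)

theory Defs
  imports
    "HOL-Analysis.Abstract_Topological_Spaces"
    "HOL-Algebra.Solvable_Groups"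
    "HOL-Library.Extended_Nat"
    "HOL-Library.FuncSet"
begin

definition topological_group :: "('a, 'm) monoid_scheme \<Rightarrow> 'a topology \<Rightarrow> bool" where
  "topological_group G T \<longleftrightarrow>
     group G \<and> topspace T = carrier G \<and>
     continuous_map (prod_topology T T) T (\<lambda>(x, y). x \<otimes>\<^bsub>G\<^esub> y) \<and>
     continuous_map T T (m_inv G)"

definition profinite_group :: "('a, 'm) monoid_scheme \<Rightarrow> 'a topology \<Rightarrow> bool" where
  "profinite_group G T \<longleftrightarrow>
     topological_group G T \<and> compact_space T \<and> Hausdorff_space T \<and>
     (\<forall>x \<in> topspace T. connected_component_of_set T x = {x})"

text \<open>The derived series here is that of the abstract group. In a Hausdorff topological group the
  \<open>l\<close>-th term of the series of closed derived subgroups is the closure of the \<open>l\<close>-th abstract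
  term, so it makes no difference which of the two series is required to reach the trivial
  subgroup.\<close>

definition soluble_of_derived_length_at_most :: "nat \<Rightarrow> ('a, 'm) monoid_scheme \<Rightarrow> bool" where
  "soluble_of_derived_length_at_most l G \<longleftrightarrow>
     group G \<and> (derived G ^^ l) (carrier G) = {\<one>\<^bsub>G\<^esub>}"

text \<open>\<open>F\<close> is free on the generators \<open>x 0, \<dots>, x (d - 1)\<close> in the category of profinite groups that are
  soluble of derived length at most \<open>l\<close>. HOL cannot quantify over all types inside a formula, so the
  test objects \<open>H\<close> have carrier inside \<open>nat \<Rightarrow> nat\<close>, a type with continuum many elements. This
  is the full universal property: every finite group has a copy on such a carrier, and so does every
  profinite group topologically generated by finitely many elements, since it embeds in a countable
  product of finite groups. In particular the free object itself has a copy there. Homomorphisms are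
  taken to be extensional so that uniqueness refers only to their values on \<open>carrier F\<close>.\<close>

definition free_soluble_profinite_on ::
    "nat \<Rightarrow> nat \<Rightarrow> ('a, 'm) monoid_scheme \<Rightarrow> 'a topology \<Rightarrow> (nat \<Rightarrow> 'a) \<Rightarrow> bool" where
  "free_soluble_profinite_on d l F T x \<longleftrightarrow>
     profinite_group F T \<and> soluble_of_derived_length_at_most l F \<and>
     (\<forall>i<d. x i \<in> carrier F) \<and>
     (\<forall>(H :: (nat \<Rightarrow> nat) monoid) U y.
        profinite_group H U \<and> soluble_of_derived_length_at_most l H \<and>
        (\<forall>i<d. y i \<in> carrier H) \<longrightarrow>
        (\<exists>!h. h \<in> extensional (carrier F) \<and> h \<in> hom F H \<and> continuous_map T U h \<and>
              (\<forall>i<d. h (x i) = y i)))"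

definition free_soluble_profinite ::
    "nat \<Rightarrow> nat \<Rightarrow> ('a, 'm) monoid_scheme \<Rightarrow> 'a topology \<Rightarrow> bool" where
  "free_soluble_profinite d l F T \<longleftrightarrow> (\<exists>x. free_soluble_profinite_on d l F T x)"

definition topologically_generates ::
    "('a, 'm) monoid_scheme \<Rightarrow> 'a topology \<Rightarrow> 'a set \<Rightarrow> bool" where
  "topologically_generates G T S \<longleftrightarrow>
     S \<subseteq> carrier G \<and> T closure_of (generate G S) = carrier G"

definition conjugate_by :: "('a, 'm) monoid_scheme \<Rightarrow> 'a \<Rightarrow> 'a \<Rightarrow> 'a" where
  "conjugate_by G s g = inv\<^bsub>G\<^esub> g \<otimes>\<^bsub>G\<^esub> s \<otimes>\<^bsub>G\<^esub> g"

definition invariably_generates ::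
    "('a, 'm) monoid_scheme \<Rightarrow> 'a topology \<Rightarrow> 'a set \<Rightarrow> bool" where
  "invariably_generates G T S \<longleftrightarrow>
     S \<subseteq> carrier G \<and>
     (\<forall>g \<in> S \<rightarrow> carrier G. topologically_generates G T ((\<lambda>s. conjugate_by G s (g s)) ` S))"

text \<open>Cardinalities are measured in \<open>enat\<close>, with all infinite cardinals identified with \<open>\<infinity>\<close>; the
  infimum is attained because \<open>enat\<close> is well-ordered.\<close>

definition d_I :: "('a, 'm) monoid_scheme \<Rightarrow> 'a topology \<Rightarrow> enat" where
  "d_I G T = (INF S \<in> {S. invariably_generates G T S}. if finite S then enat (card S) else \<infinity>)"

end

theory Submission
  imports
    Defs
    "HOL-Algebra.Multiplicative_Group"
    "HOL-Algebra.SndIsomorphismGrp"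
    "HOL-Algebra.Weak_Morphisms"
    "HOL-Computational_Algebra.Primes"
    "HOL-Number_Theory.Cong"
begin

text \<open>Write \<open>D j\<close> for the \<open>j\<close>-th term of the derived series of the free group \<open>F\<close>, with \<open>D 0 = F\<close>.

  \<^bold>\<open>Upper bound.\<close> One looks for \<open>d\<close> elements in \<open>D 0\<close> and \<open>d - 1\<close> elements in each of
  \<open>D 1, \<dots>, D (l - 1)\<close> such that no proper open subgroup contains a conjugate of each of them. Modulo an
  open normal subgroup they are found by going down a chief series. Let \<open>B/N\<close> be a chief factor and
  let \<open>D j\<close> be the last term with \<open>B \<subseteq> D j N\<close>. Suppose the elements are right modulo \<open>B\<close>. A proper
  subgroup \<open>H \<supseteq> N\<close> that contains conjugates of all of them satisfies \<open>H B = F\<close>, so it is a complement of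
  \<open>B\<close> modulo \<open>N\<close>. Since \<open>D j\<close> centralises \<open>B/N\<close>, for the elements at level \<open>j\<close> conjugation is
  harmless: they lie in \<open>H\<close> themselves. Now correct the level \<open>j\<close> elements by elements of \<open>B\<close>. Each
  complement spoils exactly one tuple of corrections, and \<open>d\<close> generators of \<open>F\<close> show that there are
  fewer than \<open>q ^ d\<close> complements, \<open>q\<close> being the order of \<open>B/N\<close>. That settles \<open>j = 0\<close>. For \<open>j > 0\<close> the
  factor is non-central if it has complements at all, complements then come in classes of \<open>q\<close>
  conjugates that spoil the same tuple, and \<open>d - 1\<close> corrections suffice
  (\<open>exists_correction_avoiding_complements\<close>, \<open>exists_invariable_generators_mod\<close>). Compactness of the
  space of families passes from the finite quotients to \<open>F\<close>
  (\<open>exists_small_invariable_generating_set\<close>).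

  \<^bold>\<open>Lower bound.\<close> Let \<open>S\<close> generate \<open>F\<close> invariably, let \<open>N\<close> be an open normal subgroup of index \<open>n\<close>
  containing \<open>D j\<close> with \<open>j < l\<close>, and let \<open>r\<close> be a prime that does not divide \<open>n\<close>. Freeness gives \<open>N\<close>
  the Schreier rank: its largest quotient of exponent \<open>r\<close> that is abelian has rank at least
  \<open>1 + (d - 1) n\<close>. On the other hand
  this quotient is generated by the conjugates of the powers \<open>s [^] m\<close> with \<open>s \<in> S\<close>, where \<open>m\<close> is the
  order of \<open>s\<close> modulo \<open>N\<close>: after dividing these out, \<open>s\<close> generates a cyclic group of order prime to
  \<open>r\<close>, hence has a conjugate in a complement of the image of \<open>N\<close>, and by invariable generation this
  complement is everything (\<open>cocycle_rigid\<close>). Modulo \<open>N\<close> there are only \<open>n / m\<close> conjugates of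
  \<open>s [^] m\<close>. If all orders \<open>m > 1\<close> exceed the size of \<open>S\<close>, then the elements of \<open>S\<close> outside \<open>N\<close>
  contribute fewer than \<open>n\<close> generators, so at least \<open>d - 1\<close> elements of \<open>S\<close> lie in \<open>N\<close> and are
  non-trivial in the quotient, and at least \<open>d\<close> if \<open>N = F\<close> (\<open>tower_step\<close>). Iterating with large primes
  along a series of length \<open>l\<close> starting at \<open>F\<close> produces disjoint parts of \<open>S\<close> of total size at
  least \<open>d + (l - 1) (d - 1)\<close>.

  Cocycles are represented by functions on the group. A homomorphism from \<open>N\<close> to \<open>\<int>/r\<close> is handled through an extension
  \<open>c\<close> to the whole group with \<open>c (t n) = c t + c n\<close> for \<open>n\<close> in \<open>N\<close>; such functions are the
  cocycles with values in the functions on the cosets of \<open>N\<close>, written as coboundaries of functions on the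
  group.\<close>

section \<open>Complements of an abelian normal subgroup\<close>

lemma (in group) inv_cancel [simp]:
  assumes "x \<in> carrier G" and "y \<in> carrier G"
  shows "x \<otimes> (inv x \<otimes> y) = y" and "inv x \<otimes> (x \<otimes> y) = y"
  using assms by (simp_all add: m_assoc[symmetric])

definition (in group) complements :: "'a set \<Rightarrow> 'a set set" where
  "complements B = {H. subgroup H G \<and> H \<inter> B = {\<one>} \<and> B <#> H = carrier G}"

text \<open>For a complement \<open>H\<close> of \<open>B\<close>, this is the inverse of the \<open>B\<close>-component of \<open>g\<close> in the decomposition
  \<open>B H\<close> of the group.\<close>

definition (in group) correction :: "'a set \<Rightarrow> 'a set \<Rightarrow> 'a \<Rightarrow> 'a" where
  "correction B H g = (THE b. b \<in> B \<and> b \<otimes> g \<in> H)"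

lemma (in group) correction_unique:
  assumes B: "subgroup B G" and H: "H \<in> complements B" and g: "g \<in> carrier G"
    and b: "b \<in> B" "b \<otimes> g \<in> H" and c: "c \<in> B" "c \<otimes> g \<in> H"
  shows "b = c"
proof -
  have sH: "subgroup H G" and HB: "H \<inter> B = {\<one>}"
    using H by (auto simp: complements_def)
  have bc: "b \<in> carrier G" "c \<in> carrier G"
    using b c subgroup.mem_carrier[OF B] by auto
  have "(b \<otimes> g) \<otimes> inv (c \<otimes> g) \<in> H"
    using b c sH by (simp add: subgroup.m_closed subgroup.m_inv_closed)
  also have "(b \<otimes> g) \<otimes> inv (c \<otimes> g) = b \<otimes> inv c"
    using g bc by (simp add: inv_mult_group m_assoc)
  finally have "b \<otimes> inv c \<in> H \<inter> B"
    using b c B by (simp add: subgroup.m_closed subgroup.m_inv_closed)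
  then have "b \<otimes> inv c = \<one>" using HB by auto
  then show ?thesis using bc by (metis inv_closed inv_equality inv_inv)
qed

lemma (in group) correction_eqI:
  assumes "subgroup B G" and "H \<in> complements B" and "g \<in> carrier G"
    and "b \<in> B" "b \<otimes> g \<in> H"
  shows "correction B H g = b"
  unfolding correction_def using assms by (blast intro: the_equality correction_unique)

lemma (in group) correction:
  assumes B: "subgroup B G" and H: "H \<in> complements B" and g: "g \<in> carrier G"
  shows "correction B H g \<in> B" "correction B H g \<otimes> g \<in> H"
proof -
  obtain h b where hb: "h \<in> H" "b \<in> B" "g = b \<otimes> h"
    using H g unfolding complements_def set_mult_def by blast
  have "h \<in> carrier G" "b \<in> carrier G"
    using hb H B by (auto simp: complements_def subgroup.mem_carrier)
  then have "inv b \<otimes> g = h" using hb by simp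
  then have "correction B H g = inv b"
    using hb B by (intro correction_eqI[OF B H g]) (auto simp: subgroup.m_inv_closed)
  then show "correction B H g \<in> B" "correction B H g \<otimes> g \<in> H"
    using \<open>inv b \<otimes> g = h\<close> hb B by (auto simp: subgroup.m_inv_closed)
qed

text \<open>A complement \<open>H\<close> is pinned down by the elements of \<open>B\<close> that move the generators of the
  group into \<open>H\<close>, and the tuple of identities does not occur because the generators themselves do
  not lie in a proper subgroup.\<close>

lemma (in group) card_complements_less:
  fixes x :: "nat \<Rightarrow> 'a" and d :: nat
  assumes nB: "B \<lhd> G" and fin: "finite B" and nt: "B \<noteq> {\<one>}"
    and x: "\<And>i. i < d \<Longrightarrow> x i \<in> carrier G"
    and gen: "\<And>H. subgroup H G \<Longrightarrow> (\<And>i. i < d \<Longrightarrow> x i \<in> H) \<Longrightarrow> H = carrier G"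
  shows "finite (complements B)" and "card (complements B) < card B ^ d"
proof -
  have B: "subgroup B G" using nB by (rule normal_imp_subgroup)
  define f where "f H = (\<lambda>i\<in>{..<d}. correction B H (x i))" for H
  define E where "E = ({..<d} \<rightarrow>\<^sub>E B) - {\<lambda>i\<in>{..<d}. \<one>}"
  have finE: "finite ({..<d} \<rightarrow>\<^sub>E B)" using fin by (simp add: finite_PiE)
  have "f ` complements B \<subseteq> E"
  proof
    fix u assume "u \<in> f ` complements B"
    then obtain H where H: "H \<in> complements B" and u: "u = f H" by auto
    have sH: "subgroup H G" using H by (auto simp: complements_def)
    have "u \<in> {..<d} \<rightarrow>\<^sub>E B"
      unfolding u f_def using correction[OF B H x] by auto
    moreover have "u \<noteq> (\<lambda>i\<in>{..<d}. \<one>)"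
    proof
      assume *: "u = (\<lambda>i\<in>{..<d}. \<one>)"
      have "x i \<in> H" if "i < d" for i
      proof -
        have "correction B H (x i) = \<one>"
          using fun_cong[OF *, of i] that by (simp add: u f_def)
        then show ?thesis using correction(2)[OF B H x[OF that]] x[OF that] by simp
      qed
      then have "H = carrier G" using gen sH by blast
      then have "B = {\<one>}" using H subgroup.subset[OF B] by (auto simp: complements_def)
      then show False using nt by simp
    qed
    ultimately show "u \<in> E" by (simp add: E_def)
  qed
  moreover have "inj_on f (complements B)"
  proof -
    have sub: "H \<subseteq> K" if H: "H \<in> complements B" and K: "K \<in> complements B" and eq: "f H = f K" for H K
    proof -
      interpret second_isomorphism_grp B G "H \<inter> K"
        using H K nB by (auto simp: complements_def second_isomorphism_grp_def
            second_isomorphism_grp_axioms_def subgroups_Inter_pair)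
      have "x i \<in> B <#> (H \<inter> K)" if i: "i < d" for i
      proof -
        define b where "b = correction B H (x i)"
        have b: "b \<in> B" "b \<otimes> x i \<in> H"
          using correction[OF B H x[OF i]] by (auto simp: b_def)
        moreover have "b = correction B K (x i)"
          using fun_cong[OF eq, of i] i by (simp add: f_def b_def)
        then have "b \<otimes> x i \<in> K" using correction[OF B K x[OF i]] by simp
        moreover have "x i = inv b \<otimes> (b \<otimes> x i)"
          using b(1) x[OF i] by (simp add: inv_solve_left)
        ultimately show ?thesis
          using m_inv_closed unfolding set_mult_def by blast
      qed
      then have *: "B <#> (H \<inter> K) = carrier G"
        using gen normal_set_mult_subgroup by blast
      show "H \<subseteq> K"
      proof
        fix h assume h: "h \<in> H"
        then have "h \<in> B <#> (H \<inter> K)"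
          using * H by (auto simp: complements_def dest: subgroup.mem_carrier)
        then obtain b k where bk: "b \<in> B" "k \<in> H \<inter> K" "h = b \<otimes> k"
          by (auto simp: set_mult_def)
        have "b = h \<otimes> inv k"
          using bk H by (auto simp: complements_def m_assoc dest: subgroup.mem_carrier)
        moreover have "h \<otimes> inv k \<in> H"
          using h bk(2) H by (auto simp: complements_def subgroup.m_closed subgroup.m_inv_closed)
        ultimately have "b \<in> H" by simp
        then have "b = \<one>" using H bk(1) by (auto simp: complements_def)
        then show "h \<in> K" using bk K by (auto simp: complements_def dest: subgroup.mem_carrier)
      qed
    qed
    then show ?thesis by (metis inj_onI subset_antisym)
  qed
  ultimately have "card (complements B) \<le> card E" "finite (complements B)"
    using finE by (auto simp: E_def intro: card_inj_on_le inj_on_finite)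
  moreover have "card E < card B ^ d"
  proof -
    have "card E < card ({..<d} \<rightarrow>\<^sub>E B)"
      unfolding E_def using subgroup.one_closed[OF B] finE
      by (intro psubset_card_mono) auto
    then show ?thesis by (simp add: card_PiE)
  qed
  ultimately show "finite (complements B)" and "card (complements B) < card B ^ d" by auto
qed

definition (in group) conj_set :: "'a \<Rightarrow> 'a set \<Rightarrow> 'a set" where
  "conj_set b H = (\<lambda>h. b \<otimes> h \<otimes> inv b) ` H"

lemma (in group) mem_conj_set_iff:
  assumes "b \<in> carrier G" and "H \<subseteq> carrier G" and "g \<in> carrier G"
  shows "g \<in> conj_set b H \<longleftrightarrow> inv b \<otimes> g \<otimes> b \<in> H"
proof
  assume "g \<in> conj_set b H"
  then obtain h where "h \<in> H" "g = b \<otimes> h \<otimes> inv b" by (auto simp: conj_set_def)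
  then show "inv b \<otimes> g \<otimes> b \<in> H"
    using assms by (simp add: m_assoc subsetD)
next
  assume *: "inv b \<otimes> g \<otimes> b \<in> H"
  have "g = b \<otimes> (inv b \<otimes> g \<otimes> b) \<otimes> inv b"
    using assms by (simp add: m_assoc)
  then show "g \<in> conj_set b H" using * unfolding conj_set_def by blast
qed

lemma (in group) subgroup_conj_set:
  assumes b: "b \<in> carrier G" and H: "subgroup H G"
  shows "subgroup (conj_set b H) G"
proof -
  note sub = subgroup.subset[OF H]
  have hom: "group_hom G G (\<lambda>h. b \<otimes> h \<otimes> inv b)"
    using b by (intro group_hom.intro is_group group_hom_axioms.intro homI) (simp_all add: m_assoc)
  show ?thesis
    unfolding conj_set_def by (rule group_hom.subgroup_img_is_subgroup[OF hom H])
qed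

lemma (in group) conj_set_complements:
  assumes nB: "B \<lhd> G" and b: "b \<in> B" and H: "H \<in> complements B"
  shows "conj_set b H \<in> complements B"
proof -
  interpret B: normal B G by (rule nB)
  have bc: "b \<in> carrier G" using b by (rule B.mem_carrier)
  have sH: "subgroup H G" and HB: "H \<inter> B = {\<one>}" and BH: "B <#> H = carrier G"
    using H by (auto simp: complements_def)
  note sub = subgroup.subset[OF sH]
  have "conj_set b H \<inter> B \<subseteq> {\<one>}"
  proof
    fix g assume g: "g \<in> conj_set b H \<inter> B"
    then have gc: "g \<in> carrier G" by auto
    have "inv b \<otimes> g \<otimes> b \<in> H \<inter> B"
      using g b gc bc mem_conj_set_iff[OF bc sub gc] by auto
    then have "inv b \<otimes> g \<otimes> b = \<one>" using HB by auto
    then have "b \<otimes> (inv b \<otimes> g \<otimes> b) \<otimes> inv b = \<one>" using bc by simp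
    then show "g \<in> {\<one>}" using gc bc by (simp add: m_assoc)
  qed
  moreover have "\<one> \<in> conj_set b H"
    using mem_conj_set_iff[OF bc sub one_closed] bc subgroup.one_closed[OF sH] by simp
  moreover have "B <#> conj_set b H = carrier G"
  proof
    show "B <#> conj_set b H \<subseteq> carrier G"
      using setmult_subset_G[OF B.subset subgroup.subset[OF subgroup_conj_set[OF bc sH]]] .
    show "carrier G \<subseteq> B <#> conj_set b H"
    proof
      fix g assume g: "g \<in> carrier G"
      then have "g \<in> B <#> H" using BH by simp
      then obtain c h where ch: "c \<in> B" "h \<in> H" "g = c \<otimes> h"
        by (auto simp: set_mult_def)
      then have hc: "h \<in> carrier G" "c \<in> carrier G" using sub by auto
      have "g = (c \<otimes> (h \<otimes> b \<otimes> inv h) \<otimes> inv b) \<otimes> (b \<otimes> h \<otimes> inv b)"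
        using ch hc bc by (simp add: m_assoc)
      moreover have "c \<otimes> (h \<otimes> b \<otimes> inv h) \<otimes> inv b \<in> B"
        using B.inv_op_closed2[OF hc(1) b] ch b by simp
      moreover have "b \<otimes> h \<otimes> inv b \<in> conj_set b H"
        using ch by (auto simp: conj_set_def)
      ultimately show "g \<in> B <#> conj_set b H" unfolding set_mult_def by blast
    qed
  qed
  ultimately show ?thesis
    using subgroup_conj_set[OF bc sH] by (auto simp: complements_def)
qed

text \<open>Let \<open>B\<close> be abelian with trivial intersection with the centre. An element of \<open>B\<close> that
  normalises a complement centralises it, hence centralises the whole group; so every complement has
  exactly \<open>card B\<close> conjugates under \<open>B\<close>.\<close>

lemma (in group) conj_set_inj_on:
  assumes nB: "B \<lhd> G" and ab: "\<And>b c. b \<in> B \<Longrightarrow> c \<in> B \<Longrightarrow> b \<otimes> c = c \<otimes> b"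
    and noncentral: "\<And>b. b \<in> B \<Longrightarrow> (\<And>g. g \<in> carrier G \<Longrightarrow> b \<otimes> g = g \<otimes> b) \<Longrightarrow> b = \<one>"
    and H: "H \<in> complements B"
  shows "inj_on (\<lambda>b. conj_set b H) B"
proof (rule inj_onI)
  interpret B: normal B G by (rule nB)
  have sH: "subgroup H G" and HB: "H \<inter> B = {\<one>}" and BH: "B <#> H = carrier G"
    using H by (auto simp: complements_def)
  note sub = subgroup.subset[OF sH]
  fix b c assume b: "b \<in> B" and c: "c \<in> B" and eq: "conj_set b H = conj_set c H"
  define e where "e = inv c \<otimes> b"
  have e: "e \<in> B" "e \<in> carrier G" using b c by (auto simp: e_def)
  have comm: "e \<otimes> h = h \<otimes> e" if h: "h \<in> H" for h
  proof -
    have hc: "h \<in> carrier G" using h sub by auto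
    have "b \<otimes> h \<otimes> inv b \<in> conj_set c H"
      using h eq by (auto simp: conj_set_def)
    then have "inv c \<otimes> (b \<otimes> h \<otimes> inv b) \<otimes> c \<in> H"
      using b c hc by (subst (asm) mem_conj_set_iff) (use sub in auto)
    also have "inv c \<otimes> (b \<otimes> h \<otimes> inv b) \<otimes> c = e \<otimes> h \<otimes> inv e"
      using b c hc by (simp add: e_def m_assoc inv_mult_group)
    finally have "e \<otimes> h \<otimes> inv e \<otimes> inv h \<in> H"
      using h sH by (simp add: subgroup.m_closed subgroup.m_inv_closed)
    moreover have "e \<otimes> h \<otimes> inv e \<otimes> inv h \<in> B"
      using B.inv_op_closed2[OF hc, of "inv e"] e hc by (simp add: m_assoc)
    ultimately have "e \<otimes> h \<otimes> inv e \<otimes> inv h = \<one>" using HB by auto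
    then have "(e \<otimes> h \<otimes> inv e \<otimes> inv h) \<otimes> (h \<otimes> e) = h \<otimes> e" using e hc by simp
    then show ?thesis using e hc by (simp add: m_assoc)
  qed
  have "e = \<one>"
  proof (rule noncentral[OF e(1)])
    fix g assume "g \<in> carrier G"
    then have "g \<in> B <#> H" using BH by simp
    then obtain a h where ah: "a \<in> B" "h \<in> H" "g = a \<otimes> h" by (auto simp: set_mult_def)
    then have hc: "h \<in> carrier G" "a \<in> carrier G" using sub by auto
    have "e \<otimes> g = (e \<otimes> a) \<otimes> h" using e hc ah by (simp add: m_assoc)
    also have "\<dots> = a \<otimes> (e \<otimes> h)" using ab[OF e(1) ah(1)] e hc by (simp add: m_assoc)
    also have "\<dots> = g \<otimes> e" using comm[OF ah(2)] e hc ah by (simp add: m_assoc)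
    finally show "e \<otimes> g = g \<otimes> e" .
  qed
  then show "b = c" using b c unfolding e_def by (metis B.mem_carrier inv_cancel(1) r_one)
qed

text \<open>Elements that commute with \<open>B\<close> are moved into a complement and into its conjugates under
  \<open>B\<close> by the same element of \<open>B\<close>.\<close>

lemma (in group) correction_conj_set:
  assumes nB: "B \<lhd> G" and ab: "\<And>b c. b \<in> B \<Longrightarrow> c \<in> B \<Longrightarrow> b \<otimes> c = c \<otimes> b"
    and H: "H \<in> complements B" and b: "b \<in> B"
    and a: "a \<in> carrier G" and comm: "\<And>c. c \<in> B \<Longrightarrow> a \<otimes> c = c \<otimes> a"
  shows "correction B (conj_set b H) a = correction B H a"
proof -
  interpret B: normal B G by (rule nB)
  note sB = normal_imp_subgroup[OF nB]
  define c where "c = correction B H a"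
  have c: "c \<in> B" "c \<otimes> a \<in> H" using correction[OF sB H a] by (auto simp: c_def)
  have car: "b \<in> carrier G" "c \<in> carrier G" using b c by auto
  have "b \<otimes> (c \<otimes> a) \<otimes> inv b = c \<otimes> a"
  proof -
    have "b \<otimes> (c \<otimes> a) = c \<otimes> (b \<otimes> a)"
      using ab[OF b c(1)] car a by (simp add: m_assoc[symmetric])
    also have "\<dots> = c \<otimes> (a \<otimes> b)" using comm[OF b] by simp
    finally show ?thesis using car a by (simp add: m_assoc)
  qed
  then have "c \<otimes> a \<in> conj_set b H"
    using c(2) unfolding conj_set_def by (metis (no_types) imageI)
  then show ?thesis
    using correction_eqI[OF sB conj_set_complements[OF nB b H] a c(1)] by (simp add: c_def)
qed

text \<open>The counting at the heart of the upper bound: a tuple of elements centralising \<open>B\<close> can be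
  corrected by \<open>B\<close> so as to lie in no complement. Only \<open>d\<close> entries are required by the bound on the
  number of complements, and one entry is saved when complements come in classes of
  \<open>card B\<close> conjugates.\<close>

lemma (in group) exists_correction_avoiding_complements:
  fixes x a :: "nat \<Rightarrow> 'a" and d n :: nat
  assumes nB: "B \<lhd> G" and fin: "finite B" and nt: "B \<noteq> {\<one>}"
    and ab: "\<And>b c. b \<in> B \<Longrightarrow> c \<in> B \<Longrightarrow> b \<otimes> c = c \<otimes> b"
    and x: "\<And>i. i < d \<Longrightarrow> x i \<in> carrier G"
    and gen: "\<And>H. subgroup H G \<Longrightarrow> (\<And>i. i < d \<Longrightarrow> x i \<in> H) \<Longrightarrow> H = carrier G"
    and a: "\<And>m. m < n \<Longrightarrow> a m \<in> carrier G"
    and comm: "\<And>m c. m < n \<Longrightarrow> c \<in> B \<Longrightarrow> a m \<otimes> c = c \<otimes> a m"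
    and n: "n = d \<or> n = d - 1 \<and>
      (\<forall>b\<in>B. (\<forall>g\<in>carrier G. b \<otimes> g = g \<otimes> b) \<longrightarrow> b = \<one>)"
    and d: "d \<ge> 1"
  shows "\<exists>b. (\<forall>m<n. b m \<in> B) \<and> (\<forall>H\<in>complements B. \<exists>m<n. b m \<otimes> a m \<notin> H)"
proof -
  note sB = normal_imp_subgroup[OF nB]
  have X: "finite (complements B)" "card (complements B) < card B ^ d"
    by (rule card_complements_less[OF nB fin nt, of d x]; fact x gen)+
  define f where "f H = (\<lambda>m\<in>{..<n}. correction B H (a m))" for H
  have fB: "f H \<in> {..<n} \<rightarrow>\<^sub>E B" if "H \<in> complements B" for H
    unfolding f_def using correction[OF sB that a] by auto
  have Bpos: "card B > 0" using fin sB by (auto simp: card_gt_0_iff dest: subgroup.one_closed)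
  have "card (f ` complements B) < card B ^ n"
  proof (cases "n = d")
    case True
    then show ?thesis using X card_image_le[where f = f, OF X(1)] by simp
  next
    case False
    then have n': "n = d - 1" and nc: "\<And>b. b \<in> B \<Longrightarrow> (\<And>g. g \<in> carrier G \<Longrightarrow> b \<otimes> g = g \<otimes> b) \<Longrightarrow> b = \<one>"
      using n by auto
    \<comment> \<open>one complement for each spoiled tuple; together with its conjugates it uses up \<open>card B\<close> complements\<close>
    define p where "p u = (SOME H. H \<in> complements B \<and> f H = u)" for u
    have p: "p u \<in> complements B" "f (p u) = u" if "u \<in> f ` complements B" for u
      using that someI_ex[of "\<lambda>H. H \<in> complements B \<and> f H = u"] by (auto simp: p_def)
    let ?g = "\<lambda>(u, b). conj_set b (p u)"
    have fconj: "f (conj_set b H) = f H" if "H \<in> complements B" "b \<in> B" for H b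
      unfolding f_def using correction_conj_set[OF nB ab that a comm] by (auto intro!: restrict_ext)
    have dn: "d = Suc n" using n' d by simp
    have "inj_on ?g (f ` complements B \<times> B)"
    proof (rule inj_onI, clarsimp, rule conjI)
      fix H K b c
      assume *: "H \<in> complements B" "K \<in> complements B" "b \<in> B" "c \<in> B"
        "conj_set b (p (f H)) = conj_set c (p (f K))"
      show eq: "f H = f K" using fconj[OF p(1) *(3), of "f H"] fconj[OF p(1) *(4), of "f K"] * p by simp
      show "b = c"
        using inj_onD[OF conj_set_inj_on[OF nB ab nc p(1)], of "f H" b c] * eq by simp
    qed
    moreover have "?g ` (f ` complements B \<times> B) \<subseteq> complements B"
      using conj_set_complements[OF nB _ p(1)] by auto
    ultimately have "card (f ` complements B \<times> B) \<le> card (complements B)"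
      using X(1) by (rule card_inj_on_le)
    then have "card (f ` complements B) * card B \<le> card (complements B)"
      by (simp only: card_cartesian_product)
    also have "\<dots> < card B ^ n * card B" using X(2) by (simp add: dn mult.commute)
    finally have "card (f ` complements B) * card B < card B ^ n * card B" .
    then show ?thesis using Bpos by simp
  qed
  also have "card B ^ n = card ({..<n} \<rightarrow>\<^sub>E B)" by (simp add: card_PiE)
  finally have "f ` complements B \<noteq> {..<n} \<rightarrow>\<^sub>E B" by auto
  then obtain b where b: "b \<in> {..<n} \<rightarrow>\<^sub>E B" "b \<notin> f ` complements B"
    using fB by blast
  have "\<exists>m<n. b m \<otimes> a m \<notin> H" if H: "H \<in> complements B" for H
  proof (rule ccontr)
    assume "\<not> (\<exists>m<n. b m \<otimes> a m \<notin> H)"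
    then have "correction B H (a m) = b m" if "m < n" for m
      using that b(1) by (intro correction_eqI[OF sB H a]) auto
    then have "b = f H"
      using b(1) by (intro PiE_ext[OF b(1) fB[OF H]]) (simp add: f_def)
    then show False using b(2) H by auto
  qed
  then show ?thesis using b(1) by (intro exI[of _ b]) auto
qed

section \<open>Chief factors and the derived series\<close>

text \<open>The number of generators placed in the \<open>j\<close>-th term of the derived series.\<close>

definition slots :: "nat \<Rightarrow> nat \<Rightarrow> nat" where
  "slots d j = (if j = 0 then d else d - 1)"

abbreviation (in group) derived_term :: "nat \<Rightarrow> 'a set" where
  "derived_term j \<equiv> (derived G ^^ j) (carrier G)"

lemma (in group) derived_term_normal: "derived_term j \<lhd> G"
  by (induction j) (auto intro: derived_is_normal normal_self)

lemma (in group) commutator_in_derived: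
  assumes "a \<in> H" and "b \<in> H"
  shows "a \<otimes> b \<otimes> inv a \<otimes> inv b \<in> derived G H"
  unfolding derived_def using assms by (intro generate.incl) blast

lemma (in group) derived_term_antimono:
  assumes "i \<le> j" shows "derived_term j \<subseteq> derived_term i"
  using assms
proof (induction j rule: dec_induct)
  case (step j)
  have "derived_term (Suc j) \<subseteq> derived_term j"
    using derived_incl[of "derived_term j" "derived_term j"]
      normal_imp_subgroup[OF derived_term_normal] by simp
  then show ?case using step by simp
qed simp

lemma (in group) commute_iff_commutator:
  assumes "a \<in> carrier G" and "b \<in> carrier G"
  shows "a \<otimes> b = b \<otimes> a \<longleftrightarrow> a \<otimes> b \<otimes> inv a \<otimes> inv b = \<one>"
proof
  assume "a \<otimes> b = b \<otimes> a"
  then show "a \<otimes> b \<otimes> inv a \<otimes> inv b = \<one>" using assms by (simp add: m_assoc)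
next
  assume "a \<otimes> b \<otimes> inv a \<otimes> inv b = \<one>"
  then have "(a \<otimes> b \<otimes> inv a \<otimes> inv b) \<otimes> (b \<otimes> a) = b \<otimes> a" using assms by simp
  then show "a \<otimes> b = b \<otimes> a" using assms by (simp add: m_assoc)
qed

text \<open>The group is a product of a central subgroup and \<open>H\<close>, so its commutators are commutators of \<open>H\<close>.\<close>

lemma (in group) derived_subset_complement_of_central:
  assumes H: "H \<in> complements B" and B: "B \<subseteq> carrier G"
    and central: "\<And>b g. b \<in> B \<Longrightarrow> g \<in> carrier G \<Longrightarrow> b \<otimes> g = g \<otimes> b"
  shows "derived_term 1 \<subseteq> H"
proof -
  have sH: "subgroup H G" and BH: "B <#> H = carrier G"
    using H by (auto simp: complements_def)
  note sub = subgroup.subset[OF sH]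
  have "derived_set G (carrier G) \<subseteq> H"
  proof clarify
    fix g k assume gk: "g \<in> carrier G" "k \<in> carrier G"
    then have "g \<in> B <#> H" "k \<in> B <#> H" using BH by simp_all
    then obtain b h c i where *: "b \<in> B" "h \<in> H" "g = b \<otimes> h" "c \<in> B" "i \<in> H" "k = c \<otimes> i"
      unfolding set_mult_def by blast
    then have car: "b \<in> carrier G" "h \<in> carrier G" "c \<in> carrier G" "i \<in> carrier G"
      using B sub by auto
    have "g \<otimes> k = b \<otimes> (h \<otimes> (c \<otimes> i))" using * car by (simp add: m_assoc)
    also have "\<dots> = b \<otimes> (c \<otimes> (h \<otimes> i))"
      using central[OF *(4) car(2)] car by (simp add: m_assoc[symmetric])
    finally have gk': "g \<otimes> k = (b \<otimes> c) \<otimes> (h \<otimes> i)" using car by (simp add: m_assoc)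
    have "k \<otimes> g = c \<otimes> (i \<otimes> (b \<otimes> h))" using * car by (simp add: m_assoc)
    also have "\<dots> = c \<otimes> (b \<otimes> (i \<otimes> h))"
      using central[OF *(1) car(4)] car by (simp add: m_assoc[symmetric])
    also have "\<dots> = (c \<otimes> b) \<otimes> (i \<otimes> h)" using car by (simp add: m_assoc)
    also have "c \<otimes> b = b \<otimes> c" using central[OF *(4) car(1)] .
    finally have kg: "k \<otimes> g = (b \<otimes> c) \<otimes> (i \<otimes> h)" .
    define z where "z = b \<otimes> c"
    have z: "z \<in> carrier G" "\<And>g. g \<in> carrier G \<Longrightarrow> z \<otimes> g = g \<otimes> z"
    proof -
      fix y assume y: "y \<in> carrier G"
      have "z \<otimes> y = b \<otimes> (y \<otimes> c)" using central[OF *(4) y] car y by (simp add: z_def m_assoc)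
      also have "\<dots> = y \<otimes> z"
        using central[OF *(1) y] car y by (simp add: z_def m_assoc[symmetric])
      finally show "z \<otimes> y = y \<otimes> z" .
    qed (use car in \<open>simp add: z_def\<close>)
    have "g \<otimes> k \<otimes> inv g \<otimes> inv k = (g \<otimes> k) \<otimes> inv (k \<otimes> g)"
      using gk by (simp add: inv_mult_group m_assoc)
    also have "\<dots> = z \<otimes> (h \<otimes> i) \<otimes> inv (z \<otimes> (i \<otimes> h))" unfolding gk' kg z_def ..
    also have "\<dots> = ((h \<otimes> i) \<otimes> z) \<otimes> inv ((i \<otimes> h) \<otimes> z)"
      using z(2)[of "h \<otimes> i"] z(2)[of "i \<otimes> h"] car by simp
    also have "\<dots> = (h \<otimes> i) \<otimes> inv (i \<otimes> h)"
      using z(1) car by (simp add: inv_mult_group m_assoc)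
    also have "\<dots> \<in> H" using * sH by (simp add: subgroup.m_closed subgroup.m_inv_closed)
    finally show "g \<otimes> k \<otimes> inv g \<otimes> inv k \<in> H" .
  qed
  then show ?thesis using generate_subgroup_incl[OF _ sH] by (simp add: derived_def)
qed

lemma (in group) centralizer_Int_normal:
  assumes "B \<lhd> G"
  shows "{b \<in> B. \<forall>g\<in>carrier G. b \<otimes> g = g \<otimes> b} \<lhd> G"
proof -
  interpret B: normal B G by (rule assms)
  let ?Z = "{b \<in> B. \<forall>g\<in>carrier G. b \<otimes> g = g \<otimes> b}"
  have "subgroup ?Z G"
  proof (rule subgroupI)
    show "?Z \<subseteq> carrier G" using B.subset by auto
    have "\<one> \<in> ?Z" by auto
    then show "?Z \<noteq> {}" by blast
    fix a assume a: "a \<in> ?Z"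
    then have ac: "a \<in> carrier G" by auto
    have "inv a \<otimes> g = g \<otimes> inv a" if g: "g \<in> carrier G" for g
    proof -
      have "a \<otimes> g = g \<otimes> a" using a g by auto
      then have "inv a \<otimes> (a \<otimes> g) \<otimes> inv a = inv a \<otimes> (g \<otimes> a) \<otimes> inv a" by simp
      then show ?thesis using ac g by (simp add: m_assoc)
    qed
    moreover have "a \<in> B" using a by blast
    then have "inv a \<in> B" by (rule B.m_inv_closed)
    ultimately show "inv a \<in> ?Z" by blast
    fix b assume b: "b \<in> ?Z"
    then have bc: "b \<in> carrier G" by auto
    have "a \<otimes> b \<otimes> g = g \<otimes> (a \<otimes> b)" if g: "g \<in> carrier G" for g
    proof -
      have "a \<otimes> g = g \<otimes> a" "b \<otimes> g = g \<otimes> b" using a b g by auto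
      then have "a \<otimes> b \<otimes> g = a \<otimes> (g \<otimes> b)" using ac bc g by (simp add: m_assoc)
      also have "\<dots> = (a \<otimes> g) \<otimes> b" using ac bc g by (simp add: m_assoc)
      also have "\<dots> = g \<otimes> (a \<otimes> b)" using \<open>a \<otimes> g = g \<otimes> a\<close> ac bc g by (simp add: m_assoc)
      finally show ?thesis .
    qed
    moreover have "a \<in> B" "b \<in> B" using a b by blast+
    then have "a \<otimes> b \<in> B" by (rule B.m_closed)
    ultimately show "a \<otimes> b \<in> ?Z" by blast
  qed
  moreover have "g \<otimes> z \<otimes> inv g = z" if "z \<in> ?Z" "g \<in> carrier G" for z g
  proof -
    have "g \<otimes> z = z \<otimes> g" "z \<in> carrier G" using that by auto
    then show ?thesis using that by (simp add: m_assoc)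
  qed
  ultimately show ?thesis by (simp add: normal_inv_iff)
qed

text \<open>Here \<open>j\<close> is the place of \<open>B\<close> in the derived series: \<open>B\<close> lies in the \<open>j\<close>-th term and, by
  minimality, meets the next term trivially. Hence the \<open>j\<close>-th term centralises \<open>B\<close>. If \<open>j > 0\<close> and \<open>B\<close>
  has a complement, then \<open>B\<close> cannot be central, since a complement of a central subgroup contains all
  commutators.\<close>

lemma (in group) minimal_normal_supplement:
  fixes x :: "nat \<Rightarrow> 'a" and d l :: nat
  assumes nB: "B \<lhd> G" and fin: "finite B" and nt: "B \<noteq> {\<one>}"
    and minimal: "\<And>M. M \<lhd> G \<Longrightarrow> M \<subseteq> B \<Longrightarrow> M = {\<one>} \<or> M = B"
    and x: "\<And>i. i < d \<Longrightarrow> x i \<in> carrier G"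
    and gen: "\<And>H. subgroup H G \<Longrightarrow> (\<And>i. i < d \<Longrightarrow> x i \<in> H) \<Longrightarrow> H = carrier G"
    and d: "d \<ge> 1" and sol: "derived_term l = {\<one>}"
  shows "\<exists>j<l. B \<subseteq> derived_term j \<and>
    (\<forall>a. (\<forall>m<slots d j. a m \<in> derived_term j) \<longrightarrow>
      (\<exists>b. (\<forall>m<slots d j. b m \<in> B) \<and>
        (\<forall>H. subgroup H G \<and> B <#> H = carrier G \<and>
             (\<forall>m<slots d j. \<exists>g\<in>carrier G. inv g \<otimes> (b m \<otimes> a m) \<otimes> g \<in> H)
           \<longrightarrow> H = carrier G)))"
proof -
  interpret B: normal B G by (rule nB)
  have notl: "\<not> B \<subseteq> derived_term l" using sol nt B.one_closed by auto
  \<comment> \<open>the first derived term that no longer contains \<open>B\<close>; the one before it is the term sought\<close>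
  define k where "k = (LEAST k. \<not> B \<subseteq> derived_term k)"
  have k: "\<not> B \<subseteq> derived_term k" "k \<le> l"
    unfolding k_def by (rule LeastI[of _ l], rule notl) (rule Least_le, rule notl)
  have "k \<noteq> 0" using k(1) B.subset by (intro notI) simp
  then obtain j where j: "k = Suc j" by (cases k) auto
  have Bj: "B \<subseteq> derived_term j" using not_less_Least[of j "\<lambda>k. \<not> B \<subseteq> derived_term k"] j
    by (auto simp: k_def)
  have "B \<inter> derived_term (Suc j) \<lhd> G"
    by (rule normal_subgroup_intersect[OF nB derived_term_normal])
  then have triv: "B \<inter> derived_term (Suc j) = {\<one>}"
    using minimal[of "B \<inter> derived_term (Suc j)"] k(1) j by blast
  have comm: "a \<otimes> b = b \<otimes> a" if a: "a \<in> derived_term j" and b: "b \<in> B" for a b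
  proof -
    have car: "a \<in> carrier G" "b \<in> carrier G"
      using a b exp_of_derived_in_carrier[OF subset_refl] by auto
    have "a \<otimes> b \<otimes> inv a \<otimes> inv b \<in> derived_term (Suc j)"
      using commutator_in_derived[OF a, of b] b Bj by auto
    moreover have "a \<otimes> b \<otimes> inv a \<otimes> inv b \<in> B"
      using B.inv_op_closed2[OF car(1) b] b by simp
    ultimately have "a \<otimes> b \<otimes> inv a \<otimes> inv b = \<one>" using triv by auto
    then show ?thesis using commute_iff_commutator[OF car] by simp
  qed
  have ab: "b \<otimes> c = c \<otimes> b" if "b \<in> B" "c \<in> B" for b c
    using comm that Bj by auto
  have step: "\<exists>b. (\<forall>m<slots d j. b m \<in> B) \<and> (\<forall>H\<in>complements B. \<exists>m<slots d j. b m \<otimes> a m \<notin> H)"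
    if a: "\<And>m. m < slots d j \<Longrightarrow> a m \<in> derived_term j" for a
  proof (cases "complements B = {}")
    case True
    then show ?thesis by (auto intro: exI[of _ "\<lambda>_. \<one>"])
  next
    case False
    then obtain H where H: "H \<in> complements B" by auto
    have n: "slots d j = d \<or> slots d j = d - 1 \<and>
      (\<forall>b\<in>B. (\<forall>g\<in>carrier G. b \<otimes> g = g \<otimes> b) \<longrightarrow> b = \<one>)"
    proof (cases "j = 0")
      case False
      let ?Z = "{b \<in> B. \<forall>g\<in>carrier G. b \<otimes> g = g \<otimes> b}"
      have "?Z \<noteq> B"
      proof
        assume "?Z = B"
        then have "derived_term 1 \<subseteq> H"
          by (intro derived_subset_complement_of_central[OF H B.subset]) blast
        then have "B \<subseteq> H" using Bj derived_term_antimono[of 1 j] False by simp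
        then show False using H nt by (auto simp: complements_def)
      qed
      then have "?Z = {\<one>}" using minimal[OF centralizer_Int_normal[OF nB]] by blast
      then show ?thesis using False by (auto simp: slots_def)
    qed (simp add: slots_def)
    show ?thesis
    proof (rule exists_correction_avoiding_complements[OF nB fin nt, where x = x and d = d])
      show "a m \<in> carrier G" if "m < slots d j" for m
        using a[OF that] exp_of_derived_in_carrier[OF subset_refl] by blast
      show "a m \<otimes> c = c \<otimes> a m" if "m < slots d j" "c \<in> B" for m c
        using comm a that by simp
    qed (fact ab x gen d n)+
  qed
  have final: "H = carrier G"
    if b: "\<And>m. m < slots d j \<Longrightarrow> b m \<in> B" and a: "\<And>m. m < slots d j \<Longrightarrow> a m \<in> derived_term j"
      and avoid: "\<And>H. H \<in> complements B \<Longrightarrow> \<exists>m<slots d j. b m \<otimes> a m \<notin> H"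
      and sH: "subgroup H G" and BH: "B <#> H = carrier G"
      and conj: "\<And>m. m < slots d j \<Longrightarrow> \<exists>g\<in>carrier G. inv g \<otimes> (b m \<otimes> a m) \<otimes> g \<in> H" for a b H
  proof (rule ccontr)
    assume ne: "H \<noteq> carrier G"
    note sub = subgroup.subset[OF sH]
    have decomp: "\<exists>c h. c \<in> B \<and> h \<in> H \<and> g = c \<otimes> h \<and> c \<in> carrier G \<and> h \<in> carrier G"
      if "g \<in> carrier G" for g
    proof -
      have "g \<in> B <#> H" using that BH by simp
      then show ?thesis using sub B.subset unfolding set_mult_def by blast
    qed
    have "H \<inter> B \<lhd> G"
      unfolding normal_inv_iff
    proof (intro conjI ballI)
      show "subgroup (H \<inter> B) G" by (rule subgroups_Inter_pair[OF sH B.is_subgroup])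
      fix g y assume g: "g \<in> carrier G" and y: "y \<in> H \<inter> B"
      obtain c h where ch: "c \<in> B" "h \<in> H" "g = c \<otimes> h" and car: "c \<in> carrier G" "h \<in> carrier G"
        using decomp[OF g] by blast
      have yc: "y \<in> carrier G" using y by auto
      define z where "z = h \<otimes> y \<otimes> inv h"
      have z: "z \<in> H \<inter> B"
        using y ch(2) sH B.inv_op_closed2[OF car(2), of y] unfolding z_def
        by (auto simp: subgroup.m_closed subgroup.m_inv_closed)
      have "g \<otimes> y \<otimes> inv g = c \<otimes> z \<otimes> inv c"
        using ch car yc by (simp add: z_def m_assoc inv_mult_group)
      also have "c \<otimes> z = z \<otimes> c" using ab ch z by auto
      finally show "g \<otimes> y \<otimes> inv g \<in> H \<inter> B" using z car ch by (auto simp: m_assoc)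
    qed
    moreover have "H \<inter> B \<noteq> B"
    proof
      assume "H \<inter> B = B"
      then have "B \<subseteq> H" by blast
      then have "B <#> H \<subseteq> H"
        using sH by (auto simp: set_mult_def subgroup.m_closed)
      then show False using ne BH sub by auto
    qed
    ultimately have "H \<inter> B = {\<one>}" using minimal[of "H \<inter> B"] by auto
    then have "H \<in> complements B" using sH BH by (simp add: complements_def)
    then obtain m where m: "m < slots d j" "b m \<otimes> a m \<notin> H" using avoid by blast
    obtain g where g: "g \<in> carrier G" "inv g \<otimes> (b m \<otimes> a m) \<otimes> g \<in> H" using conj[OF m(1)] by blast
    obtain c h where ch: "c \<in> B" "h \<in> H" "g = c \<otimes> h" and car: "c \<in> carrier G" "h \<in> carrier G"
      using decomp[OF g(1)] by blast
    define y where "y = b m \<otimes> a m"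
    have "y \<in> derived_term j"
      using a[OF m(1)] b[OF m(1)] Bj normal_imp_subgroup[OF derived_term_normal[of j]]
      by (auto simp: y_def subgroup.m_closed)
    then have y: "y \<otimes> c = c \<otimes> y" "y \<in> carrier G"
      using comm ch exp_of_derived_in_carrier[OF subset_refl] by auto
    have "inv g \<otimes> y \<otimes> g = inv h \<otimes> (inv c \<otimes> (y \<otimes> c)) \<otimes> h"
      using ch car y(2) by (simp add: m_assoc inv_mult_group)
    also have "\<dots> = inv h \<otimes> y \<otimes> h" using y car by simp
    finally have "inv h \<otimes> y \<otimes> h \<in> H" using g(2) by (simp add: y_def)
    then have "h \<otimes> (inv h \<otimes> y \<otimes> h) \<otimes> inv h \<in> H"
      using ch by (simp add: subgroup.m_closed[OF sH] subgroup.m_inv_closed[OF sH])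
    then show False using m(2) y car by (simp add: m_assoc y_def)
  qed
  have "j < l" using k(2) j by simp
  show ?thesis
  proof (rule exI[of _ j], intro conjI allI impI)
    fix a :: "nat \<Rightarrow> 'a" assume a: "\<forall>m<slots d j. a m \<in> derived_term j"
    then obtain b where b: "\<forall>m<slots d j. b m \<in> B" "\<forall>H\<in>complements B. \<exists>m<slots d j. b m \<otimes> a m \<notin> H"
      using step[of a] by blast
    then show "\<exists>b. (\<forall>m<slots d j. b m \<in> B) \<and>
        (\<forall>H. subgroup H G \<and> B <#> H = carrier G \<and>
             (\<forall>m<slots d j. \<exists>g\<in>carrier G. inv g \<otimes> (b m \<otimes> a m) \<otimes> g \<in> H)
           \<longrightarrow> H = carrier G)"
    proof (intro exI[of _ b] conjI allI impI)
      fix H assume H: "subgroup H G \<and> B <#> H = carrier G \<and>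
             (\<forall>m<slots d j. \<exists>g\<in>carrier G. inv g \<otimes> (b m \<otimes> a m) \<otimes> g \<in> H)"
      show "H = carrier G"
      proof (rule final)
        show "b m \<in> B" "a m \<in> derived_term j" if "m < slots d j" for m
          using a b(1) that by blast+
        show "\<exists>m<slots d j. b m \<otimes> a m \<notin> K" if "K \<in> complements B" for K
          using b(2) that by blast
        show "\<exists>g\<in>carrier G. inv g \<otimes> (b m \<otimes> a m) \<otimes> g \<in> H" if "m < slots d j" for m
          using H that by blast
      qed (use H in blast)+
    qed (use b(1) in blast)
  qed fact+
qed

text \<open>The previous lemma applied in the quotient by \<open>N\<close>. The corrections can be lifted into the derived
  term itself, because \<open>B\<close> and \<open>B \<inter> derived_term j\<close> have the same image.\<close>

lemma (in group) chief_factor_supplement: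
  fixes x :: "nat \<Rightarrow> 'a" and d l :: nat
  assumes nN: "N \<lhd> G" and fin: "finite (rcosets N)" and nB: "B \<lhd> G" and NB: "N \<subset> B"
    and minimal: "\<And>M. M \<lhd> G \<Longrightarrow> N \<subseteq> M \<Longrightarrow> M \<subseteq> B \<Longrightarrow> M = N \<or> M = B"
    and x: "\<And>i. i < d \<Longrightarrow> x i \<in> carrier G"
    and gen: "\<And>H. subgroup H G \<Longrightarrow> N \<subseteq> H \<Longrightarrow> (\<And>i. i < d \<Longrightarrow> x i \<in> H) \<Longrightarrow> H = carrier G"
    and d: "d \<ge> 1" and sol: "derived_term l = {\<one>}"
  shows "\<exists>j<l. \<forall>a. (\<forall>m<slots d j. a m \<in> derived_term j) \<longrightarrow>
      (\<exists>b. (\<forall>m<slots d j. b m \<in> B \<inter> derived_term j) \<and>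
        (\<forall>H. subgroup H G \<and> N \<subseteq> H \<and> B <#> H = carrier G \<and>
             (\<forall>m<slots d j. \<exists>g\<in>carrier G. inv g \<otimes> (b m \<otimes> a m) \<otimes> g \<in> H)
           \<longrightarrow> H = carrier G))"
proof -
  interpret N: normal N G by (rule nN)
  interpret B: normal B G by (rule nB)
  define Q where "Q = G Mod N"
  define p where "p g = N #> g" for g
  interpret Q: group Q unfolding Q_def by (rule N.factorgroup_is_group)
  have phom: "p \<in> hom G Q" unfolding p_def Q_def by (rule N.r_coset_hom_Mod)
  interpret p: group_hom G Q p
    by (intro group_hom.intro group_hom_axioms.intro is_group Q.is_group phom)
  have carQ: "carrier Q = p ` carrier G" by (simp add: Q_def p_def carrier_FactGroup)
  have p_eq: "\<exists>n\<in>N. g = n \<otimes> h" if "p g = p h" "g \<in> carrier G" "h \<in> carrier G" for g h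
  proof -
    have "g \<in> N #> h" using that rcos_self[OF that(2) N.is_subgroup] by (simp add: p_def)
    then show ?thesis by (auto simp: r_coset_def)
  qed
  have p_one: "p n = \<one>\<^bsub>Q\<^esub>" if "n \<in> N" for n
    using that N.rcos_const[OF is_group] by (simp add: p_def Q_def)
  have vimage: "subgroup {g \<in> carrier G. p g \<in> H} G" "N \<subseteq> {g \<in> carrier G. p g \<in> H}"
    if H: "subgroup H Q" for H
  proof -
    show "subgroup {g \<in> carrier G. p g \<in> H} G"
      using H by (intro subgroup.intro)
        (auto simp: subgroup.m_closed subgroup.m_inv_closed subgroup.one_closed)
    show "N \<subseteq> {g \<in> carrier G. p g \<in> H}"
      using p_one H by (auto simp: subgroup.one_closed)
  qed
  have nBQ: "p ` B \<lhd> Q"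
    by (rule B.surj_hom_normal_subgroup[OF p.group_hom_axioms carQ[symmetric]])
  have "\<exists>j<l. p ` B \<subseteq> Q.derived_term j \<and>
    (\<forall>a. (\<forall>m<slots d j. a m \<in> Q.derived_term j) \<longrightarrow>
      (\<exists>b. (\<forall>m<slots d j. b m \<in> p ` B) \<and>
        (\<forall>H. subgroup H Q \<and> p ` B <#>\<^bsub>Q\<^esub> H = carrier Q \<and>
             (\<forall>m<slots d j. \<exists>g\<in>carrier Q. inv\<^bsub>Q\<^esub> g \<otimes>\<^bsub>Q\<^esub> (b m \<otimes>\<^bsub>Q\<^esub> a m) \<otimes>\<^bsub>Q\<^esub> g \<in> H)
           \<longrightarrow> H = carrier Q)))"
  proof (rule Q.minimal_normal_supplement[where x = "p \<circ> x", OF nBQ])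
    have "p ` B \<subseteq> rcosets N" 
      using rcosetsI[OF N.subset B.mem_carrier] by (auto simp: p_def)
    then show "finite (p ` B)" using fin by (rule finite_subset)
    obtain b where b: "b \<in> B" "b \<notin> N" using NB by auto
    have "p b \<noteq> \<one>\<^bsub>Q\<^esub>"
      using b rcos_self[OF B.mem_carrier[OF b(1)] N.is_subgroup] by (auto simp: p_def Q_def)
    then show "p ` B \<noteq> {\<one>\<^bsub>Q\<^esub>}" using b by auto
  next
    fix M assume M: "M \<lhd> Q" "M \<subseteq> p ` B"
    let ?M = "{g \<in> carrier G. p g \<in> M}"
    have sM: "subgroup M Q" using M(1) by (rule normal_imp_subgroup)
    have "?M \<lhd> G"
      unfolding normal_inv_iff
    proof (intro conjI ballI)
      show "subgroup ?M G" using vimage[OF sM] by blast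
      fix g y assume "g \<in> carrier G" "y \<in> ?M"
      then show "g \<otimes> y \<otimes> inv g \<in> ?M"
        using normal.inv_op_closed2[OF M(1), of "p g" "p y"] by auto
    qed
    moreover have "?M \<subseteq> B"
    proof clarify
      fix g assume g: "g \<in> carrier G" "p g \<in> M"
      then obtain b where b: "b \<in> B" "p g = p b" using M(2) by auto
      obtain n where "n \<in> N" "g = n \<otimes> b" using p_eq[OF b(2) g(1)] b(1) by auto
      then show "g \<in> B" using NB b by auto
    qed
    ultimately have "?M = N \<or> ?M = B"
      using minimal[of ?M] vimage(2)[OF sM] by blast
    moreover have "M = p ` ?M" using M(2) B.subset by (auto simp: image_iff)
    ultimately show "M = {\<one>\<^bsub>Q\<^esub>} \<or> M = p ` B"
      using p_one N.one_closed by (metis (no_types, lifting) image_cong image_constant)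
  next
    show "(p \<circ> x) i \<in> carrier Q" if "i < d" for i using x[OF that] by simp
  next
    fix H assume H: "subgroup H Q" "\<And>i. i < d \<Longrightarrow> (p \<circ> x) i \<in> H"
    have "{g \<in> carrier G. p g \<in> H} = carrier G"
      using H x by (intro gen vimage) auto
    then show "H = carrier Q" using subgroup.subset[OF H(1)] carQ by auto
  next
    have "Q.derived_term l = p ` derived_term l"
      using p.exp_of_derived_img[OF subset_refl, of l] by (simp add: carQ)
    then show "Q.derived_term l = {\<one>\<^bsub>Q\<^esub>}" by (simp add: sol)
  qed fact
  then obtain j where j: "j < l" "p ` B \<subseteq> Q.derived_term j" and
    step: "\<forall>a. (\<forall>m<slots d j. a m \<in> Q.derived_term j) \<longrightarrow>
      (\<exists>b. (\<forall>m<slots d j. b m \<in> p ` B) \<and>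
        (\<forall>H. subgroup H Q \<and> p ` B <#>\<^bsub>Q\<^esub> H = carrier Q \<and>
             (\<forall>m<slots d j. \<exists>g\<in>carrier Q. inv\<^bsub>Q\<^esub> g \<otimes>\<^bsub>Q\<^esub> (b m \<otimes>\<^bsub>Q\<^esub> a m) \<otimes>\<^bsub>Q\<^esub> g \<in> H)
           \<longrightarrow> H = carrier Q))" by (elim exE conjE)
  have dQ: "Q.derived_term j = p ` derived_term j"
    using p.exp_of_derived_img[OF subset_refl, of j] by (simp add: carQ)
  show ?thesis
  proof (rule exI[of _ j], intro conjI allI impI)
    fix a :: "nat \<Rightarrow> 'a" assume a: "\<forall>m<slots d j. a m \<in> derived_term j"
    have ac: "a m \<in> carrier G" if "m < slots d j" for m
      using a that exp_of_derived_in_carrier[OF subset_refl] by blast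
    have "\<forall>m<slots d j. (p \<circ> a) m \<in> Q.derived_term j" using a dQ by simp
    from step[THEN spec, THEN mp, OF this]
    obtain b where b: "\<forall>m<slots d j. b m \<in> p ` B"
      and bH: "\<forall>H. subgroup H Q \<and> p ` B <#>\<^bsub>Q\<^esub> H = carrier Q \<and>
             (\<forall>m<slots d j. \<exists>g\<in>carrier Q. inv\<^bsub>Q\<^esub> g \<otimes>\<^bsub>Q\<^esub> (b m \<otimes>\<^bsub>Q\<^esub> (p \<circ> a) m) \<otimes>\<^bsub>Q\<^esub> g \<in> H)
             \<longrightarrow> H = carrier Q"
      by (elim exE conjE)
    have "\<exists>c. c \<in> B \<inter> derived_term j \<and> p c = b m" if m: "m < slots d j" for m
    proof -
      obtain e where e: "e \<in> B" "b m = p e" using b m by auto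
      then obtain c where c: "c \<in> derived_term j" "p c = p e" using j(2) dQ by auto
      then have cc: "c \<in> carrier G" using exp_of_derived_in_carrier[OF subset_refl] by blast
      then obtain n where "n \<in> N" "c = n \<otimes> e" using p_eq[OF c(2)] e by auto
      then have "c \<in> B" using NB e by auto
      then show ?thesis using c e by auto
    qed
    then obtain c where c: "\<And>m. m < slots d j \<Longrightarrow> c m \<in> B \<inter> derived_term j \<and> p (c m) = b m" by metis
    have "H = carrier G" if sH: "subgroup H G" and NH: "N \<subseteq> H" and BH: "B <#> H = carrier G"
      and conj: "\<And>m. m < slots d j \<Longrightarrow> \<exists>g\<in>carrier G. inv g \<otimes> (c m \<otimes> a m) \<otimes> g \<in> H" for H
    proof -
      have "p ` H = carrier Q"
      proof (rule bH[THEN spec, THEN mp], intro conjI)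
        show "subgroup (p ` H) Q" by (rule p.subgroup_img_is_subgroup[OF sH])
        show "p ` B <#>\<^bsub>Q\<^esub> p ` H = carrier Q"
          using set_mult_hom[OF phom B.subset subgroup.subset[OF sH]] BH by (simp add: carQ)
        show "\<forall>m<slots d j. \<exists>g\<in>carrier Q. inv\<^bsub>Q\<^esub> g \<otimes>\<^bsub>Q\<^esub> (b m \<otimes>\<^bsub>Q\<^esub> (p \<circ> a) m) \<otimes>\<^bsub>Q\<^esub> g \<in> p ` H"
        proof (intro allI impI)
          fix m assume m: "m < slots d j"
          obtain g where g: "g \<in> carrier G" "inv g \<otimes> (c m \<otimes> a m) \<otimes> g \<in> H" using conj[OF m] by blast
          have "p (inv g \<otimes> (c m \<otimes> a m) \<otimes> g) = inv\<^bsub>Q\<^esub> (p g) \<otimes>\<^bsub>Q\<^esub> (b m \<otimes>\<^bsub>Q\<^esub> p (a m)) \<otimes>\<^bsub>Q\<^esub> p g"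
            using g(1) c[OF m] ac[OF m] by auto
          then show "\<exists>g\<in>carrier Q. inv\<^bsub>Q\<^esub> g \<otimes>\<^bsub>Q\<^esub> (b m \<otimes>\<^bsub>Q\<^esub> (p \<circ> a) m) \<otimes>\<^bsub>Q\<^esub> g \<in> p ` H"
            using g by (intro bexI[of _ "p g"]) (auto simp: image_iff intro!: bexI[of _ "inv g \<otimes> (c m \<otimes> a m) \<otimes> g"])
        qed
      qed
      show ?thesis
      proof
        show "H \<subseteq> carrier G" by (rule subgroup.subset[OF sH])
        show "carrier G \<subseteq> H"
        proof
          fix g assume g: "g \<in> carrier G"
          then have "p g \<in> p ` H" using \<open>p ` H = carrier Q\<close> by simp
          then obtain h where h: "h \<in> H" "p g = p h" by auto
          obtain n where "n \<in> N" "g = n \<otimes> h" using p_eq[OF h(2) g] h sH by (auto dest: subgroup.mem_carrier)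
          then show "g \<in> H" using NH h sH by (auto simp: subgroup.m_closed)
        qed
      qed
    qed
    then show "\<exists>b. (\<forall>m<slots d j. b m \<in> B \<inter> derived_term j) \<and>
        (\<forall>H. subgroup H G \<and> N \<subseteq> H \<and> B <#> H = carrier G \<and>
             (\<forall>m<slots d j. \<exists>g\<in>carrier G. inv g \<otimes> (b m \<otimes> a m) \<otimes> g \<in> H)
           \<longrightarrow> H = carrier G)"
      using c by (intro exI[of _ c]) blast
  qed (rule j(1))
qed

section \<open>Invariable generation modulo a normal subgroup of finite index\<close>

lemma (in group) finite_normal_above:
  assumes N: "subgroup N G" and fin: "finite (rcosets N)"
  shows "finite {M. M \<lhd> G \<and> N \<subseteq> M}"
proof -
  let ?f = "\<lambda>M. {C \<in> rcosets N. C \<subseteq> M}"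
  have "\<Union> (?f M) = M" if M: "M \<lhd> G" "N \<subseteq> M" for M
  proof
    show "M \<subseteq> \<Union> (?f M)"
    proof
      fix m assume m: "m \<in> M"
      have sM: "subgroup M G" using M(1) by (rule normal_imp_subgroup)
      have mc: "m \<in> carrier G" using sM m by (rule subgroup.mem_carrier)
      have "N #> m \<subseteq> M" using m M(2) sM by (auto simp: r_coset_def subgroup.m_closed)
      then show "m \<in> \<Union> (?f M)"
        using rcos_self[OF mc N] rcosetsI[OF subgroup.subset[OF N] mc] by blast
    qed
  qed auto
  then have "inj_on ?f {M. M \<lhd> G \<and> N \<subseteq> M}" by (metis (no_types, lifting) inj_onI mem_Collect_eq)
  moreover have "?f ` {M. M \<lhd> G \<and> N \<subseteq> M} \<subseteq> Pow (rcosets N)" by auto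
  ultimately show ?thesis using fin by (meson finite_Pow_iff inj_on_finite)
qed

lemma (in group) finite_rcosets_mono:
  assumes N: "subgroup N G" and fin: "finite (rcosets N)" and M: "subgroup M G" and NM: "N \<subseteq> M"
  shows "finite (rcosets M)"
proof -
  have "M #> g = M <#> (N #> g)" if g: "g \<in> carrier G" for g
  proof -
    have "M <#> N = M"
    proof
      show "M <#> N \<subseteq> M" using NM M by (auto simp: set_mult_def subgroup.m_closed)
      have "m = m \<otimes> \<one>" if "m \<in> M" for m using M that by (simp add: subgroup.mem_carrier)
      then show "M \<subseteq> M <#> N" using subgroup.one_closed[OF N] unfolding set_mult_def by blast
    qed
    then show ?thesis
      using setmult_rcos_assoc[OF subgroup.subset[OF M] subgroup.subset[OF N] g] by simp
  qed
  then have "rcosets M \<subseteq> (\<lambda>C. M <#> C) ` (rcosets N)"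
    using rcosetsI[OF subgroup.subset[OF N]] by (auto simp: RCOSETS_def)
  then show ?thesis using fin by (rule finite_surj[rotated])
qed

text \<open>Induction down a chief series. A subgroup \<open>H\<close> containing conjugates of the corrected family
  yields \<open>B H\<close>, which contains conjugates of the original one, so \<open>B H\<close> is the whole group and the
  choice of the corrections applies to \<open>H\<close>.\<close>

theorem (in group) exists_invariable_generators_mod:
  fixes x :: "nat \<Rightarrow> 'a" and d l :: nat
  assumes nN: "N \<lhd> G" and fin: "finite (rcosets N)"
    and x: "\<And>i. i < d \<Longrightarrow> x i \<in> carrier G"
    and gen: "\<And>H. subgroup H G \<Longrightarrow> N \<subseteq> H \<Longrightarrow> (\<And>i. i < d \<Longrightarrow> x i \<in> H) \<Longrightarrow> H = carrier G"
    and d: "d \<ge> 1" and sol: "derived_term l = {\<one>}"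
  shows "\<exists>a. (\<forall>j<l. \<forall>m<slots d j. a j m \<in> derived_term j) \<and>
    (\<forall>H. subgroup H G \<and> N \<subseteq> H \<and>
         (\<forall>j<l. \<forall>m<slots d j. \<exists>g\<in>carrier G. inv g \<otimes> a j m \<otimes> g \<in> H) \<longrightarrow> H = carrier G)"
proof -
  define \<N> where "\<N> = {M. M \<lhd> G \<and> N \<subseteq> M}"
  have fin\<N>: "finite \<N>"
    unfolding \<N>_def by (rule finite_normal_above[OF normal_imp_subgroup[OF nN] fin])
  have "M \<in> \<N> \<Longrightarrow> \<exists>a. (\<forall>j<l. \<forall>m<slots d j. a j m \<in> derived_term j) \<and>
    (\<forall>H. subgroup H G \<and> M \<subseteq> H \<and>
         (\<forall>j<l. \<forall>m<slots d j. \<exists>g\<in>carrier G. inv g \<otimes> a j m \<otimes> g \<in> H) \<longrightarrow> H = carrier G)" for M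
  proof (induction "card {B \<in> \<N>. M \<subset> B}" arbitrary: M rule: less_induct)
    case less
    have M: "M \<lhd> G" "N \<subseteq> M" using less.prems by (auto simp: \<N>_def)
    show ?case
    proof (cases "M = carrier G")
      case True
      have "\<one> \<in> derived_term j" for j
        using normal_imp_subgroup[OF derived_term_normal[of j]] by (rule subgroup.one_closed)
      then show ?thesis using True
        by (intro exI[of _ "\<lambda>_ _. \<one>"]) (auto dest: subgroup.subset)
    next
      case False
      have "carrier G \<in> {B \<in> \<N>. M \<subset> B}"
        using False M nN by (auto simp: \<N>_def normal_self dest: normal_imp_subgroup subgroup.subset)
      moreover have "finite {B \<in> \<N>. M \<subset> B}" using fin\<N> by simp
      ultimately obtain B where B: "B \<in> {B \<in> \<N>. M \<subset> B}"
        and Bmin: "\<And>C. C \<in> {B \<in> \<N>. M \<subset> B} \<Longrightarrow> C \<subseteq> B \<Longrightarrow> B = C"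
        by (metis (no_types, lifting) finite_has_minimal2)
      have nB: "B \<lhd> G" and MB: "M \<subset> B" using B by (auto simp: \<N>_def)
      have "{C \<in> \<N>. B \<subset> C} \<subset> {C \<in> \<N>. M \<subset> C}" using B by auto
      then have "card {C \<in> \<N>. B \<subset> C} < card {C \<in> \<N>. M \<subset> C}"
        using fin\<N> by (intro psubset_card_mono) auto
      then obtain a where A: "\<forall>j<l. \<forall>m<slots d j. a j m \<in> derived_term j"
        and AH: "\<forall>H. subgroup H G \<and> B \<subseteq> H \<and>
         (\<forall>j<l. \<forall>m<slots d j. \<exists>g\<in>carrier G. inv g \<otimes> a j m \<otimes> g \<in> H) \<longrightarrow> H = carrier G"
        using less.hyps[of B] B by blast
      have a: "a j m \<in> derived_term j" if "j < l" "m < slots d j" for j m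
        using A that by blast
      have aH: "H = carrier G" if "subgroup H G" "B \<subseteq> H"
           "\<And>j m. j < l \<Longrightarrow> m < slots d j \<Longrightarrow> \<exists>g\<in>carrier G. inv g \<otimes> a j m \<otimes> g \<in> H" for H
        using AH that by blast
      have "finite (rcosets M)"
        by (rule finite_rcosets_mono[OF normal_imp_subgroup[OF nN] fin normal_imp_subgroup[OF M(1)] M(2)])
      have "\<exists>j<l. \<forall>a. (\<forall>m<slots d j. a m \<in> derived_term j) \<longrightarrow>
        (\<exists>b. (\<forall>m<slots d j. b m \<in> B \<inter> derived_term j) \<and>
          (\<forall>H. subgroup H G \<and> M \<subseteq> H \<and> B <#> H = carrier G \<and>
               (\<forall>m<slots d j. \<exists>g\<in>carrier G. inv g \<otimes> (b m \<otimes> a m) \<otimes> g \<in> H)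
             \<longrightarrow> H = carrier G))"
      proof (rule chief_factor_supplement[OF M(1) _ nB MB, where x = x])
        show "C = M \<or> C = B" if "C \<lhd> G" "M \<subseteq> C" "C \<subseteq> B" for C
          using Bmin[of C] that M(2) by (auto simp: \<N>_def)
        show "H = carrier G" if "subgroup H G" "M \<subseteq> H" "\<And>i. i < d \<Longrightarrow> x i \<in> H" for H
          using gen[of H] that M(2) by auto
      qed fact+
      then obtain j where j: "j < l" and step: "\<forall>a. (\<forall>m<slots d j. a m \<in> derived_term j) \<longrightarrow>
        (\<exists>b. (\<forall>m<slots d j. b m \<in> B \<inter> derived_term j) \<and>
          (\<forall>H. subgroup H G \<and> M \<subseteq> H \<and> B <#> H = carrier G \<and>
               (\<forall>m<slots d j. \<exists>g\<in>carrier G. inv g \<otimes> (b m \<otimes> a m) \<otimes> g \<in> H)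
             \<longrightarrow> H = carrier G))" by (elim exE conjE)
      have "\<forall>m<slots d j. a j m \<in> derived_term j" using a[OF j] by blast
      from step[THEN spec, THEN mp, OF this]
      obtain b where b: "\<forall>m<slots d j. b m \<in> B \<inter> derived_term j"
        and bH: "\<forall>H. subgroup H G \<and> M \<subseteq> H \<and> B <#> H = carrier G \<and>
               (\<forall>m<slots d j. \<exists>g\<in>carrier G. inv g \<otimes> (b m \<otimes> a j m) \<otimes> g \<in> H)
             \<longrightarrow> H = carrier G"
        by (elim exE conjE)
      define a' where "a' = a(j := \<lambda>m. b m \<otimes> a j m)"
      have "a' i m \<in> derived_term i" if "i < l" "m < slots d i" for i m
        using that a b normal_imp_subgroup[OF derived_term_normal[of j]]
        by (auto simp: a'_def subgroup.m_closed)
      moreover have "H = carrier G" if sH: "subgroup H G" and MH: "M \<subseteq> H"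
        and conj: "\<And>i m. i < l \<Longrightarrow> m < slots d i \<Longrightarrow> \<exists>g\<in>carrier G. inv g \<otimes> a' i m \<otimes> g \<in> H" for H
      proof (rule bH[THEN spec, THEN mp], intro conjI allI impI sH MH)
        interpret BH: second_isomorphism_grp B G H
          using nB sH by (simp add: second_isomorphism_grp_def second_isomorphism_grp_axioms_def)
        show "B <#> H = carrier G"
        proof (rule aH)
          show "subgroup (B <#> H) G" by (rule BH.normal_set_mult_subgroup)
          show "B \<subseteq> B <#> H" by (rule BH.H_contained_in_set_mult)
          fix i m assume im: "i < l" "m < slots d i"
          obtain g where g: "g \<in> carrier G" "inv g \<otimes> a' i m \<otimes> g \<in> H" using conj[OF im] by blast
          have ac: "a i m \<in> carrier G" using a[OF im] exp_of_derived_in_carrier[OF subset_refl] by blast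
          have "inv g \<otimes> a i m \<otimes> g \<in> B <#> H"
          proof (cases "i = j")
            case True
            then have bm: "b m \<in> B" "b m \<in> carrier G" using b im by auto
            have "inv g \<otimes> a i m \<otimes> g = (inv g \<otimes> inv (b m) \<otimes> g) \<otimes> (inv g \<otimes> a' i m \<otimes> g)"
              using True g(1) bm ac by (simp add: a'_def m_assoc)
            moreover have "inv g \<otimes> inv (b m) \<otimes> g \<in> B"
              using BH.inv_op_closed1[OF g(1)] bm by simp
            ultimately show ?thesis using g(2) unfolding set_mult_def by blast
          next
            case False
            then show ?thesis using g BH.S_contained_in_set_mult by (auto simp: a'_def)
          qed
          then show "\<exists>g\<in>carrier G. inv g \<otimes> a i m \<otimes> g \<in> B <#> H" using g(1) by blast
        qed
        fix m assume "m < slots d j"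
        then show "\<exists>g\<in>carrier G. inv g \<otimes> (b m \<otimes> a j m) \<otimes> g \<in> H"
          using conj[OF j] by (simp add: a'_def)
      qed
      ultimately show ?thesis by (intro exI[of _ a']) blast
    qed
  qed
  then show ?thesis using nN by (simp add: \<N>_def)
qed

section \<open>Open subgroups of profinite groups\<close>

locale top_group = group G for G (structure) +
  fixes T
  assumes topological: "topological_group G T"
begin

lemma topspace [simp]: "topspace T = carrier G"
  using topological by (simp add: topological_group_def)

lemma continuous_map_mult:
  assumes "continuous_map X T f" and "continuous_map X T g"
  shows "continuous_map X T (\<lambda>x. f x \<otimes> g x)"
proof -
  have "continuous_map (prod_topology T T) T (\<lambda>(x, y). x \<otimes> y)"
    using topological by (simp add: topological_group_def)
  from continuous_map_compose[OF continuous_map_pairedI[OF assms] this]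
  show ?thesis by (simp add: o_def)
qed

lemma continuous_map_inv:
  assumes "continuous_map X T f"
  shows "continuous_map X T (\<lambda>x. inv (f x))"
proof -
  have "continuous_map T T (m_inv G)"
    using topological by (simp add: topological_group_def)
  from continuous_map_compose[OF assms this] show ?thesis by (simp add: o_def)
qed

lemma continuous_map_id' [simp]: "continuous_map T T (\<lambda>x. x)"
  using continuous_map_id[of T] by (simp add: id_def)

lemma openin_right_translate:
  assumes U: "openin T U" and g: "g \<in> carrier G"
  shows "openin T {x \<in> carrier G. x \<otimes> g \<in> U}"
proof -
  have "continuous_map T T (\<lambda>x. x \<otimes> g)"
    using g by (intro continuous_map_mult) simp_all
  from openin_continuous_map_preimage[OF this U] show ?thesis by simp
qed

lemma openin_inv_image:
  assumes U: "openin T U"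
  shows "openin T {x \<in> carrier G. inv x \<in> U}"
proof -
  have "continuous_map T T (\<lambda>x. inv x)" by (intro continuous_map_inv) simp
  from openin_continuous_map_preimage[OF this U] show ?thesis by simp
qed

lemma openin_rcoset:
  assumes U: "openin T U" and g: "g \<in> carrier G"
  shows "openin T (U #> g)"
proof -
  have "U \<subseteq> carrier G" using openin_subset[OF U] by simp
  then have "U #> g = {x \<in> carrier G. x \<otimes> inv g \<in> U}"
    using g by (force simp: r_coset_def m_assoc subset_iff)
  then show ?thesis using openin_right_translate[OF U, of "inv g"] g by simp
qed

text \<open>A subgroup is a union of translates of any subset of it that contains the identity.\<close>

lemma openin_subgroupI:
  assumes H: "subgroup H G" and V: "openin T V" "\<one> \<in> V" "V \<subseteq> H"
  shows "openin T H"
proof (subst openin_subopen, intro ballI)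
  fix h assume h: "h \<in> H"
  have hc: "h \<in> carrier G" using H h by (rule subgroup.mem_carrier)
  have "h \<in> V #> h" using V(2) hc unfolding r_coset_def by force
  moreover have "V #> h \<subseteq> H" using V(3) h H by (auto simp: r_coset_def subgroup.m_closed)
  ultimately show "\<exists>W. openin T W \<and> h \<in> W \<and> W \<subseteq> H" using openin_rcoset[OF V(1) hc] by blast
qed

text \<open>The complement is a union of open cosets.\<close>

lemma closedin_open_subgroup:
  assumes H: "subgroup H G" and op: "openin T H"
  shows "closedin T H"
proof -
  have "openin T (carrier G - H)"
  proof (subst openin_subopen, intro ballI)
    fix g assume g: "g \<in> carrier G - H"
    then have gc: "g \<in> carrier G" by simp
    have "(H #> g) \<inter> H = {}"
    proof (rule ccontr)
      assume "(H #> g) \<inter> H \<noteq> {}"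
      then obtain h where h: "h \<in> H" "h \<otimes> g \<in> H" by (auto simp: r_coset_def)
      then have "inv h \<otimes> (h \<otimes> g) \<in> H" using H by (simp add: subgroup.m_closed subgroup.m_inv_closed)
      then show False using g h H by (simp add: subgroup.mem_carrier)
    qed
    then have "H #> g \<subseteq> carrier G - H"
      using r_coset_subset_G[OF subgroup.subset[OF H] gc] by blast
    then show "\<exists>W. openin T W \<and> g \<in> W \<and> W \<subseteq> carrier G - H"
      using openin_rcoset[OF op gc] rcos_self[OF gc H] by blast
  qed
  then show ?thesis using subgroup.subset[OF H] by (simp add: closedin_def)
qed

text \<open>The cosets form an open cover without proper subcovers.\<close>

lemma finite_rcosets_open_subgroup:
  assumes comp: "compact_space T" and H: "subgroup H G" and op: "openin T H"
  shows "finite (rcosets H)"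
proof -
  have "\<Union> (rcosets H) = topspace T" using rcosets_part_G[OF H] by simp
  moreover have "\<forall>U\<in>rcosets H. openin T U"
    using openin_rcoset[OF op] by (auto simp: RCOSETS_def)
  ultimately obtain \<F> where F: "finite \<F>" "\<F> \<subseteq> rcosets H" "\<Union> \<F> = topspace T"
    using comp[unfolded compact_space, THEN spec, of "rcosets H"] by (elim impE exE conjE) auto
  have "C \<in> \<F>" if C: "C \<in> rcosets H" for C
  proof -
    obtain g where g: "g \<in> carrier G" "C = H #> g" using C by (auto simp: RCOSETS_def)
    then have gC: "g \<in> C" using rcos_self[OF g(1) H] by simp
    obtain D where D: "D \<in> \<F>" "g \<in> D" using F(3) g(1) by auto
    then have "D \<inter> C \<noteq> {}" using gC by blast
    then have "D = C" using rcos_disjoint[OF H] D F(2) C unfolding pairwise_def disjnt_def by blast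
    then show ?thesis using D by simp
  qed
  then show ?thesis using F(1) by (meson finite_subset subsetI)
qed

lemma open_normal_INT:
  assumes "finite I" and "\<And>i. i \<in> I \<Longrightarrow> M i \<lhd> G \<and> openin T (M i)" and "N \<lhd> G" and "openin T N"
  shows "{g \<in> N. \<forall>i\<in>I. g \<in> M i} \<lhd> G \<and> openin T {g \<in> N. \<forall>i\<in>I. g \<in> M i}"
  using assms
proof (induction rule: finite_induct)
  case (insert i I)
  have "{g \<in> N. \<forall>j\<in>insert i I. g \<in> M j} = M i \<inter> {g \<in> N. \<forall>i\<in>I. g \<in> M i}" by auto
  then show ?case
    using insert.IH insert.prems normal_subgroup_intersect[of "M i" "{g \<in> N. \<forall>i\<in>I. g \<in> M i}"]
    by (auto intro: openin_Int)
qed simp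

lemma continuous_map_FactGroup:
  assumes N: "subgroup N G" and op: "openin T N"
  shows "continuous_map T (discrete_topology (carrier (G Mod N))) (\<lambda>g. N #> g)"
  unfolding continuous_map_def
proof (intro conjI allI impI)
  show "(\<lambda>g. N #> g) \<in> topspace T \<rightarrow> topspace (discrete_topology (carrier (G Mod N)))"
    by (auto simp: carrier_FactGroup)
  fix U
  show "openin T {x \<in> topspace T. N #> x \<in> U}"
  proof (subst openin_subopen, intro ballI)
    fix g assume "g \<in> {x \<in> topspace T. N #> x \<in> U}"
    then have g: "g \<in> carrier G" "N #> g \<in> U" by auto
    have "N #> h = N #> g" if "h \<in> N #> g" for h
      using repr_independence[OF that g(1) N] by simp
    then have "N #> g \<subseteq> {x \<in> topspace T. N #> x \<in> U}"
      using g r_coset_subset_G[OF subgroup.subset[OF N] g(1)] by auto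
    then show "\<exists>W. openin T W \<and> g \<in> W \<and> W \<subseteq> {x \<in> topspace T. N #> x \<in> U}"
      using openin_rcoset[OF op g(1)] rcos_self[OF g(1) N] by blast
  qed
qed

end

locale profinite = top_group +
  assumes profinite: "profinite_group G T"
begin

lemma compact: "compact_space T"
  using profinite by (simp add: profinite_group_def)

text \<open>In a compact Hausdorff space components and quasi-components agree, so the trivial component
  of the identity is an intersection of clopen sets; compactness leaves one of them inside \<open>U\<close>.\<close>

lemma clopen_nbhd_one:
  assumes U: "openin T U" "\<one> \<in> U"
  shows "\<exists>K. openin T K \<and> closedin T K \<and> \<one> \<in> K \<and> K \<subseteq> U"
proof -
  have "quasi_component_of T \<one> = connected_component_of T \<one>"
    using profinite by (intro quasi_eq_connected_component_of) (simp add: profinite_group_def)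
  then have "quasi_component_of_set T \<one> = {\<one>}"
    using profinite by (simp add: profinite_group_def)
  then have C: "{\<one>} \<in> quasi_components_of T"
    unfolding quasi_components_of_def by (metis imageI one_closed topspace)
  have "compactin T (topspace T - U)"
    by (intro closedin_compact_space compact closedin_diff closedin_topspace U(1))
  then have "separated_between T {\<one>} (topspace T - U)"
    using separated_between_quasi_component_compact[OF C] U(2) by simp
  then obtain K where "closedin T K" "openin T K" "{\<one>} \<subseteq> K" "topspace T - U \<subseteq> topspace T - K"
    unfolding separated_between by blast
  moreover have "K \<subseteq> U" using calculation openin_subset[of T K] by blast
  ultimately show ?thesis by blast
qed

text \<open>If \<open>K\<close> is clopen and \<open>V\<close> is a symmetric neighbourhood of the identity with \<open>K V \<subseteq> K\<close>, then the
  subgroup generated by \<open>V\<close> stays inside \<open>K\<close>. Wallace's theorem supplies \<open>V\<close>, and then also a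
  neighbourhood of the identity contained in all conjugates of this subgroup.\<close>

lemma open_normal_nbhd_one:
  assumes U: "openin T U" "\<one> \<in> U"
  shows "\<exists>N. N \<lhd> G \<and> openin T N \<and> N \<subseteq> U"
proof -
  obtain K where K: "openin T K" "closedin T K" "\<one> \<in> K" "K \<subseteq> U"
    using clopen_nbhd_one[OF U] by blast
  have Kc: "K \<subseteq> carrier G" using openin_subset[OF K(1)] by simp
  have compK: "compactin T K" using K(2) compact by (simp add: closedin_compact_space)
  have "continuous_map (prod_topology T T) T (\<lambda>z. fst z \<otimes> snd z)"
    by (intro continuous_map_mult continuous_map_fst continuous_map_snd)
  from openin_continuous_map_preimage[OF this K(1)]
  have W: "openin (prod_topology T T) {z \<in> topspace (prod_topology T T). fst z \<otimes> snd z \<in> K}" .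
  have "K \<times> {\<one>} \<subseteq> {z \<in> topspace (prod_topology T T). fst z \<otimes> snd z \<in> K}"
    using Kc by auto
  then obtain A V where AV: "openin T A" "openin T V" "K \<subseteq> A" "\<one> \<in> V"
    "A \<times> V \<subseteq> {z \<in> topspace (prod_topology T T). fst z \<otimes> snd z \<in> K}"
    using Wallace_theorem_prod_topology[OF compK _ W, of "{\<one>}"] by (auto simp: finite_imp_compactin)
  define V' where "V' = V \<inter> {x \<in> carrier G. inv x \<in> V}"
  have V': "openin T V'" "\<one> \<in> V'" "V' \<subseteq> carrier G"
    using AV openin_inv_image[OF AV(2)] by (auto simp: V'_def)
  define H where "H = generate G V'"
  have sH: "subgroup H G" unfolding H_def by (rule generate_is_subgroup[OF V'(3)])
  have KV: "k \<otimes> v \<in> K" if "k \<in> K" "v \<in> V" for k v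
  proof -
    have "(k, v) \<in> A \<times> V" using that AV(3) by blast
    then show ?thesis using AV(5) by auto
  qed
  have KH: "k \<otimes> h \<in> K" if "h \<in> H" "k \<in> K" for h k
    using that unfolding H_def
  proof (induction arbitrary: k rule: generate.induct)
    case one
    then show ?case using Kc by auto
  next
    case (incl h)
    then show ?case using KV by (simp add: V'_def)
  next
    case (inv h)
    then show ?case using KV by (simp add: V'_def)
  next
    case (eng h1 h2)
    have "h1 \<in> carrier G" "h2 \<in> carrier G"
      using generate_in_carrier[OF V'(3)] eng.hyps by auto
    then have "k \<otimes> (h1 \<otimes> h2) = (k \<otimes> h1) \<otimes> h2"
      using eng.prems Kc by (simp add: m_assoc subset_iff)
    then show ?case using eng by simp
  qed
  have "H \<subseteq> K"
  proof
    fix h assume h: "h \<in> H"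
    then show "h \<in> K" using KH[OF h K(3)] subgroup.mem_carrier[OF sH h] by simp
  qed
  have "V' \<subseteq> H" unfolding H_def by (auto intro: generate.incl)
  then have opH: "openin T H" using openin_subgroupI[OF sH V'(1,2)] by simp
  \<comment> \<open>the normal core of \<open>H\<close>\<close>
  define N where "N = {x \<in> carrier G. \<forall>g\<in>carrier G. inv g \<otimes> x \<otimes> g \<in> H}"
  have sN: "subgroup N G"
  proof (rule subgroup.intro)
    fix x y assume x: "x \<in> N" and y: "y \<in> N"
    have "inv g \<otimes> (x \<otimes> y) \<otimes> g \<in> H" if g: "g \<in> carrier G" for g
    proof -
      have "inv g \<otimes> (x \<otimes> y) \<otimes> g = (inv g \<otimes> x \<otimes> g) \<otimes> (inv g \<otimes> y \<otimes> g)"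
        using x y g by (simp add: N_def m_assoc)
      then show ?thesis using x y g sH by (simp add: N_def subgroup.m_closed)
    qed
    then show "x \<otimes> y \<in> N" using x y by (simp add: N_def)
  next
    fix x assume x: "x \<in> N"
    have "inv g \<otimes> inv x \<otimes> g \<in> H" if g: "g \<in> carrier G" for g
    proof -
      have "inv g \<otimes> inv x \<otimes> g = inv (inv g \<otimes> x \<otimes> g)"
        using x g by (simp add: N_def m_assoc inv_mult_group)
      then show ?thesis using x g sH by (simp add: N_def subgroup.m_inv_closed)
    qed
    then show "inv x \<in> N" using x by (simp add: N_def)
  qed (use sH in \<open>auto simp: N_def subgroup.one_closed\<close>)
  have "N \<lhd> G"
    unfolding normal_inv_iff
  proof (intro conjI ballI sN)
    fix g x assume g: "g \<in> carrier G" and x: "x \<in> N"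
    have "inv k \<otimes> (g \<otimes> x \<otimes> inv g) \<otimes> k \<in> H" if k: "k \<in> carrier G" for k
    proof -
      have "inv k \<otimes> (g \<otimes> x \<otimes> inv g) \<otimes> k = inv (inv g \<otimes> k) \<otimes> x \<otimes> (inv g \<otimes> k)"
        using g k x by (simp add: N_def m_assoc inv_mult_group)
      then show ?thesis using x g k by (simp add: N_def)
    qed
    then show "g \<otimes> x \<otimes> inv g \<in> N" using g x by (simp add: N_def)
  qed
  moreover have "N \<subseteq> U"
  proof
    fix x assume "x \<in> N"
    then have "x \<in> carrier G" "inv \<one> \<otimes> x \<otimes> \<one> \<in> H" unfolding N_def by blast+
    then show "x \<in> U" using \<open>H \<subseteq> K\<close> K(4) by auto
  qed
  moreover have "openin T N"
  proof -
    have "continuous_map (prod_topology T T) T (\<lambda>z. inv (snd z) \<otimes> fst z \<otimes> snd z)"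
      by (intro continuous_map_mult continuous_map_inv continuous_map_fst continuous_map_snd)
    from openin_continuous_map_preimage[OF this opH]
    have W: "openin (prod_topology T T)
        {z \<in> topspace (prod_topology T T). inv (snd z) \<otimes> fst z \<otimes> snd z \<in> H}" .
    have "{\<one>} \<times> carrier G \<subseteq> {z \<in> topspace (prod_topology T T). inv (snd z) \<otimes> fst z \<otimes> snd z \<in> H}"
      using sH by (auto simp: subgroup.one_closed)
    moreover have "compactin T (carrier G)" using compact by (simp add: compact_space_def)
    ultimately obtain A B where AB: "openin T A" "openin T B" "\<one> \<in> A" "carrier G \<subseteq> B"
      "A \<times> B \<subseteq> {z \<in> topspace (prod_topology T T). inv (snd z) \<otimes> fst z \<otimes> snd z \<in> H}"
      using Wallace_theorem_prod_topology[OF _ _ W, of "{\<one>}" "carrier G"] by (auto simp: finite_imp_compactin)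
    have "A \<subseteq> N"
    proof
      fix x assume x: "x \<in> A"
      have "inv g \<otimes> x \<otimes> g \<in> H" if "g \<in> carrier G" for g
      proof -
        have "(x, g) \<in> A \<times> B" using AB(4) x that by blast
        then show ?thesis using AB(5) by auto
      qed
      moreover have "x \<in> carrier G" using openin_subset[OF AB(1)] x by auto
      ultimately show "x \<in> N" by (simp add: N_def)
    qed
    then show ?thesis using openin_subgroupI[OF sN AB(1,3)] by simp
  qed
  ultimately show ?thesis by blast
qed

text \<open>Density need only be checked modulo open normal subgroups, since their cosets form a basis of the
  topology.\<close>

lemma dense_if_dense_mod_open_normal:
  assumes A: "A \<subseteq> carrier G"
    and mod: "\<And>N. N \<lhd> G \<Longrightarrow> openin T N \<Longrightarrow> N <#> A = carrier G"
  shows "T closure_of A = carrier G"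
proof
  show "T closure_of A \<subseteq> carrier G" using closure_of_subset_topspace[of T A] by simp
  show "carrier G \<subseteq> T closure_of A"
  proof
    fix x assume x: "x \<in> carrier G"
    have "\<exists>y\<in>A. y \<in> U" if U: "x \<in> U" "openin T U" for U
    proof -
      have "openin T {y \<in> carrier G. inv y \<in> {y \<in> carrier G. y \<otimes> x \<in> U}}"
        by (intro openin_inv_image openin_right_translate U(2) x)
      then obtain N where N: "N \<lhd> G" "openin T N" "N \<subseteq> {y \<in> carrier G. inv y \<in> {y \<in> carrier G. y \<otimes> x \<in> U}}"
        using open_normal_nbhd_one[of "{y \<in> carrier G. inv y \<in> {y \<in> carrier G. y \<otimes> x \<in> U}}"] U x by auto
      have "x \<in> N <#> A" using mod[OF N(1,2)] x by simp
      then obtain n a where na: "n \<in> N" "a \<in> A" "x = n \<otimes> a" by (auto simp: set_mult_def)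
      have "n \<in> carrier G" "inv n \<otimes> x \<in> U" using N(3) na(1) by auto
      then have "a \<in> U" using na A by auto
      then show ?thesis using na by blast
    qed
    then show "x \<in> T closure_of A" using x by (auto simp: in_closure_of)
  qed
qed

end

section \<open>Finite quotients of the free object and the upper bound\<close>

lemma continuous_map_discrete_iff:
  "continuous_map X (discrete_topology A) f \<longleftrightarrow>
    f \<in> topspace X \<rightarrow> A \<and> (\<forall>a\<in>A. openin X {x \<in> topspace X. f x = a})"
proof
  assume *: "continuous_map X (discrete_topology A) f"
  have "openin X {x \<in> topspace X. f x = a}" if "a \<in> A" for a
    using openin_continuous_map_preimage[OF *, of "{a}"] that by simp
  then show "f \<in> topspace X \<rightarrow> A \<and> (\<forall>a\<in>A. openin X {x \<in> topspace X. f x = a})"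
    using * by (simp add: continuous_map_def)
next
  assume *: "f \<in> topspace X \<rightarrow> A \<and> (\<forall>a\<in>A. openin X {x \<in> topspace X. f x = a})"
  have "openin X {x \<in> topspace X. f x \<in> U}" if "U \<subseteq> A" for U
  proof -
    have "{x \<in> topspace X. f x \<in> U} = (\<Union>a\<in>U. {x \<in> topspace X. f x = a})" by auto
    then show ?thesis using * that by (auto intro!: openin_Union)
  qed
  then show "continuous_map X (discrete_topology A) f"
    using * by (simp add: continuous_map_def)
qed

lemma ex1_unique: "\<exists>!a. P a \<Longrightarrow> P b \<Longrightarrow> P c \<Longrightarrow> b = c"
  by blast

lemma (in group) profinite_group_discrete:
  assumes fin: "finite (carrier G)"
  shows "profinite_group G (discrete_topology (carrier G))"
proof -
  have "topological_group G (discrete_topology (carrier G))"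
    unfolding topological_group_def prod_topology_discrete_topology[symmetric]
    by (auto simp: is_group)
  then show ?thesis
    using fin by (simp add: profinite_group_def compact_space_discrete_topology
        connected_component_of_discrete_topology)
qed

locale free_soluble = profinite +
  fixes d l :: nat and x :: "nat \<Rightarrow> 'a"
  assumes free: "free_soluble_profinite_on d l G T x"
begin

lemma generator_closed: "i < d \<Longrightarrow> x i \<in> carrier G"
  using free by (simp add: free_soluble_profinite_on_def)

lemma derived_term_trivial: "derived_term l = {\<one>}"
  using free by (simp add: free_soluble_profinite_on_def soluble_of_derived_length_at_most_def)

text \<open>A finite group has a copy with carrier in \<open>nat \<Rightarrow> nat\<close>, so the universal property holds for
  finite groups on every type.\<close>

lemma finite_copy:
  fixes H :: "('h, 'k) monoid_scheme"
  assumes sol: "soluble_of_derived_length_at_most l H" and fin: "finite (carrier H)"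
    and y: "\<forall>i<d. y i \<in> carrier H"
  obtains e :: "'h \<Rightarrow> nat \<Rightarrow> nat" and K :: "(nat \<Rightarrow> nat) monoid" where "e \<in> iso H K" and "group K" and
    "\<exists>!h. h \<in> extensional (carrier G) \<and> h \<in> hom G K \<and>
       continuous_map T (discrete_topology (carrier K)) h \<and> (\<forall>i<d. h (x i) = e (y i))"
proof -
  interpret H: group H using sol by (simp add: soluble_of_derived_length_at_most_def)
  define e :: "'h \<Rightarrow> nat \<Rightarrow> nat" where "e b = (\<lambda>_. to_nat_on (carrier H) b)" for b
  define K where "K = image_group e H"
  have "inj_on e (carrier H)"
    using inj_on_to_nat_on[OF countable_finite[OF fin]] by (auto simp: e_def inj_on_def fun_eq_iff)
  then have iso: "e \<in> iso H K" unfolding K_def by (rule inj_imp_image_group_iso)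
  have gK: "group K"
    unfolding K_def by (rule H.inj_imp_image_group_is_group) fact
  interpret e: group_hom H K e
    using iso gK by (intro group_hom.intro group_hom_axioms.intro H.is_group) (simp_all add: iso_def)
  have carK: "carrier K = e ` carrier H" by (simp add: K_def image_group_carrier)
  have "(derived K ^^ l) (carrier K) = e ` (derived H ^^ l) (carrier H)"
    using e.exp_of_derived_img[OF subset_refl, of l] by (simp add: carK)
  then have "soluble_of_derived_length_at_most l K"
    using sol gK by (simp add: soluble_of_derived_length_at_most_def)
  moreover have "profinite_group K (discrete_topology (carrier K))"
    using fin by (intro group.profinite_group_discrete gK) (simp add: carK)
  moreover have "\<forall>i<d. e (y i) \<in> carrier K" using y by (simp add: carK)
  ultimately have "\<exists>!h. h \<in> extensional (carrier G) \<and> h \<in> hom G K \<and>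
       continuous_map T (discrete_topology (carrier K)) h \<and> (\<forall>i<d. h (x i) = e (y i))"
    using free[unfolded free_soluble_profinite_on_def, THEN conjunct2, THEN conjunct2, THEN conjunct2,
        THEN spec, of K, THEN spec, of "discrete_topology (carrier K)", THEN spec, of "\<lambda>i. e (y i)"]
    by simp
  then show thesis by (rule that[OF iso gK])
qed

lemma hom_to_finite_exists:
  fixes H :: "('h, 'k) monoid_scheme"
  assumes sol: "soluble_of_derived_length_at_most l H" and fin: "finite (carrier H)"
    and y: "\<And>i. i < d \<Longrightarrow> y i \<in> carrier H"
  shows "\<exists>h. h \<in> hom G H \<and> continuous_map T (discrete_topology (carrier H)) h \<and> (\<forall>i<d. h (x i) = y i)"
proof -
  interpret H: group H using sol by (simp add: soluble_of_derived_length_at_most_def)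
  have y': "\<forall>i<d. y i \<in> carrier H" using y by blast
  obtain e :: "'h \<Rightarrow> nat \<Rightarrow> nat" and K :: "(nat \<Rightarrow> nat) monoid" where iso: "e \<in> iso H K" and gK: "group K" and
    ex: "\<exists>!h. h \<in> extensional (carrier G) \<and> h \<in> hom G K \<and>
       continuous_map T (discrete_topology (carrier K)) h \<and> (\<forall>i<d. h (x i) = e (y i))"
    by (rule finite_copy[OF sol fin y'], rule that)
  from ex1_implies_ex[OF ex] obtain h where h: "h \<in> hom G K" "continuous_map T (discrete_topology (carrier K)) h"
    "\<forall>i<d. h (x i) = e (y i)" by (elim exE conjE)
  define f where "f = inv_into (carrier H) e"
  have f: "f \<in> hom K H" using H.iso_set_sym[OF iso] by (simp add: f_def iso_def)
  have "f \<circ> h \<in> hom G H" by (rule Group.hom_compose[OF h(1) f])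
  moreover have "continuous_map T (discrete_topology (carrier H)) (f \<circ> h)"
    using f by (intro continuous_map_compose[OF h(2)]) (auto simp: hom_def)
  moreover have "(f \<circ> h) (x i) = y i" if "i < d" for i
    using h(3) that y[OF that] iso by (auto simp: f_def iso_def bij_betw_def)
  ultimately show ?thesis by blast
qed

lemma hom_to_finite_unique:
  fixes H :: "('h, 'k) monoid_scheme"
  assumes sol: "soluble_of_derived_length_at_most l H" and fin: "finite (carrier H)"
    and f: "f \<in> hom G H" "continuous_map T (discrete_topology (carrier H)) f"
    and h: "h \<in> hom G H" "continuous_map T (discrete_topology (carrier H)) h"
    and eq: "\<And>i. i < d \<Longrightarrow> f (x i) = h (x i)" and g: "g \<in> carrier G"
  shows "f g = h g"
proof -
  interpret H: group H using sol by (simp add: soluble_of_derived_length_at_most_def)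
  have y: "f (x i) \<in> carrier H" if "i < d" for i
    using f(1) generator_closed[OF that] by (auto simp: hom_def)
  have y': "\<forall>i<d. f (x i) \<in> carrier H" using y by blast
  obtain e :: "'h \<Rightarrow> nat \<Rightarrow> nat" and K :: "(nat \<Rightarrow> nat) monoid" where iso: "e \<in> iso H K" and gK: "group K" and
    ex: "\<exists>!k. k \<in> extensional (carrier G) \<and> k \<in> hom G K \<and>
       continuous_map T (discrete_topology (carrier K)) k \<and> (\<forall>i<d. k (x i) = e (f (x i)))"
    by (rule finite_copy[OF sol fin y'], rule that)
  have e: "e \<in> hom H K" "inj_on e (carrier H)" using iso by (auto simp: iso_def bij_betw_def)
  have lift: "restrict (e \<circ> k) (carrier G) \<in> extensional (carrier G) \<and>
      restrict (e \<circ> k) (carrier G) \<in> hom G K \<and>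
      continuous_map T (discrete_topology (carrier K)) (restrict (e \<circ> k) (carrier G)) \<and>
      (\<forall>i<d. restrict (e \<circ> k) (carrier G) (x i) = e (f (x i)))"
    if k: "k \<in> hom G H" "continuous_map T (discrete_topology (carrier H)) k"
      and kf: "\<And>i. i < d \<Longrightarrow> k (x i) = f (x i)" for k
  proof (intro conjI allI impI)
    have "e \<circ> k \<in> hom G K" by (rule Group.hom_compose[OF k(1) e(1)])
    then show "restrict (e \<circ> k) (carrier G) \<in> hom G K"
      by (auto simp: hom_def)
    have "continuous_map T (discrete_topology (carrier K)) (e \<circ> k)"
      using e by (intro continuous_map_compose[OF k(2)]) (auto simp: hom_def)
    then show "continuous_map T (discrete_topology (carrier K)) (restrict (e \<circ> k) (carrier G))"
      by (rule continuous_map_eq) simp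
    show "restrict (e \<circ> k) (carrier G) (x i) = e (f (x i))" if "i < d" for i
      using kf[OF that] generator_closed[OF that] by simp
  qed simp
  have "restrict (e \<circ> f) (carrier G) = restrict (e \<circ> h) (carrier G)"
    by (rule ex1_unique[OF ex]; rule lift) (simp_all add: f h eq)
  then have "restrict (e \<circ> f) (carrier G) g = restrict (e \<circ> h) (carrier G) g" by simp
  then have "e (f g) = e (h g)" using g by simp
  moreover have "f g \<in> carrier H" "h g \<in> carrier H" using f h g by (auto simp: hom_def)
  ultimately show ?thesis using e(2) by (auto dest: inj_onD)
qed

lemma soluble_FactGroup:
  assumes N: "N \<lhd> G"
  shows "soluble_of_derived_length_at_most l (G Mod N)"
proof -
  interpret N: normal N G by (rule N)
  interpret Q: group "G Mod N" by (rule N.factorgroup_is_group)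
  interpret p: group_hom G "G Mod N" "\<lambda>g. N #> g"
    by (intro group_hom.intro group_hom_axioms.intro is_group Q.is_group N.r_coset_hom_Mod)
  have "Q.derived_term l = (\<lambda>g. N #> g) ` derived_term l"
    using p.exp_of_derived_img[OF subset_refl, of l] by (simp add: carrier_FactGroup)
  then show ?thesis
    using Q.is_group N.subset by (simp add: soluble_of_derived_length_at_most_def derived_term_trivial)
qed

text \<open>If the generators lay in a proper subgroup of a finite quotient, the quotient map and a map
  into that subgroup would be two homomorphisms with the same values on the generators.\<close>

lemma open_subgroup_eq_carrier:
  assumes nN: "N \<lhd> G" and op: "openin T N" and P: "subgroup P G" and NP: "N \<subseteq> P"
    and x: "\<And>i. i < d \<Longrightarrow> x i \<in> P"
  shows "P = carrier G"
proof -
  interpret N: normal N G by (rule nN)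
  define Q where "Q = G Mod N"
  interpret Q: group Q unfolding Q_def by (rule N.factorgroup_is_group)
  define p where "p g = N #> g" for g
  have phom: "p \<in> hom G Q" unfolding p_def Q_def by (rule N.r_coset_hom_Mod)
  interpret p: group_hom G Q p
    by (intro group_hom.intro group_hom_axioms.intro is_group Q.is_group phom)
  have solQ: "soluble_of_derived_length_at_most l Q"
    unfolding Q_def by (rule soluble_FactGroup[OF nN])
  have finQ: "finite (carrier Q)"
    using finite_rcosets_open_subgroup[OF compact N.is_subgroup op] by (simp add: Q_def FactGroup_def)
  have cont: "continuous_map T (discrete_topology (carrier Q)) p"
    unfolding Q_def p_def by (rule continuous_map_FactGroup[OF N.is_subgroup op])
  define R where "R = Q\<lparr>carrier := p ` P\<rparr>"
  have sR: "subgroup (p ` P) Q" by (rule p.subgroup_img_is_subgroup[OF P])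
  interpret R: group R unfolding R_def by (rule Q.subgroup_imp_group[OF sR])
  have "(derived R ^^ l) (carrier R) \<subseteq> {\<one>\<^bsub>Q\<^esub>}"
  proof -
    have *: "(derived R ^^ k) (p ` P) = (derived Q ^^ k) (p ` P)" for k
    proof (induction k)
      case (Suc k)
      have "(derived Q ^^ k) (p ` P) \<subseteq> p ` P"
        using Suc R.exp_of_derived_in_carrier[of "p ` P" k] by (simp add: R_def)
      then show ?case using Suc Q.derived_consistent[OF _ sR] by (simp add: R_def)
    qed simp
    have "(derived Q ^^ l) (p ` P) \<subseteq> (derived Q ^^ l) (carrier Q)"
      by (rule Q.mono_exp_of_derived[OF subgroup.subset[OF sR]])
    then show ?thesis using solQ * by (simp add: soluble_of_derived_length_at_most_def R_def)
  qed
  moreover have "\<one>\<^bsub>Q\<^esub> \<in> (derived R ^^ l) (carrier R)"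
    using subgroup.one_closed[OF R.exp_of_derived_is_subgroup[OF R.subgroup_self, of l]]
    by (simp add: R_def)
  ultimately have solR: "soluble_of_derived_length_at_most l R"
    using R.is_group by (auto simp: soluble_of_derived_length_at_most_def R_def)
  have finR: "finite (carrier R)"
    using finQ subgroup.subset[OF sR] by (auto simp: R_def intro: finite_subset)
  have "p (x i) \<in> carrier R" if "i < d" for i using x[OF that] by (simp add: R_def)
  then obtain h where h: "h \<in> hom G R" "continuous_map T (discrete_topology (carrier R)) h"
    "\<forall>i<d. h (x i) = p (x i)"
    using hom_to_finite_exists[OF solR finR, of "\<lambda>i. p (x i)"] by blast
  have RQ: "carrier R \<subseteq> carrier Q" using subgroup.subset[OF sR] by (simp add: R_def)
  have hR: "h g \<in> carrier R" if "g \<in> carrier G" for g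
    using h(1) that by (auto simp: hom_def)
  have h1: "h \<in> hom G Q"
  proof (rule homI)
    show "h g \<in> carrier Q" if "g \<in> carrier G" for g using hR[OF that] RQ by blast
    show "h (g \<otimes> k) = h g \<otimes>\<^bsub>Q\<^esub> h k" if "g \<in> carrier G" "k \<in> carrier G" for g k
      using hom_mult[OF h(1) that] by (simp add: R_def)
  qed
  have h2: "continuous_map T (discrete_topology (carrier Q)) h"
    using continuous_map_compose[OF h(2), of "discrete_topology (carrier Q)" "\<lambda>q. q"] RQ
    by (simp add: o_def subset_iff Pi_def)
  have "p g \<in> p ` P" if g: "g \<in> carrier G" for g
  proof -
    have "h g = p g"
      using hom_to_finite_unique[OF solQ finQ h1 h2 phom cont] h(3) g by blast
    then show ?thesis using hR[OF g] by (simp add: R_def)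
  qed
  have "g \<in> P" if g: "g \<in> carrier G" for g
  proof -
    obtain k where k: "k \<in> P" "p g = p k" using \<open>\<And>g. g \<in> carrier G \<Longrightarrow> p g \<in> p ` P\<close>[OF g] by auto
    have "g \<in> N #> k" using rcos_self[OF g N.is_subgroup] k(2) by (simp add: p_def)
    then show ?thesis using k(1) NP P by (auto simp: r_coset_def subgroup.m_closed)
  qed
  then show ?thesis using subgroup.subset[OF P] by blast
qed

definition slot_index :: "(nat \<times> nat) set" where
  "slot_index = (SIGMA j:{..<l}. {..<slots d j})"

lemma finite_slot_index: "finite slot_index"
  by (simp add: slot_index_def)

lemma card_slot_index:
  assumes "d \<ge> 1" and "l \<ge> 1"
  shows "card slot_index = l * (d - 1) + 1"
proof -
  obtain k where k: "l = Suc k" using assms by (cases l) auto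
  have "card slot_index = (\<Sum>j<l. slots d j)" by (simp add: slot_index_def)
  also have "\<dots> = d + k * (d - 1)"
    unfolding k sum.lessThan_Suc_shift by (simp add: slots_def)
  finally show ?thesis using assms k by simp
qed

text \<open>Families whose conjugates, however chosen, generate together with \<open>N\<close> the whole group. Membership
  depends only on the values of the family modulo \<open>N\<close>, which makes these sets clopen in the product
  topology when \<open>N\<close> is open.\<close>

definition invariable_families :: "'a set \<Rightarrow> (nat \<times> nat \<Rightarrow> 'a) set" where
  "invariable_families N = {a \<in> slot_index \<rightarrow>\<^sub>E carrier G.
     \<forall>H. subgroup H G \<and> N \<subseteq> H \<and> (\<forall>s\<in>slot_index. \<exists>g\<in>carrier G. inv g \<otimes> a s \<otimes> g \<in> H)
       \<longrightarrow> H = carrier G}"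

lemma invariable_families_nonempty:
  assumes nN: "N \<lhd> G" and op: "openin T N" and d: "d \<ge> 1"
  shows "invariable_families N \<noteq> {}"
proof -
  have "\<exists>a. (\<forall>j<l. \<forall>m<slots d j. a j m \<in> derived_term j) \<and>
    (\<forall>H. subgroup H G \<and> N \<subseteq> H \<and>
         (\<forall>j<l. \<forall>m<slots d j. \<exists>g\<in>carrier G. inv g \<otimes> a j m \<otimes> g \<in> H) \<longrightarrow> H = carrier G)"
  proof (rule exists_invariable_generators_mod[OF nN, where x = x])
    show "finite (rcosets N)"
      by (rule finite_rcosets_open_subgroup[OF compact normal_imp_subgroup[OF nN] op])
    show "H = carrier G" if "subgroup H G" "N \<subseteq> H" "\<And>i. i < d \<Longrightarrow> x i \<in> H" for H
      by (rule open_subgroup_eq_carrier[OF nN op that])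
  qed (fact generator_closed d derived_term_trivial)+
  then obtain a where a: "\<forall>j<l. \<forall>m<slots d j. a j m \<in> derived_term j"
    and aH: "\<forall>H. subgroup H G \<and> N \<subseteq> H \<and>
         (\<forall>j<l. \<forall>m<slots d j. \<exists>g\<in>carrier G. inv g \<otimes> a j m \<otimes> g \<in> H) \<longrightarrow> H = carrier G"
    by (elim exE conjE)
  have ac: "a j m \<in> carrier G" if "j < l" "m < slots d j" for j m
    using a that exp_of_derived_in_carrier[OF subset_refl] by blast
  define a' where "a' = (\<lambda>(j, m)\<in>slot_index. a j m)"
  have "a' \<in> invariable_families N"
    unfolding invariable_families_def
  proof (intro CollectI conjI allI impI)
    show "a' \<in> slot_index \<rightarrow>\<^sub>E carrier G"
      using ac by (auto simp: a'_def slot_index_def)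
    fix H assume H: "subgroup H G \<and> N \<subseteq> H \<and> (\<forall>s\<in>slot_index. \<exists>g\<in>carrier G. inv g \<otimes> a' s \<otimes> g \<in> H)"
    show "H = carrier G"
    proof (rule aH[THEN spec, THEN mp], intro conjI allI impI)
      fix j m assume jm: "j < l" "m < slots d j"
      then have "(j, m) \<in> slot_index" by (simp add: slot_index_def)
      then show "\<exists>g\<in>carrier G. inv g \<otimes> a j m \<otimes> g \<in> H"
        using H by (auto simp: a'_def)
    qed (use H in blast)+
  qed
  then show ?thesis by blast
qed

lemma invariable_families_mono:
  assumes "N \<subseteq> M"
  shows "invariable_families N \<subseteq> invariable_families M"
  unfolding invariable_families_def using assms by (intro Collect_mono) (meson subset_trans)

lemma closedin_invariable_families:
  assumes nN: "N \<lhd> G" and op: "openin T N"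
  shows "closedin (product_topology (\<lambda>_. T) slot_index) (invariable_families N)"
proof -
  interpret N: normal N G by (rule nN)
  let ?P = "product_topology (\<lambda>_. T) slot_index"
  have "openin ?P (topspace ?P - invariable_families N)"
  proof (subst openin_subopen, intro ballI)
    fix a assume "a \<in> topspace ?P - invariable_families N"
    then have a: "a \<in> slot_index \<rightarrow>\<^sub>E carrier G" and "a \<notin> invariable_families N" by auto
    then obtain H where H: "subgroup H G" "N \<subseteq> H" "H \<noteq> carrier G"
      and conj: "\<forall>s\<in>slot_index. \<exists>g\<in>carrier G. inv g \<otimes> a s \<otimes> g \<in> H"
      unfolding invariable_families_def by blast
    define W where "W = (\<Pi>\<^sub>E s\<in>slot_index. N #> a s)"
    have ac: "a s \<in> carrier G" if "s \<in> slot_index" for s using a that by auto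
    have "openin ?P W"
      unfolding W_def using openin_rcoset[OF op ac] by (simp add: openin_PiE finite_slot_index)
    moreover have "a \<in> W"
      using a rcos_self[OF ac N.is_subgroup] by (auto simp: W_def)
    moreover have "W \<subseteq> topspace ?P - invariable_families N"
    proof
      fix b assume b: "b \<in> W"
      have "b \<in> slot_index \<rightarrow>\<^sub>E carrier G"
        using b ac r_coset_subset_G[OF N.subset] unfolding W_def by blast
      moreover have "\<exists>g\<in>carrier G. inv g \<otimes> b s \<otimes> g \<in> H" if s: "s \<in> slot_index" for s
      proof -
        obtain n where n: "n \<in> N" "b s = n \<otimes> a s" using b s by (auto simp: W_def r_coset_def)
        obtain g where g: "g \<in> carrier G" "inv g \<otimes> a s \<otimes> g \<in> H" using conj s by blast
        have "inv g \<otimes> b s \<otimes> g = (inv g \<otimes> n \<otimes> g) \<otimes> (inv g \<otimes> a s \<otimes> g)"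
          using n g(1) ac[OF s] by (simp add: m_assoc)
        moreover have "inv g \<otimes> n \<otimes> g \<in> H" using N.inv_op_closed1[OF g(1) n(1)] H(2) by blast
        ultimately have "inv g \<otimes> b s \<otimes> g \<in> H" using g H(1) by (simp add: subgroup.m_closed)
        then show ?thesis using g(1) by blast
      qed
      ultimately show "b \<in> topspace ?P - invariable_families N"
        using H by (auto simp: invariable_families_def)
    qed
    ultimately show "\<exists>W. openin ?P W \<and> a \<in> W \<and> W \<subseteq> topspace ?P - invariable_families N" by blast
  qed
  moreover have "invariable_families N \<subseteq> topspace ?P" by (auto simp: invariable_families_def)
  ultimately show ?thesis by (simp add: closedin_def)
qed

text \<open>The sets of families that work modulo the various open normal subgroups are closed and non-empty,
  and they shrink with \<open>N\<close>, so by compactness they have a common element.\<close>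

theorem exists_small_invariable_generating_set:
  assumes d: "d \<ge> 1" and l: "l \<ge> 1"
  shows "\<exists>S. invariably_generates G T S \<and> finite S \<and> card S \<le> l * (d - 1) + 1"
proof -
  let ?P = "product_topology (\<lambda>_. T) slot_index"
  define \<N> where "\<N> = {N. N \<lhd> G \<and> openin T N}"
  have comp: "compact_space ?P" using compact by (simp add: compact_space_product_topology)
  have closed: "\<forall>C\<in>invariable_families ` \<N>. closedin ?P C"
    using closedin_invariable_families by (auto simp: \<N>_def)
  have fip: "\<Inter> \<F> \<noteq> {}" if F: "finite \<F> \<and> \<F> \<subseteq> invariable_families ` \<N>" for \<F>
  proof -
    obtain \<M> where M: "finite \<M>" "\<M> \<subseteq> \<N>" "\<F> = invariable_families ` \<M>"
      using F finite_subset_image by metis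
    define N where "N = {g \<in> carrier G. \<forall>M\<in>\<M>. g \<in> M}"
    have "N \<lhd> G \<and> openin T N"
      unfolding N_def using M(2) openin_topspace[of T]
      by (intro open_normal_INT[OF M(1)] normal_self) (auto simp: \<N>_def)
    then have N: "N \<lhd> G" "openin T N" "\<forall>M\<in>\<M>. N \<subseteq> M" by (auto simp: N_def)
    have "invariable_families N \<subseteq> \<Inter> \<F>"
      unfolding M(3) using N(3) invariable_families_mono by blast
    then show ?thesis using invariable_families_nonempty[OF N(1,2) d] by blast
  qed
  have "\<Inter> (invariable_families ` \<N>) \<noteq> {}"
    using comp[unfolded compact_space_fip, THEN spec, THEN mp, of "invariable_families ` \<N>"] closed fip by simp
  then obtain a where a: "\<And>N. N \<lhd> G \<Longrightarrow> openin T N \<Longrightarrow> a \<in> invariable_families N"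
    by (auto simp: \<N>_def)
  have "carrier G \<in> \<N>" using openin_topspace[of T] by (simp add: \<N>_def normal_self)
  then have ac: "a s \<in> carrier G" if "s \<in> slot_index" for s
    using a[of "carrier G"] that by (auto simp: \<N>_def invariable_families_def)
  define S where "S = a ` slot_index"
  have "invariably_generates G T S"
    unfolding invariably_generates_def
  proof (intro conjI ballI)
    show "S \<subseteq> carrier G" using ac by (auto simp: S_def)
    fix g assume g: "g \<in> S \<rightarrow> carrier G"
    let ?A = "(\<lambda>s. conjugate_by G s (g s)) ` S"
    have A: "?A \<subseteq> carrier G" using g \<open>S \<subseteq> carrier G\<close> by (auto simp: conjugate_by_def)
    have "T closure_of (generate G ?A) = carrier G"
    proof (rule dense_if_dense_mod_open_normal)
      show "generate G ?A \<subseteq> carrier G" using generate_incl[OF A] .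
      fix N assume N: "N \<lhd> G" "openin T N"
      interpret second_isomorphism_grp N G "generate G ?A"
        using N generate_is_subgroup[OF A]
        by (simp add: second_isomorphism_grp_def second_isomorphism_grp_axioms_def)
      have "\<exists>h\<in>carrier G. inv h \<otimes> a s \<otimes> h \<in> N <#> generate G ?A" if s: "s \<in> slot_index" for s
      proof (rule bexI[of _ "g (a s)"])
        have "a s \<in> S" using s by (simp add: S_def)
        then have "conjugate_by G (a s) (g (a s)) \<in> generate G ?A" by (intro generate.incl) blast
        then show "inv g (a s) \<otimes> a s \<otimes> g (a s) \<in> N <#> generate G ?A"
          using S_contained_in_set_mult by (auto simp: conjugate_by_def)
        show "g (a s) \<in> carrier G" using g \<open>a s \<in> S\<close> by auto
      qed
      then have conj: "\<forall>s\<in>slot_index. \<exists>h\<in>carrier G. inv h \<otimes> a s \<otimes> h \<in> N <#> generate G ?A"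
        by blast
      have "\<forall>H. subgroup H G \<and> N \<subseteq> H \<and> (\<forall>s\<in>slot_index. \<exists>h\<in>carrier G. inv h \<otimes> a s \<otimes> h \<in> H)
          \<longrightarrow> H = carrier G"
        using a[OF N] unfolding invariable_families_def by (elim CollectE conjE)
      then show "N <#> generate G ?A = carrier G"
        by (rule allE) (erule mp, intro conjI conj normal_set_mult_subgroup H_contained_in_set_mult)
    qed
    then show "topologically_generates G T ?A"
      using A by (simp add: topologically_generates_def)
  qed
  moreover have "finite S" "card S \<le> l * (d - 1) + 1"
    using card_image_le[OF finite_slot_index, of a] card_slot_index[OF d l] finite_slot_index
    by (auto simp: S_def)
  ultimately show ?thesis by blast
qed

end

section \<open>Averaging a cocycle over the cosets of a normal subgroup\<close>

text \<open>For fixed \<open>h\<close> the function \<open>t \<mapsto> c (h t) - c t\<close> is modulo \<open>r\<close> a function on the cosets of \<open>N\<close>, and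
  as \<open>h\<close> varies these functions form a cocycle. By Shapiro's lemma it carries the same information as the
  homomorphism that \<open>c\<close> restricts to on \<open>N\<close>. Values in \<open>\<int>/r\<close> are represented by integers up to congruence,
  since \<open>r\<close> varies and so cannot be fixed by a type.\<close>

locale coset_cocycle = normal N G for N and G (structure) +
  fixes c :: "'a \<Rightarrow> int" and r :: int
  assumes add: "\<And>t n. t \<in> carrier G \<Longrightarrow> n \<in> N \<Longrightarrow> [c (t \<otimes> n) = c t + c n] (mod r)"
    and finite_index: "finite (rcosets N)"
    and coprime_index: "coprime (int (card (rcosets N))) r"
begin

text \<open>For \<open>n\<close> in \<open>N\<close> this is the value \<open>c (n t) - c t\<close> of the cocycle at \<open>n\<close>; as \<open>n\<close> varies these functions
  form a submodule.\<close>

definition conj_value :: "'a \<Rightarrow> 'a \<Rightarrow> int" where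
  "conj_value n t = c (inv t \<otimes> n \<otimes> t)"

definition conj_values :: "('a \<Rightarrow> int) set" where
  "conj_values = {u. \<exists>n\<in>N. \<forall>t\<in>carrier G. [u t = conj_value n t] (mod r)}"

lemma conj_closed: "n \<in> N \<Longrightarrow> t \<in> carrier G \<Longrightarrow> inv t \<otimes> n \<otimes> t \<in> N"
  by (rule inv_op_closed1)

lemma c_left_mult:
  assumes "n \<in> N" and "t \<in> carrier G"
  shows "[c (n \<otimes> t) = c t + conj_value n t] (mod r)"
proof -
  have "n \<otimes> t = t \<otimes> (inv t \<otimes> n \<otimes> t)" using assms by (simp add: m_assoc)
  then show ?thesis using add[OF assms(2) conj_closed[OF assms]] by (simp add: conj_value_def)
qed

lemma c_one: "[c \<one> = 0] (mod r)"
  using add[of \<one> \<one>] by (simp add: cong_iff_dvd_diff)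

lemma conj_values_zero: "(\<lambda>_. 0) \<in> conj_values"
  using c_one by (auto simp: conj_values_def conj_value_def cong_sym_eq m_assoc intro!: bexI[of _ \<one>])

lemma conj_values_add:
  assumes "u \<in> conj_values" and "v \<in> conj_values"
  shows "(\<lambda>t. u t + v t) \<in> conj_values"
proof -
  obtain m n where m: "m \<in> N" "\<forall>t\<in>carrier G. [u t = conj_value m t] (mod r)"
    and n: "n \<in> N" "\<forall>t\<in>carrier G. [v t = conj_value n t] (mod r)"
    using assms by (auto simp: conj_values_def)
  have "[u t + v t = conj_value (m \<otimes> n) t] (mod r)" if t: "t \<in> carrier G" for t
  proof -
    have "inv t \<otimes> (m \<otimes> n) \<otimes> t = (inv t \<otimes> m \<otimes> t) \<otimes> (inv t \<otimes> n \<otimes> t)"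
      using m(1) n(1) t by (simp add: m_assoc)
    then have "[conj_value (m \<otimes> n) t = conj_value m t + conj_value n t] (mod r)"
      using add[OF mem_carrier[OF conj_closed[OF m(1) t]] conj_closed[OF n(1) t]]
      by (simp add: conj_value_def)
    moreover have "[u t + v t = conj_value m t + conj_value n t] (mod r)"
      using m(2) n(2) t by (intro cong_add) auto
    ultimately show ?thesis by (meson cong_sym cong_trans)
  qed
  then show ?thesis using m(1) n(1) by (auto simp: conj_values_def intro!: bexI[of _ "m \<otimes> n"])
qed

lemma conj_values_sum:
  assumes "finite I" and "\<And>i. i \<in> I \<Longrightarrow> u i \<in> conj_values"
  shows "(\<lambda>t. \<Sum>i\<in>I. u i t) \<in> conj_values"
  using assms by (induction rule: finite_induct) (auto intro: conj_values_zero conj_values_add)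

lemma conj_values_mult:
  assumes "u \<in> conj_values"
  shows "(\<lambda>t. int k * u t) \<in> conj_values"
  using conj_values_sum[of "{..<k}" "\<lambda>_. u"] assms by simp

lemma conj_values_cong:
  assumes "u \<in> conj_values" and "\<And>t. t \<in> carrier G \<Longrightarrow> [v t = u t] (mod r)"
  shows "v \<in> conj_values"
  using assms unfolding conj_values_def by (blast intro: cong_trans)

definition rep :: "'a set \<Rightarrow> 'a" where
  "rep C = (SOME g. g \<in> C)"

lemma rep:
  assumes "C \<in> rcosets N"
  shows "rep C \<in> carrier G" and "N #> rep C = C"
proof -
  obtain g where g: "g \<in> carrier G" "C = N #> g" using assms by (auto simp: RCOSETS_def)
  then have "g \<in> C" using rcos_self[OF g(1) is_subgroup] by simp
  then have mem: "rep C \<in> C" unfolding rep_def by (rule someI)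
  then show "rep C \<in> carrier G" using g r_coset_subset_G[OF subset g(1)] by auto
  show "N #> rep C = C" using repr_independence[OF _ g(1) is_subgroup, of "rep C"] mem g(2) by simp
qed

definition index_inverse :: nat where
  "index_inverse = (SOME k. [int k * int (card (rcosets N)) = 1] (mod r))"

lemma inverse_mod:
  assumes "coprime (int m) r"
  shows "\<exists>k::nat. [int k * int m = 1] (mod r)"
proof -
  obtain k where k: "[int m * k = 1] (mod r)"
    using cong_solve_coprime_int[OF assms] by blast
  \<comment> \<open>shift into the naturals by a multiple of \<open>r\<close>\<close>
  define k' where "k' = nat (k + \<bar>k\<bar> * \<bar>r\<bar>)"
  show ?thesis
  proof (cases "r = 0")
    case True
    then have "int m = 1" using assms by simp
    then show ?thesis by (intro exI[of _ 1]) simp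
  next
    case False
    have "\<bar>k\<bar> * \<bar>r\<bar> \<ge> \<bar>k\<bar> * 1" using False by (intro mult_left_mono) auto
    then have "int k' = k + \<bar>k\<bar> * \<bar>r\<bar>" by (simp add: k'_def)
    then have "[int k' = k] (mod r)" by (simp add: cong_iff_dvd_diff)
    then have "[int k' * int m = k * int m] (mod r)" by (rule cong_mult) simp
    then show ?thesis using k by (metis cong_trans mult.commute)
  qed
qed

lemma index_inverse: "[int index_inverse * int (card (rcosets N)) = 1] (mod r)"
  unfolding index_inverse_def using inverse_mod[OF coprime_index] by (rule someI_ex)

text \<open>Replacing \<open>c\<close> by its mean over coset representatives changes the cocycle by a coboundary and leaves
  it unchanged on \<open>N\<close>. This is the usual averaging argument for the vanishing of cohomology in coprime
  characteristic.\<close>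

definition average :: "'a \<Rightarrow> int" where
  "average t = int index_inverse * (\<Sum>C\<in>rcosets N. c (rep C \<otimes> t))"

lemma average_right_mult:
  assumes "t \<in> carrier G" and "n \<in> N"
  shows "[average (t \<otimes> n) = average t + c n] (mod r)"
proof -
  have "[(\<Sum>C\<in>rcosets N. c (rep C \<otimes> (t \<otimes> n))) = (\<Sum>C\<in>rcosets N. c (rep C \<otimes> t) + c n)] (mod r)"
  proof (rule cong_sum)
    fix C assume C: "C \<in> rcosets N"
    have "rep C \<otimes> (t \<otimes> n) = rep C \<otimes> t \<otimes> n" using rep(1)[OF C] assms by (simp add: m_assoc)
    then show "[c (rep C \<otimes> (t \<otimes> n)) = c (rep C \<otimes> t) + c n] (mod r)"
      using add[of "rep C \<otimes> t" n] rep(1)[OF C] assms by simp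
  qed
  then have "[average (t \<otimes> n) = int index_inverse * (\<Sum>C\<in>rcosets N. c (rep C \<otimes> t) + c n)] (mod r)"
    unfolding average_def by (rule cong_scalar_left)
  also have "int index_inverse * (\<Sum>C\<in>rcosets N. c (rep C \<otimes> t) + c n) =
      average t + (int index_inverse * int (card (rcosets N))) * c n"
    by (simp add: average_def sum.distrib algebra_simps)
  also have "[\<dots> = average t + 1 * c n] (mod r)"
    by (intro cong_add cong_refl cong_scalar_right index_inverse)
  finally show ?thesis by simp
qed

lemma average_left_mult:
  assumes "n \<in> N" and "t \<in> carrier G"
  shows "[average (n \<otimes> t) = average t + conj_value n t] (mod r)"
proof -
  have "n \<otimes> t = t \<otimes> (inv t \<otimes> n \<otimes> t)" using assms by (simp add: m_assoc)
  then show ?thesis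
    using average_right_mult[OF assms(2) conj_closed[OF assms]] by (simp add: conj_value_def)
qed

lemma rcosets_translate:
  assumes "h \<in> carrier G"
  shows "bij_betw (\<lambda>C. C #> h) (rcosets N) (rcosets N)"
proof (rule bij_betw_byWitness[where f' = "\<lambda>C. C #> inv h"])
  have *: "C #> h #> inv h = C" "C #> inv h #> h = C" "C \<subseteq> carrier G" if "C \<in> rcosets N" for C
  proof -
    show sub: "C \<subseteq> carrier G" using that rcosets_part_G[OF is_subgroup] by blast
    show "C #> h #> inv h = C" "C #> inv h #> h = C"
      using sub assms by (simp_all add: coset_mult_assoc)
  qed
  then show "\<forall>C\<in>rcosets N. C #> h #> inv h = C" "\<forall>C\<in>rcosets N. C #> inv h #> h = C" by auto
  have "C #> k \<in> rcosets N" if C: "C \<in> rcosets N" and k: "k \<in> carrier G" for C k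
  proof -
    obtain g where "g \<in> carrier G" "C = N #> g" using C by (auto simp: RCOSETS_def)
    then show ?thesis using k rcosetsI[OF subset, of "g \<otimes> k"] by (simp add: coset_mult_assoc subset)
  qed
  then show "(\<lambda>C. C #> h) ` (rcosets N) \<subseteq> rcosets N" "(\<lambda>C. C #> inv h) ` (rcosets N) \<subseteq> rcosets N"
    using assms by auto
qed

text \<open>Translation by \<open>h\<close> permutes the cosets, so it changes each representative only by an element
  of \<open>N\<close>. The averaged cocycle therefore takes all its values in the submodule spanned by its values on
  \<open>N\<close>.\<close>

lemma average_diff_conj_value:
  assumes h: "h \<in> carrier G"
  shows "(\<lambda>t. average (h \<otimes> t) - average t) \<in> conj_values"
proof -
  define n where "n C = rep C \<otimes> h \<otimes> inv (rep (C #> h))" for C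
  define u where "u C t = conj_value (inv (rep (C #> h)) \<otimes> n C \<otimes> rep (C #> h)) t" for C t
  have bij: "bij_betw (\<lambda>C. C #> h) (rcosets N) (rcosets N)" by (rule rcosets_translate[OF h])
  have Ch: "C #> h \<in> rcosets N" if "C \<in> rcosets N" for C
    using bij that by (auto simp: bij_betw_def)
  have n: "n C \<in> N" if C: "C \<in> rcosets N" for C
  proof -
    have "N #> (rep C \<otimes> h) = N #> rep (C #> h)"
      using rep[OF C] rep[OF Ch[OF C]] h by (simp add: coset_mult_assoc[symmetric] subset)
    then have "rep C \<otimes> h \<in> N #> rep (C #> h)"
      using rcos_self[of "rep C \<otimes> h" N] rep[OF C] h is_subgroup by simp
    then obtain k where "k \<in> N" "rep C \<otimes> h = k \<otimes> rep (C #> h)" by (auto simp: r_coset_def)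
    then show ?thesis using rep(1)[OF Ch[OF C]] by (simp add: n_def m_assoc)
  qed
  have "(\<lambda>t. int index_inverse * (\<Sum>C\<in>rcosets N. u C t)) \<in> conj_values"
  proof (intro conj_values_mult conj_values_sum finite_index)
    fix C assume C: "C \<in> rcosets N"
    show "u C \<in> conj_values"
      unfolding conj_values_def u_def
      by (intro CollectI bexI[OF _ conj_closed[OF n[OF C] rep(1)[OF Ch[OF C]]]] ballI cong_refl)
  qed
  then show ?thesis
  proof (rule conj_values_cong)
    fix t assume t: "t \<in> carrier G"
    have translate: "[c (rep C \<otimes> (h \<otimes> t)) = c (rep (C #> h) \<otimes> t) + u C t] (mod r)" if C: "C \<in> rcosets N" for C
    proof -
      note rC = rep(1)[OF C] rep(1)[OF Ch[OF C]] n[OF C]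
      have "rep C \<otimes> (h \<otimes> t) = n C \<otimes> (rep (C #> h) \<otimes> t)"
        using rC(1,2) h t by (simp add: n_def m_assoc)
      moreover have "conj_value (n C) (rep (C #> h) \<otimes> t) = u C t"
        using rC h t by (simp add: u_def conj_value_def m_assoc inv_mult_group)
      ultimately show ?thesis using c_left_mult[OF rC(3), of "rep (C #> h) \<otimes> t"] rC t by simp
    qed
    have "[(\<Sum>C\<in>rcosets N. c (rep C \<otimes> (h \<otimes> t))) =
        (\<Sum>C\<in>rcosets N. c (rep (C #> h) \<otimes> t) + u C t)] (mod r)"
      by (rule cong_sum) (rule translate)
    then have "[average (h \<otimes> t) = int index_inverse * (\<Sum>C\<in>rcosets N. c (rep (C #> h) \<otimes> t) + u C t)] (mod r)"
      unfolding average_def by (rule cong_scalar_left)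
    moreover have "(\<Sum>C\<in>rcosets N. c (rep (C #> h) \<otimes> t)) = (\<Sum>C\<in>rcosets N. c (rep C \<otimes> t))"
      by (rule sum.reindex_bij_betw[OF bij])
    ultimately have "[average (h \<otimes> t) = average t + int index_inverse * (\<Sum>C\<in>rcosets N. u C t)] (mod r)"
      by (simp add: average_def sum.distrib algebra_simps)
    then show "[average (h \<otimes> t) - average t = int index_inverse * (\<Sum>C\<in>rcosets N. u C t)] (mod r)"
      by (simp add: cong_iff_dvd_diff algebra_simps)
  qed
qed

text \<open>The zero set of the averaged cocycle. It is the complement of \<open>N\<close>, modulo the kernel of the
  cocycle on \<open>N\<close>, that the averaging argument constructs.\<close>

definition stabilizer :: "'a set" where
  "stabilizer = {h \<in> carrier G. \<forall>t\<in>carrier G. [average (h \<otimes> t) = average t] (mod r)}"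

lemma stabilizer_subgroup: "subgroup stabilizer G"
proof (rule subgroup.intro)
  fix h k assume h: "h \<in> stabilizer" and k: "k \<in> stabilizer"
  then have car: "h \<in> carrier G" "k \<in> carrier G" by (auto simp: stabilizer_def)
  have "[average (h \<otimes> k \<otimes> t) = average t] (mod r)" if t: "t \<in> carrier G" for t
  proof -
    have "[average (h \<otimes> (k \<otimes> t)) = average (k \<otimes> t)] (mod r)" "[average (k \<otimes> t) = average t] (mod r)"
      using h k t car by (auto simp: stabilizer_def)
    then show ?thesis using car t by (simp add: m_assoc) (rule cong_trans)
  qed
  then show "h \<otimes> k \<in> stabilizer" using car by (simp add: stabilizer_def)
next
  fix h assume h: "h \<in> stabilizer"
  then have car: "h \<in> carrier G" by (simp add: stabilizer_def)
  have "[average (inv h \<otimes> t) = average t] (mod r)" if t: "t \<in> carrier G" for t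
  proof -
    have "inv h \<otimes> t \<in> carrier G" using car t by simp
    then have "[average (h \<otimes> (inv h \<otimes> t)) = average (inv h \<otimes> t)] (mod r)"
      using h unfolding stabilizer_def by blast
    then show ?thesis using car t by (simp add: cong_sym)
  qed
  then show "inv h \<in> stabilizer" using car by (simp add: stabilizer_def)
qed (auto simp: stabilizer_def)

lemma subset_stabilizer:
  assumes K: "K \<lhd> G" and inv: "\<And>k t. k \<in> K \<Longrightarrow> t \<in> carrier G \<Longrightarrow> [c (k \<otimes> t) = c t] (mod r)"
  shows "K \<subseteq> stabilizer"
proof
  interpret K: normal K G by (rule K)
  fix k assume k: "k \<in> K"
  have "[average (k \<otimes> t) = average t] (mod r)" if t: "t \<in> carrier G" for t
    unfolding average_def
  proof (intro cong_scalar_left cong_sum)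
    fix C assume "C \<in> rcosets N"
    then have C: "rep C \<in> carrier G" by (rule rep)
    have "rep C \<otimes> (k \<otimes> t) = (rep C \<otimes> k \<otimes> inv (rep C)) \<otimes> (rep C \<otimes> t)"
      using C k t by (simp add: m_assoc)
    then show "[c (rep C \<otimes> (k \<otimes> t)) = c (rep C \<otimes> t)] (mod r)"
      using inv[OF K.inv_op_closed2[OF C k], of "rep C \<otimes> t"] C t by simp
  qed
  then show "k \<in> stabilizer" using k by (simp add: stabilizer_def)
qed

text \<open>Conjugacy of complements in a cyclic extension. Put
  \<open>y t = (\<Sum>i<m. average (s\<^sup>i t) - average t)\<close>. As the cocycle vanishes at \<open>s [^] m\<close>, the difference
  \<open>y (s t) - y t\<close> telescopes to \<open>- m (average (s t) - average t)\<close>, and \<open>m\<close> is invertible modulo \<open>r\<close>. So the averaged cocycle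
  restricted to the group generated by \<open>s\<close> is a coboundary, and it is one of an element of the
  submodule of values on \<open>N\<close>. Conjugating by a corresponding element of \<open>N\<close> makes it vanish at \<open>s\<close>.\<close>

lemma conjugate_in_stabilizer:
  assumes s: "s \<in> carrier G" and m: "coprime (int m) r" and sm: "s [^] m \<in> N"
    and inv: "\<And>t. t \<in> carrier G \<Longrightarrow> [c (s [^] m \<otimes> t) = c t] (mod r)"
  shows "\<exists>g\<in>carrier G. inv g \<otimes> s \<otimes> g \<in> stabilizer"
proof -
  obtain k where k: "[int k * int m = 1] (mod r)" using inverse_mod[OF m] by blast
  define y where "y t = (\<Sum>i<m. average (s [^] i \<otimes> t) - average t)" for t
  have "(\<lambda>t. int k * y t) \<in> conj_values"
    unfolding y_def using s by (intro conj_values_mult conj_values_sum average_diff_conj_value) auto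
  then obtain n where n: "n \<in> N" and ny: "\<And>t. t \<in> carrier G \<Longrightarrow> [int k * y t = conj_value n t] (mod r)"
    by (auto simp: conj_values_def)
  have nc: "n \<in> carrier G" using n by simp
  have key: "[conj_value n (s \<otimes> t) - conj_value n t = average t - average (s \<otimes> t)] (mod r)"
    if t: "t \<in> carrier G" for t
  proof -
    have pw: "s [^] i \<otimes> (s \<otimes> t) = s [^] Suc i \<otimes> t" for i
      using s t by (simp add: m_assoc[symmetric])
    have "y (s \<otimes> t) - y t = (\<Sum>i<m. (average (s [^] Suc i \<otimes> t) - average (s [^] i \<otimes> t)) - (average (s \<otimes> t) - average t))"
      unfolding y_def pw sum_subtractf[symmetric] by (intro sum.cong) auto
    also have "\<dots> = (average (s [^] m \<otimes> t) - average t) - int m * (average (s \<otimes> t) - average t)"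
      using sum_lessThan_telescope[of "\<lambda>i. average (s [^] i \<otimes> t)" m] t
      by (simp only: sum_subtractf) (simp add: algebra_simps)
    finally have yd: "y (s \<otimes> t) - y t = (average (s [^] m \<otimes> t) - average t) + int m * (average t - average (s \<otimes> t))"
      by (simp add: algebra_simps)
    have "[c (s [^] m \<otimes> t) = c t + conj_value (s [^] m) t] (mod r)" by (rule c_left_mult[OF sm t])
    then have "[conj_value (s [^] m) t = 0] (mod r)"
      using inv[OF t] by (metis add.right_neutral cong_add_lcancel cong_sym cong_trans)
    then have "[average (s [^] m \<otimes> t) - average t = 0] (mod r)"
      using average_left_mult[OF sm t] by (simp add: cong_iff_dvd_diff) (metis diff_add_cancel dvd_add add.commute diff_diff_eq)
    then have "[y (s \<otimes> t) - y t = 0 + int m * (average t - average (s \<otimes> t))] (mod r)"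
      unfolding yd by (rule cong_add) simp
    then have "[int k * (y (s \<otimes> t) - y t) = int k * (int m * (average t - average (s \<otimes> t)))] (mod r)"
      by (intro cong_scalar_left) simp
    moreover have "[(int k * int m) * (average t - average (s \<otimes> t)) = 1 * (average t - average (s \<otimes> t))] (mod r)"
      by (intro cong_scalar_right k)
    moreover have "[int k * y (s \<otimes> t) - int k * y t = conj_value n (s \<otimes> t) - conj_value n t] (mod r)"
      using s t by (intro cong_diff ny) auto
    ultimately show ?thesis
      by (simp add: right_diff_distrib mult.assoc) (meson cong_sym cong_trans)
  qed
  have "[average (n \<otimes> s \<otimes> inv n \<otimes> t) = average t] (mod r)" if t: "t \<in> carrier G" for t
  proof -
    define t' where "t' = inv n \<otimes> t"
    have t': "t' \<in> carrier G" "t = n \<otimes> t'" using nc t by (simp_all add: t'_def)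
    have "n \<otimes> s \<otimes> inv n \<otimes> t = n \<otimes> (s \<otimes> t')" using nc s t by (simp add: t'_def m_assoc)
    then have 1: "[average (n \<otimes> s \<otimes> inv n \<otimes> t) = average (s \<otimes> t') + conj_value n (s \<otimes> t')] (mod r)"
      using average_left_mult[OF n, of "s \<otimes> t'"] s t' by simp
    have 2: "[average t = average t' + conj_value n t'] (mod r)"
      using average_left_mult[OF n t'(1)] t'(2) by simp
    have "[average (s \<otimes> t') + conj_value n t' + (conj_value n (s \<otimes> t') - conj_value n t') =
        average (s \<otimes> t') + conj_value n t' + (average t' - average (s \<otimes> t'))] (mod r)"
      by (intro cong_add cong_refl key t')
    then have "[average (s \<otimes> t') + conj_value n (s \<otimes> t') = average t' + conj_value n t'] (mod r)"
      by (simp add: algebra_simps)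
    then show ?thesis using 1 2 by (meson cong_sym cong_trans)
  qed
  then have "inv (inv n) \<otimes> s \<otimes> inv n \<in> stabilizer"
    using nc s by (simp add: stabilizer_def)
  then show ?thesis using nc by (intro bexI[of _ "inv n"]) auto
qed

lemma cocycle_trivial_on_N:
  assumes "stabilizer = carrier G" and n: "n \<in> N"
  shows "[c n = 0] (mod r)"
proof -
  have "n \<in> stabilizer" using assms by simp
  then have "[average (n \<otimes> \<one>) = average \<one>] (mod r)" unfolding stabilizer_def by blast
  moreover have "[average (\<one> \<otimes> n) = average \<one> + c n] (mod r)"
    using average_right_mult[OF one_closed n] .
  ultimately have "[average \<one> + c n = average \<one> + 0] (mod r)"
    using n by simp (meson cong_sym cong_trans)
  then show ?thesis by (simp only: cong_add_lcancel)
qed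

end

section \<open>Cocycles from the universal property\<close>

text \<open>The regular wreath product of \<open>\<int>/r\<close> by \<open>Q\<close>, with residues represented in \<open>{0..<r}\<close> so that its carrier is
  finite.\<close>

definition wreath :: "int \<Rightarrow> ('q, 'm) monoid_scheme \<Rightarrow> ('q \<times> ('q \<Rightarrow> int)) monoid" where
  "wreath r Q = \<lparr>carrier = carrier Q \<times> (carrier Q \<rightarrow>\<^sub>E {0..<r}),
     monoid.mult = (\<lambda>(a, u) (b, v). (a \<otimes>\<^bsub>Q\<^esub> b, \<lambda>p\<in>carrier Q. (u (b \<otimes>\<^bsub>Q\<^esub> p) + v p) mod r)),
     one = (\<one>\<^bsub>Q\<^esub>, \<lambda>p\<in>carrier Q. 0)\<rparr>"

lemma wreath_simps:
  "carrier (wreath r Q) = carrier Q \<times> (carrier Q \<rightarrow>\<^sub>E {0..<r})"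
  "(a, u) \<otimes>\<^bsub>wreath r Q\<^esub> (b, v) = (a \<otimes>\<^bsub>Q\<^esub> b, \<lambda>p\<in>carrier Q. (u (b \<otimes>\<^bsub>Q\<^esub> p) + v p) mod r)"
  "\<one>\<^bsub>wreath r Q\<^esub> = (\<one>\<^bsub>Q\<^esub>, \<lambda>p\<in>carrier Q. 0)"
  by (simp_all add: wreath_def)

context group
begin

lemma wreath_group:
  assumes r: "r > 0"
  shows "group (wreath r G)"
proof (rule groupI)
  show "z \<otimes>\<^bsub>wreath r G\<^esub> z' \<in> carrier (wreath r G)"
    if "z \<in> carrier (wreath r G)" "z' \<in> carrier (wreath r G)" for z z'
    using that r by (auto simp: wreath_simps split: prod.splits)
  show "\<one>\<^bsub>wreath r G\<^esub> \<in> carrier (wreath r G)" using r by (simp add: wreath_simps)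
  show "z \<otimes>\<^bsub>wreath r G\<^esub> z' \<otimes>\<^bsub>wreath r G\<^esub> z'' = z \<otimes>\<^bsub>wreath r G\<^esub> (z' \<otimes>\<^bsub>wreath r G\<^esub> z'')"
    if "z \<in> carrier (wreath r G)" "z' \<in> carrier (wreath r G)" "z'' \<in> carrier (wreath r G)" for z z' z''
  proof -
    obtain a u b v c w where z: "z = (a, u)" "z' = (b, v)" "z'' = (c, w)" by (metis surj_pair)
    then have "a \<in> carrier G" "b \<in> carrier G" "c \<in> carrier G" using that by (auto simp: wreath_simps)
    then show ?thesis
      unfolding z by (auto simp: wreath_simps m_assoc mod_simps add.assoc intro!: restrict_ext)
  qed
  show "\<one>\<^bsub>wreath r G\<^esub> \<otimes>\<^bsub>wreath r G\<^esub> z = z" if z: "z \<in> carrier (wreath r G)" for z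
  proof -
    obtain a u where au: "z = (a, u)" by (metis surj_pair)
    then have a: "a \<in> carrier G" and u: "u \<in> carrier G \<rightarrow>\<^sub>E {0..<r}" using z by (auto simp: wreath_simps)
    have "(\<lambda>p\<in>carrier G. u p mod r) = u"
    proof
      fix p show "(\<lambda>p\<in>carrier G. u p mod r) p = u p"
        using PiE_mem[OF u, of p] PiE_arb[OF u, of p] by (cases "p \<in> carrier G") auto
    qed
    then show ?thesis unfolding au using a by (simp add: wreath_simps cong: restrict_cong)
  qed
  show "\<exists>z'\<in>carrier (wreath r G). z' \<otimes>\<^bsub>wreath r G\<^esub> z = \<one>\<^bsub>wreath r G\<^esub>"
    if z: "z \<in> carrier (wreath r G)" for z
  proof -
    obtain a u where au: "z = (a, u)" by (metis surj_pair)
    then have a: "a \<in> carrier G" using z by (auto simp: wreath_simps)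
    let ?z = "(inv a, \<lambda>p\<in>carrier G. (- u (inv a \<otimes> p)) mod r)"
    have "?z \<otimes>\<^bsub>wreath r G\<^esub> z = \<one>\<^bsub>wreath r G\<^esub>"
      unfolding au using a by (auto simp: wreath_simps mod_simps intro!: restrict_ext)
    moreover have "?z \<in> carrier (wreath r G)" using a r by (auto simp: wreath_simps)
    ultimately show ?thesis by blast
  qed
qed

lemma finite_wreath: "finite (carrier G) \<Longrightarrow> finite (carrier (wreath r G))"
  by (simp add: wreath_simps finite_PiE)

lemma soluble_mono:
  assumes "soluble_of_derived_length_at_most i G" and "i \<le> j"
  shows "soluble_of_derived_length_at_most j G"
proof -
  have "derived_term j \<subseteq> {\<one>}"
    using derived_term_antimono[OF assms(2)] assms(1)
    by (simp add: soluble_of_derived_length_at_most_def)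
  moreover have "\<one> \<in> derived_term j"
    by (rule subgroup.one_closed[OF exp_of_derived_is_subgroup[OF subgroup_self]])
  ultimately show ?thesis by (auto simp: soluble_of_derived_length_at_most_def is_group)
qed

text \<open>The base group is abelian and the quotient by it is the group that acts.\<close>

lemma soluble_wreath:
  assumes r: "r > 0" and sol: "soluble_of_derived_length_at_most j G"
  shows "soluble_of_derived_length_at_most (Suc j) (wreath r G)"
proof -
  let ?W = "wreath r G"
  interpret W: group ?W by (rule wreath_group[OF r])
  have "fst \<in> hom ?W G" by (auto simp: hom_def wreath_simps)
  then interpret p: group_hom ?W G fst
    by (intro group_hom.intro group_hom_axioms.intro W.is_group is_group)
  have "fst ` carrier ?W = carrier G"
  proof
    show "fst ` carrier ?W \<subseteq> carrier G" by (auto simp: wreath_simps)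
    show "carrier G \<subseteq> fst ` carrier ?W"
    proof
      fix a assume "a \<in> carrier G"
      then have "(a, \<lambda>p\<in>carrier G. 0) \<in> carrier ?W" using r by (simp add: wreath_simps)
      then show "a \<in> fst ` carrier ?W" by (rule image_eqI[rotated]) simp
    qed
  qed
  then have "fst ` W.derived_term j = {\<one>}"
    using p.exp_of_derived_img[OF subset_refl, of j] sol
    by (simp add: soluble_of_derived_length_at_most_def)
  then have fst: "fst z = \<one>" if "z \<in> W.derived_term j" for z using that by auto
  have car: "W.derived_term j \<subseteq> carrier ?W" by (rule W.exp_of_derived_in_carrier[OF subset_refl])
  have comm: "z \<otimes>\<^bsub>?W\<^esub> z' = z' \<otimes>\<^bsub>?W\<^esub> z" if zz: "z \<in> W.derived_term j" "z' \<in> W.derived_term j" for z z'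
  proof -
    obtain u v where "z = (\<one>, u)" "z' = (\<one>, v)" using fst[OF zz(1)] fst[OF zz(2)] by (metis prod.collapse)
    then show ?thesis by (auto simp: wreath_simps add.commute intro!: restrict_ext)
  qed
  have "derived_set ?W (W.derived_term j) \<subseteq> {\<one>\<^bsub>?W\<^esub>}"
  proof clarsimp
    fix z z' assume z: "z \<in> W.derived_term j" "z' \<in> W.derived_term j"
    then show "z \<otimes>\<^bsub>?W\<^esub> z' \<otimes>\<^bsub>?W\<^esub> inv\<^bsub>?W\<^esub> z \<otimes>\<^bsub>?W\<^esub> inv\<^bsub>?W\<^esub> z' = \<one>\<^bsub>?W\<^esub>"
      using W.commute_iff_commutator[of z z'] comm[OF z] car by blast
  qed
  then have "W.derived_term (Suc j) \<subseteq> {\<one>\<^bsub>?W\<^esub>}"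
    using W.generate_subgroup_incl[OF _ W.triv_subgroup] by (simp add: derived_def)
  moreover have "\<one>\<^bsub>?W\<^esub> \<in> W.derived_term (Suc j)"
    by (rule subgroup.one_closed[OF W.exp_of_derived_is_subgroup[OF W.subgroup_self]])
  ultimately show ?thesis
    using W.is_group unfolding soluble_of_derived_length_at_most_def by blast
qed

end

text \<open>The elements of \<open>N\<close> at which the cocycle vanishes. For the cocycles constructed next the values of
  \<open>c\<close> are canonical residues, so equality can replace congruence.\<close>

definition (in group) cocycle_kernel :: "'a set \<Rightarrow> ('a \<Rightarrow> int) \<Rightarrow> 'a set" where
  "cocycle_kernel N c = {n \<in> N. \<forall>t\<in>carrier G. c (n \<otimes> t) = c t}"

text \<open>The cocycle is read off from the homomorphism into the wreath product of \<open>\<int>/r\<close> with the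
  quotient by \<open>N\<close> that sends \<open>x i\<close> to the pair of its coset and \<open>w i\<close>: evaluate the second component
  at the trivial coset.\<close>

lemma (in free_soluble) cocycle_exists:
  assumes nN: "N \<lhd> G" and op: "openin T N" and dN: "derived_term j \<subseteq> N" and j: "j < l"
    and r: "r > 0" and w: "\<And>i. i < d \<Longrightarrow> w i \<in> carrier (G Mod N) \<rightarrow>\<^sub>E {0..<r}"
  shows "\<exists>c. (\<forall>t\<in>carrier G. c t \<in> {0..<r}) \<and>
    (\<forall>t\<in>carrier G. \<forall>n\<in>N. [c (t \<otimes> n) = c t + c n] (mod r)) \<and>
    (\<forall>i<d. \<forall>t\<in>carrier G. [c (x i \<otimes> t) = w i (N #> t) + c t] (mod r)) \<and>
    cocycle_kernel N c \<lhd> G \<and> openin T (cocycle_kernel N c) \<and>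
    derived_term (Suc j) \<subseteq> cocycle_kernel N c"
proof -
  interpret N: normal N G by (rule nN)
  define Q where "Q = G Mod N"
  interpret Q: group Q unfolding Q_def by (rule N.factorgroup_is_group)
  define p where "p g = N #> g" for g
  have phom: "p \<in> hom G Q" unfolding p_def Q_def by (rule N.r_coset_hom_Mod)
  interpret p: group_hom G Q p
    by (intro group_hom.intro group_hom_axioms.intro is_group Q.is_group phom)
  have carQ: "carrier Q = p ` carrier G" by (simp add: Q_def p_def carrier_FactGroup)
  have oneQ: "\<one>\<^bsub>Q\<^esub> = N" by (simp add: Q_def)
  have pN: "p n = N" if "n \<in> N" for n
    using that N.rcos_const[OF is_group] by (simp add: p_def)
  have solQl: "soluble_of_derived_length_at_most l Q"
    unfolding Q_def by (rule soluble_FactGroup[OF nN])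
  have finQ: "finite (carrier Q)"
    using finite_rcosets_open_subgroup[OF compact N.is_subgroup op] by (simp add: Q_def FactGroup_def)
  have contp: "continuous_map T (discrete_topology (carrier Q)) p"
    unfolding Q_def p_def by (rule continuous_map_FactGroup[OF N.is_subgroup op])
  have "Q.derived_term j = p ` derived_term j"
    using p.exp_of_derived_img[OF subset_refl, of j] by (simp add: carQ)
  also have "\<dots> = {\<one>\<^bsub>Q\<^esub>}"
    using pN dN subgroup.one_closed[OF exp_of_derived_is_subgroup[OF subgroup_self, of j]]
    by (auto simp: oneQ image_iff)
  finally have solQ: "soluble_of_derived_length_at_most j Q"
    using Q.is_group by (simp add: soluble_of_derived_length_at_most_def)
  define W where "W = wreath r Q"
  interpret W: group W unfolding W_def by (rule Q.wreath_group[OF r])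
  have solW: "soluble_of_derived_length_at_most (Suc j) W"
    unfolding W_def by (rule Q.soluble_wreath[OF r solQ])
  have solWl: "soluble_of_derived_length_at_most l W"
    using W.soluble_mono[OF solW] j by simp
  have finW: "finite (carrier W)" unfolding W_def by (rule Q.finite_wreath[OF finQ])
  have "(p (x i), w i) \<in> carrier W" if "i < d" for i
    using w[OF that] generator_closed[OF that] by (simp add: W_def wreath_simps Q_def[symmetric])
  then obtain \<Phi> where \<Phi>: "\<Phi> \<in> hom G W" and cont: "continuous_map T (discrete_topology (carrier W)) \<Phi>"
    and \<Phi>x: "\<forall>i<d. \<Phi> (x i) = (p (x i), w i)"
    using hom_to_finite_exists[OF solWl finW, of "\<lambda>i. (p (x i), w i)"] by blast
  interpret P: group_hom G W \<Phi>
    by (intro group_hom.intro group_hom_axioms.intro is_group W.is_group \<Phi>)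
  have fsthom: "fst \<in> hom W Q" by (auto simp: hom_def W_def wreath_simps)
  have fst\<Phi>: "fst (\<Phi> g) = p g" if g: "g \<in> carrier G" for g
  proof -
    have h1: "fst \<circ> \<Phi> \<in> hom G Q" by (rule Group.hom_compose[OF \<Phi> fsthom])
    have h2: "continuous_map T (discrete_topology (carrier Q)) (fst \<circ> \<Phi>)"
      using fsthom by (intro continuous_map_compose[OF cont]) (auto simp: hom_def)
    have "(fst \<circ> \<Phi>) (x i) = p (x i)" if "i < d" for i using \<Phi>x that by simp
    then show ?thesis using hom_to_finite_unique[OF solQl finQ h1 h2 phom contp _ g] by simp
  qed
  define v where "v g = snd (\<Phi> g)" for g
  have v: "v g \<in> carrier Q \<rightarrow>\<^sub>E {0..<r}" if g: "g \<in> carrier G" for g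
    using P.hom_closed[OF g] by (auto simp: v_def W_def wreath_simps)
  have \<Phi>_eq: "\<Phi> g = (p g, v g)" if "g \<in> carrier G" for g
    using fst\<Phi>[OF that] by (simp add: v_def prod_eq_iff)
  have v_mult: "v (f \<otimes> g) q = (v f (p g \<otimes>\<^bsub>Q\<^esub> q) + v g q) mod r"
    if "f \<in> carrier G" "g \<in> carrier G" "q \<in> carrier Q" for f g q
  proof -
    have "\<Phi> (f \<otimes> g) = \<Phi> f \<otimes>\<^bsub>W\<^esub> \<Phi> g" using that by simp
    then show ?thesis using that by (simp add: \<Phi>_eq W_def wreath_simps)
  qed
  define c where "c t = v t N" for t
  have NQ: "N \<in> carrier Q" using Q.one_closed by (simp add: oneQ)
  have c_range: "c t \<in> {0..<r}" if "t \<in> carrier G" for t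
    using PiE_mem[OF v[OF that] NQ] by (simp add: c_def)
  have c_mult: "c (f \<otimes> t) = (v f (p t) + c t) mod r" if "f \<in> carrier G" "t \<in> carrier G" for f t
  proof -
    have "p t \<otimes>\<^bsub>Q\<^esub> N = p t" using Q.r_one[of "p t"] that by (simp add: oneQ)
    then show ?thesis using v_mult[OF that NQ] by (simp add: c_def)
  qed
  have add: "[c (t \<otimes> n) = c t + c n] (mod r)" if "t \<in> carrier G" "n \<in> N" for t n
    using c_mult[OF that(1) N.mem_carrier[OF that(2)]] pN[OF that(2)] by (simp add: c_def cong_def)
  have gens: "[c (x i \<otimes> t) = w i (N #> t) + c t] (mod r)" if "i < d" "t \<in> carrier G" for i t
    using c_mult[OF generator_closed[OF that(1)] that(2)] \<Phi>x that(1)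
    by (simp add: v_def p_def cong_def)
  have ker: "cocycle_kernel N c = kernel G W \<Phi>"
  proof
    show "cocycle_kernel N c \<subseteq> kernel G W \<Phi>"
    proof
      fix n assume n: "n \<in> cocycle_kernel N c"
      then have nc: "n \<in> carrier G" "n \<in> N" by (auto simp: cocycle_kernel_def)
      have "v n = (\<lambda>q\<in>carrier Q. 0)"
      proof
        fix q show "v n q = (\<lambda>q\<in>carrier Q. 0) q"
        proof (cases "q \<in> carrier Q")
          case True
          then obtain t where t: "t \<in> carrier G" "q = p t" using carQ by auto
          have "c t = (v n q + c t) mod r" using c_mult[OF nc(1) t(1)] n t by (simp add: cocycle_kernel_def)
          moreover have "c t = c t mod r" using c_range[OF t(1)] by simp
          ultimately have "[v n q + c t = 0 + c t] (mod r)" by (simp add: cong_def)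
          then have "[v n q = 0] (mod r)" by (simp only: cong_add_rcancel)
          moreover have "v n q \<in> {0..<r}" using PiE_mem[OF v[OF nc(1)] True] .
          ultimately have "v n q = 0" by (simp add: cong_def)
          then show ?thesis using True by simp
        qed (use PiE_arb[OF v[OF nc(1)]] in simp)
      qed
      then have "\<Phi> n = \<one>\<^bsub>W\<^esub>"
        using \<Phi>_eq[OF nc(1)] pN[OF nc(2)] by (simp add: W_def wreath_simps oneQ)
      then show "n \<in> kernel G W \<Phi>" using nc by (simp add: kernel_def)
    qed
    show "kernel G W \<Phi> \<subseteq> cocycle_kernel N c"
    proof
      fix n assume "n \<in> kernel G W \<Phi>"
      then have nc: "n \<in> carrier G" and "\<Phi> n = \<one>\<^bsub>W\<^esub>" by (auto simp: kernel_def)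
      then have pn: "p n = N" and vn: "v n = (\<lambda>q\<in>carrier Q. 0)"
        using \<Phi>_eq[OF nc] by (auto simp: W_def wreath_simps oneQ)
      have "n \<in> N" using rcos_self[OF nc N.is_subgroup] pn by (simp add: p_def)
      moreover have "c (n \<otimes> t) = c t" if t: "t \<in> carrier G" for t
        using c_mult[OF nc t] vn c_range[OF t] t by (simp add: carQ)
      ultimately show "n \<in> cocycle_kernel N c" by (simp add: cocycle_kernel_def)
    qed
  qed
  have "openin T {g \<in> topspace T. \<Phi> g = \<one>\<^bsub>W\<^esub>}"
    using cont W.one_closed unfolding continuous_map_discrete_iff by blast
  then have opK: "openin T (kernel G W \<Phi>)" by (simp add: kernel_def)
  have dK: "derived_term (Suc j) \<subseteq> kernel G W \<Phi>"
  proof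
    fix g assume g: "g \<in> derived_term (Suc j)"
    have gc: "g \<in> carrier G" using g exp_of_derived_in_carrier[OF subset_refl, of "Suc j"] by blast
    have "\<Phi> ` derived_term (Suc j) = (derived W ^^ Suc j) (\<Phi> ` carrier G)"
      by (rule P.exp_of_derived_img[OF subset_refl, symmetric])
    also have "\<dots> \<subseteq> W.derived_term (Suc j)"
      by (rule W.mono_exp_of_derived) auto
    also have "\<dots> = {\<one>\<^bsub>W\<^esub>}" using solW by (simp only: soluble_of_derived_length_at_most_def)
    finally show "g \<in> kernel G W \<Phi>" using g gc unfolding kernel_def by blast
  qed
  show ?thesis
    by (rule exI[of _ c]) (use c_range add gens ker P.normal_kernel opK dK in simp)
qed

section \<open>Counting cocycles and the lower bound\<close>

context coset_cocycle
begin

text \<open>Inner automorphisms by elements of \<open>N\<close> do not affect the additive map \<open>c\<close> on \<open>N\<close>.\<close>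

lemma conj_value_left_coset:
  assumes s: "s \<in> carrier G" and m: "m \<in> N" and sm: "s \<otimes> m = m \<otimes> s"
    and n: "n \<in> N" and t: "t \<in> carrier G"
  shows "[conj_value m (n \<otimes> (s [^] (i::nat) \<otimes> t)) = conj_value m t] (mod r)"
proof -
  define u where "u = s [^] i \<otimes> t"
  have mc: "m \<in> carrier G" and nc: "n \<in> carrier G" using m n by auto
  have u: "u \<in> carrier G" using s t by (simp add: u_def)
  have pw: "s [^] i \<otimes> m = m \<otimes> s [^] i"
  proof (induction i)
    case (Suc i)
    have "s [^] Suc i \<otimes> m = s [^] i \<otimes> (s \<otimes> m)" using s mc by (simp add: m_assoc)
    also have "\<dots> = (s [^] i \<otimes> m) \<otimes> s" using s mc sm by (simp add: m_assoc)
    also have "\<dots> = m \<otimes> s [^] Suc i" using Suc s mc by (simp add: m_assoc)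
    finally show ?case .
  qed (use mc in simp)
  have "inv u \<otimes> m \<otimes> u = inv t \<otimes> (inv (s [^] i) \<otimes> (m \<otimes> s [^] i)) \<otimes> t"
    using s t mc by (simp add: u_def m_assoc inv_mult_group)
  also have "\<dots> = inv t \<otimes> m \<otimes> t" using s t mc by (simp add: pw[symmetric] m_assoc)
  finally have tu: "inv u \<otimes> m \<otimes> u = inv t \<otimes> m \<otimes> t" .
  define n' where "n' = inv u \<otimes> n \<otimes> u"
  have n': "n' \<in> N" "n' \<in> carrier G" using conj_closed[OF n u] by (auto simp: n'_def)
  define k where "k = inv t \<otimes> m \<otimes> t"
  have k: "k \<in> N" "k \<in> carrier G" using conj_closed[OF m t] by (auto simp: k_def)
  have "inv (n \<otimes> u) \<otimes> m \<otimes> (n \<otimes> u) = inv n' \<otimes> k \<otimes> n'"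
    using tu[symmetric] u mc nc by (simp add: n'_def k_def m_assoc inv_mult_group)
  then have "conj_value m (n \<otimes> u) = c (inv n' \<otimes> k \<otimes> n')" by (simp add: conj_value_def)
  also have "[c (inv n' \<otimes> k \<otimes> n') = c (inv n' \<otimes> k) + c n'] (mod r)"
    using n' k by (intro add) simp_all
  also have "[c (inv n' \<otimes> k) + c n' = (c (inv n') + c k) + c n'] (mod r)"
    using n' k by (intro cong_add cong_refl add) simp_all
  also have "(c (inv n') + c k) + c n' = (c (inv n') + c n') + c k" by simp
  also have "[(c (inv n') + c n') + c k = c (inv n' \<otimes> n') + c k] (mod r)"
    using n' by (intro cong_add cong_refl cong_sym[OF add]) simp_all
  also have "[c (inv n' \<otimes> n') + c k = 0 + c k] (mod r)"
    using n' by (intro cong_add cong_refl) (simp add: c_one)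
  finally show ?thesis by (simp add: u_def k_def conj_value_def)
qed

text \<open>On powers of an element of \<open>N\<close> the cocycle is linear.\<close>

lemma c_power_mult:
  assumes n: "n \<in> N" and t: "t \<in> carrier G"
  shows "[c (n [^] (i::nat) \<otimes> t) = c t + int i * conj_value n t] (mod r)"
proof (induction i)
  case (Suc i)
  have nc: "n \<in> carrier G" using n by simp
  have ni: "n [^] i \<in> N" using n by (induction i) auto
  have "n [^] Suc i \<otimes> t = n [^] i \<otimes> t \<otimes> (inv t \<otimes> n \<otimes> t)" using nc t by (simp add: m_assoc)
  then have "[c (n [^] Suc i \<otimes> t) = c (n [^] i \<otimes> t) + conj_value n t] (mod r)"
    using add[OF _ conj_closed[OF n t], of "n [^] i \<otimes> t"] nc t by (simp add: conj_value_def)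
  also have "[c (n [^] i \<otimes> t) + conj_value n t = c t + int i * conj_value n t + conj_value n t] (mod r)"
    by (intro cong_add Suc cong_refl)
  finally show ?case by (simp add: algebra_simps)
qed (use t in simp)

text \<open>The quotient of \<open>N\<close> by the kernel has exponent \<open>r\<close>, hence no elements of order less than the
  prime \<open>r\<close>.\<close>

lemma cocycle_kernel_pure:
  assumes range: "\<And>t. t \<in> carrier G \<Longrightarrow> c t \<in> {0..<r}" and r: "prime r"
    and n: "n \<in> N" and i: "0 < i" "int i < r" and ni: "n [^] i \<in> cocycle_kernel N c"
  shows "n \<in> cocycle_kernel N c"
proof -
  have "c (n \<otimes> t) = c t" if t: "t \<in> carrier G" for t
  proof -
    have "[c t + int i * conj_value n t = c t + 0] (mod r)"
      using c_power_mult[OF n t, of i] ni t by (simp add: cocycle_kernel_def cong_sym)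
    then have "[int i * conj_value n t = 0] (mod r)" by (simp only: cong_add_lcancel)
    then have "r dvd int i \<or> r dvd conj_value n t"
      using r by (simp add: cong_0_iff prime_dvd_mult_iff)
    then have "r dvd conj_value n t" using i zdvd_not_zless by auto
    then have "[c t + conj_value n t = c t + 0] (mod r)" by (intro cong_add) (simp_all add: cong_0_iff)
    then have "[c (n \<otimes> t) = c t] (mod r)" using c_left_mult[OF n t] by (simp add: cong_trans)
    then show ?thesis
      using range[of "n \<otimes> t"] range[OF t] n t by (simp add: cong_def)
  qed
  then show ?thesis using n by (simp add: cocycle_kernel_def)
qed

end

context top_group
begin

lemma invariably_generates_open_subgroup:
  assumes S: "invariably_generates G T S" and H: "subgroup H G" and op: "openin T H"
    and conj: "\<And>s. s \<in> S \<Longrightarrow> \<exists>g\<in>carrier G. inv g \<otimes> s \<otimes> g \<in> H"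
  shows "H = carrier G"
proof -
  obtain g where g: "\<forall>s\<in>S. g s \<in> carrier G \<and> inv (g s) \<otimes> s \<otimes> g s \<in> H"
    using conj by metis
  let ?A = "(\<lambda>s. conjugate_by G s (g s)) ` S"
  have "g \<in> S \<rightarrow> carrier G" using g by simp
  then have "T closure_of (generate G ?A) = carrier G"
    using S by (simp add: invariably_generates_def topologically_generates_def)
  moreover have "generate G ?A \<subseteq> H"
    using g by (intro generate_subgroup_incl[OF _ H]) (auto simp: conjugate_by_def)
  then have "T closure_of (generate G ?A) \<subseteq> H"
    by (rule closure_of_minimal[OF _ closedin_open_subgroup[OF H op]])
  ultimately show ?thesis using subgroup.subset[OF H] by blast
qed

text \<open>If the cocycle vanishes on all conjugates of the powers of elements of \<open>S\<close> that lie in \<open>N\<close>, then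
  the stabiliser of the averaged cocycle is an open subgroup containing conjugates of all
  elements of \<open>S\<close>.\<close>

lemma cocycle_rigid:
  assumes S: "invariably_generates G T S" and cc: "coset_cocycle N G c r"
    and K: "K \<lhd> G" "openin T K" "\<And>k t. k \<in> K \<Longrightarrow> t \<in> carrier G \<Longrightarrow> [c (k \<otimes> t) = c t] (mod r)"
    and van: "\<And>s. s \<in> S \<Longrightarrow> \<exists>m::nat. coprime (int m) r \<and> s [^] m \<in> N \<and>
                (\<forall>t\<in>carrier G. [c (s [^] m \<otimes> t) = c t] (mod r))"
    and n: "n \<in> N"
  shows "[c n = 0] (mod r)"
proof -
  interpret coset_cocycle N G c r by (rule cc)
  have "stabilizer = carrier G"
  proof (rule invariably_generates_open_subgroup[OF S stabilizer_subgroup])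
    have "K \<subseteq> stabilizer" using K by (intro subset_stabilizer) auto
    moreover have "\<one> \<in> K" using K(1) by (intro subgroup.one_closed normal_imp_subgroup)
    ultimately show "openin T stabilizer" using openin_subgroupI[OF stabilizer_subgroup K(2)] by blast
    fix s assume s: "s \<in> S"
    then have sc: "s \<in> carrier G" using S by (auto simp: invariably_generates_def)
    obtain m :: nat where "coprime (int m) r" "s [^] m \<in> N"
      "\<forall>t\<in>carrier G. [c (s [^] m \<otimes> t) = c t] (mod r)" using van[OF s] by blast
    then show "\<exists>g\<in>carrier G. inv g \<otimes> s \<otimes> g \<in> stabilizer"
      by (intro conjugate_in_stabilizer[OF sc]) auto
  qed
  then show ?thesis using n by (rule cocycle_trivial_on_N)
qed

end

context profinite
begin

text \<open>The elements on which a cocycle is tested: for \<open>s\<close> of order \<open>m\<close> modulo \<open>N\<close>, one conjugate of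
  \<open>s [^] m\<close> for each coset of the cyclic group generated by \<open>s\<close> in the quotient by \<open>N\<close>.\<close>

definition test_cosets :: "'a set \<Rightarrow> 'a \<Rightarrow> 'a set set set" where
  "test_cosets N s = rcosets\<^bsub>G Mod N\<^esub> (generate (G Mod N) {N #> s})"

definition test_rep :: "'a set \<Rightarrow> 'a set set \<Rightarrow> 'a" where
  "test_rep N C = (SOME t. t \<in> carrier G \<and> N #> t \<in> C)"

lemma test_cosets_card:
  assumes nN: "N \<lhd> G" and op: "openin T N" and s: "s \<in> carrier G"
  shows "finite (test_cosets N s)"
    and "card (test_cosets N s) * group.ord (G Mod N) (N #> s) = card (rcosets N)"
    and "group.ord (G Mod N) (N #> s) \<ge> 1"
proof -
  interpret N: normal N G by (rule nN)
  interpret Q: group "G Mod N" by (rule N.factorgroup_is_group)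
  have Ns: "N #> s \<in> carrier (G Mod N)" using s by (simp add: carrier_FactGroup)
  have fin: "finite (carrier (G Mod N))"
    using finite_rcosets_open_subgroup[OF compact N.is_subgroup op] by (simp add: FactGroup_def)
  have sub: "subgroup (generate (G Mod N) {N #> s}) (G Mod N)"
    using Ns by (intro Q.generate_is_subgroup) simp
  show "finite (test_cosets N s)"
    unfolding test_cosets_def
    by (rule finite_UnionD) (simp add: Q.rcosets_part_G[OF sub] fin)
  show "card (test_cosets N s) * Q.ord (N #> s) = card (rcosets N)"
    using Q.lagrange[OF sub] Q.generate_pow_card[OF Ns]
    by (simp add: test_cosets_def order_def FactGroup_def)
  show "Q.ord (N #> s) \<ge> 1" using Q.ord_ge_1[OF fin Ns] .
qed

lemma test_coset_exists:
  assumes nN: "N \<lhd> G" and s: "s \<in> carrier G" and t: "t \<in> carrier G"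
    and fin: "finite (rcosets N)"
  shows "\<exists>C\<in>test_cosets N s. \<exists>n\<in>N. \<exists>i::nat. test_rep N C = n \<otimes> (s [^] i \<otimes> t)"
proof -
  interpret N: normal N G by (rule nN)
  interpret Q: group "G Mod N" by (rule N.factorgroup_is_group)
  let ?Q = "G Mod N"
  have Ns: "N #> s \<in> carrier ?Q" and Nt: "N #> t \<in> carrier ?Q"
    using s t by (simp_all add: carrier_FactGroup)
  have finQ: "finite (carrier ?Q)" using fin by (simp add: FactGroup_def)
  have sub: "subgroup (generate ?Q {N #> s}) ?Q"
    using Ns by (intro Q.generate_is_subgroup) simp
  define C where "C = generate ?Q {N #> s} #>\<^bsub>?Q\<^esub> (N #> t)"
  have C: "C \<in> test_cosets N s"
    unfolding C_def test_cosets_def using Q.rcosetsI[OF subgroup.subset[OF sub] Nt] .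
  have "N #> t \<in> C" unfolding C_def by (rule Q.rcos_self[OF Nt sub])
  then have rep: "test_rep N C \<in> carrier G" "N #> test_rep N C \<in> C"
    using someI[of "\<lambda>t. t \<in> carrier G \<and> N #> t \<in> C" t] t by (auto simp: test_rep_def)
  then obtain z where z: "z \<in> generate ?Q {N #> s}" "N #> test_rep N C = z <#> (N #> t)"
    by (auto simp: C_def r_coset_def[of ?Q])
  then obtain i :: nat where "z = (N #> s) [^]\<^bsub>?Q\<^esub> i"
    using Q.generate_pow_on_finite_carrier[OF finQ Ns] by auto
  then have "z = N #> (s [^] i)" using N.FactGroup_pow[OF s] by simp
  then have "N #> test_rep N C = N #> (s [^] i \<otimes> t)" using z(2) N.rcos_sum s t by simp
  then have "test_rep N C \<in> N #> (s [^] i \<otimes> t)"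
    using rcos_self[OF rep(1) N.is_subgroup] by simp
  then obtain n where "n \<in> N" "test_rep N C = n \<otimes> (s [^] i \<otimes> t)" by (auto simp: r_coset_def)
  then show ?thesis using C by blast
qed

end

text \<open>The value at \<open>t\<close> of the cocycle on \<open>s [^] m\<close> depends only on the coset of \<open>N #> t\<close> with respect to the cyclic
  group generated by \<open>s\<close>, as \<open>s\<close> commutes with its powers.\<close>

lemma (in profinite) cocycle_vanishes_by_tests:
  assumes cc: "coset_cocycle N G c r" and s: "s \<in> carrier G"
    and tests: "\<And>C. C \<in> test_cosets N s \<Longrightarrow>
      [c (s [^] group.ord (G Mod N) (N #> s) \<otimes> test_rep N C) = c (test_rep N C)] (mod r)"
  shows "s [^] group.ord (G Mod N) (N #> s) \<in> N"
    and "\<And>t. t \<in> carrier G \<Longrightarrow> [c (s [^] group.ord (G Mod N) (N #> s) \<otimes> t) = c t] (mod r)"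
proof -
  interpret coset_cocycle N G c r by (rule cc)
  interpret Q: group "G Mod N" by (rule factorgroup_is_group)
  define m where "m = Q.ord (N #> s)"
  have Ns: "N #> s \<in> carrier (G Mod N)" using s by (simp add: carrier_FactGroup)
  have "N #> (s [^] m) = N"
    using Q.pow_ord_eq_1[OF Ns] FactGroup_pow[OF s, of m] by (simp add: m_def)
  then have sm: "s [^] m \<in> N" using rcos_self[of "s [^] m" N] s is_subgroup by simp
  then show "s [^] Q.ord (N #> s) \<in> N" by (simp add: m_def)
  fix t assume t: "t \<in> carrier G"
  obtain C n i where C: "C \<in> test_cosets N s" and n: "n \<in> N"
    and rep: "test_rep N C = n \<otimes> (s [^] (i::nat) \<otimes> t)"
    using test_coset_exists[OF normal_axioms s t finite_index] by blast
  have rc: "test_rep N C \<in> carrier G" using rep n s t by simp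
  have comm: "s \<otimes> s [^] m = s [^] m \<otimes> s" using s by (metis nat_pow_Suc nat_pow_Suc2)
  have "[c (test_rep N C) + conj_value (s [^] m) (test_rep N C) = c (s [^] m \<otimes> test_rep N C)] (mod r)"
    by (rule cong_sym[OF c_left_mult[OF sm rc]])
  also have "[c (s [^] m \<otimes> test_rep N C) = c (test_rep N C) + 0] (mod r)"
    using tests[OF C] by (simp add: m_def)
  finally have "[conj_value (s [^] m) (test_rep N C) = 0] (mod r)" by (simp only: cong_add_lcancel)
  moreover have "[conj_value (s [^] m) (test_rep N C) = conj_value (s [^] m) t] (mod r)"
    unfolding rep by (rule conj_value_left_coset[OF s sm comm n t])
  ultimately have "[conj_value (s [^] m) t = 0] (mod r)" by (meson cong_sym cong_trans)
  then have "[c t + conj_value (s [^] m) t = c t + 0] (mod r)" by (rule cong_add[OF cong_refl])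
  with c_left_mult[OF sm t] have "[c (s [^] m \<otimes> t) = c t + 0] (mod r)" by (rule cong_trans)
  then show "[c (s [^] Q.ord (N #> s) \<otimes> t) = c t] (mod r)" by (simp add: m_def)
qed

text \<open>The new subgroup \<open>N'\<close> is the common kernel of cocycles \<open>c w\<close>, one for every prescription \<open>w\<close> of residues
  \<open>w i C\<close> at the generators \<open>x i\<close> and the cosets \<open>C\<close> of \<open>N\<close>. There are \<open>r ^ (n d)\<close> prescriptions. By
  rigidity \<open>w\<close> is determined by the test values of \<open>c w\<close> at the elements of \<open>S\<close> outside \<open>N'\<close> together with the
  values of \<open>c w\<close> at representatives of the non-trivial cosets of \<open>N\<close>. Hence \<open>n d\<close> is at most the number of tests
  plus \<open>n - 1\<close>. An element of \<open>S\<close> in \<open>N - N'\<close> requires \<open>n\<close> tests, and one outside \<open>N\<close> at most \<open>n / (card S + 1)\<close>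
  because its order modulo \<open>N\<close> exceeds \<open>card S\<close>. The condition on powers says that the orders of the
  non-trivial elements modulo \<open>N'\<close> are again that large.\<close>

lemma (in free_soluble) tower_step:
  assumes S: "invariably_generates G T S" and finS: "finite S"
    and nN: "N \<lhd> G" and op: "openin T N" and dN: "derived_term j \<subseteq> N" and j: "j < l"
    and pure: "\<forall>f\<in>carrier G. \<forall>i::nat. 0 < i \<and> i \<le> card S \<and> f [^] i \<in> N \<longrightarrow> f \<in> N"
  shows "\<exists>N'. N' \<lhd> G \<and> openin T N' \<and> N' \<subseteq> N \<and> derived_term (Suc j) \<subseteq> N' \<and>
    (\<forall>f\<in>carrier G. \<forall>i::nat. 0 < i \<and> i \<le> card S \<and> f [^] i \<in> N' \<longrightarrow> f \<in> N') \<and>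
    d - 1 \<le> card (S \<inter> N - N') \<and> (N = carrier G \<longrightarrow> d \<le> card (S \<inter> N - N'))"
proof -
  interpret N: normal N G by (rule nN)
  interpret Q: group "G Mod N" by (rule N.factorgroup_is_group)
  have Sc: "S \<subseteq> carrier G" using S by (simp add: invariably_generates_def)
  define k where "k = card S"
  define n where "n = card (rcosets N)"
  have fin: "finite (rcosets N)" by (rule finite_rcosets_open_subgroup[OF compact N.is_subgroup op])
  have NQ: "N \<in> rcosets N" using N.subgroup_in_rcosets[OF is_group] .
  have n: "n > 0" unfolding n_def using fin NQ by (auto simp: card_gt_0_iff)
  \<comment> \<open>\<open>p > n\<close> makes the index invertible, \<open>p > k\<close> keeps the orders modulo \<open>N'\<close> above \<open>k\<close>\<close>
  obtain p where p: "prime p" "p > max k n" using bigger_prime by blast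
  define r where "r = int p"
  have r: "prime r" "r > 0" "r > int n" "r > int k" using p by (auto simp: r_def prime_gt_0_nat)
  have cop: "coprime (int m) r" if "0 < m" "m \<le> n" for m
  proof -
    have "\<not> p dvd m" using that p(2) by (auto dest: dvd_imp_le)
    then have "coprime p m" using p(1) by (simp add: prime_imp_coprime_nat)
    then show ?thesis by (simp add: r_def coprime_commute)
  qed
  define \<W> where "\<W> = {..<d} \<rightarrow>\<^sub>E (rcosets N \<rightarrow>\<^sub>E {0..<r})"
  have fin\<W>: "finite \<W>" unfolding \<W>_def by (intro finite_PiE fin) simp_all
  have "\<exists>c. (\<forall>t\<in>carrier G. c t \<in> {0..<r}) \<and>
    (\<forall>t\<in>carrier G. \<forall>n\<in>N. [c (t \<otimes> n) = c t + c n] (mod r)) \<and>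
    (\<forall>i<d. \<forall>t\<in>carrier G. [c (x i \<otimes> t) = w i (N #> t) + c t] (mod r)) \<and>
    cocycle_kernel N c \<lhd> G \<and> openin T (cocycle_kernel N c) \<and>
    derived_term (Suc j) \<subseteq> cocycle_kernel N c" if w: "w \<in> \<W>" for w
  proof (rule cocycle_exists[OF nN op dN j r(2)])
    show "w i \<in> carrier (G Mod N) \<rightarrow>\<^sub>E {0..<r}" if "i < d" for i
      using PiE_mem[OF w[unfolded \<W>_def], of i] that by (simp add: FactGroup_def)
  qed
  then have "\<forall>w\<in>\<W>. \<exists>c. (\<forall>t\<in>carrier G. c t \<in> {0..<r}) \<and>
    (\<forall>t\<in>carrier G. \<forall>n\<in>N. [c (t \<otimes> n) = c t + c n] (mod r)) \<and>
    (\<forall>i<d. \<forall>t\<in>carrier G. [c (x i \<otimes> t) = w i (N #> t) + c t] (mod r)) \<and>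
    cocycle_kernel N c \<lhd> G \<and> openin T (cocycle_kernel N c) \<and>
    derived_term (Suc j) \<subseteq> cocycle_kernel N c" by (rule ballI)
  from bchoice[OF this] obtain c where c: "\<forall>w\<in>\<W>. (\<forall>t\<in>carrier G. c w t \<in> {0..<r}) \<and>
    (\<forall>t\<in>carrier G. \<forall>n\<in>N. [c w (t \<otimes> n) = c w t + c w n] (mod r)) \<and>
    (\<forall>i<d. \<forall>t\<in>carrier G. [c w (x i \<otimes> t) = w i (N #> t) + c w t] (mod r)) \<and>
    cocycle_kernel N (c w) \<lhd> G \<and> openin T (cocycle_kernel N (c w)) \<and>
    derived_term (Suc j) \<subseteq> cocycle_kernel N (c w)" by (elim exE)
  have range: "c w t \<in> {0..<r}" if "w \<in> \<W>" "t \<in> carrier G" for w t using c that by blast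
  have add: "[c w (t \<otimes> m) = c w t + c w m] (mod r)" if "w \<in> \<W>" "t \<in> carrier G" "m \<in> N" for w t m
    using c that by blast
  have gens: "[c w (x i \<otimes> t) = w i (N #> t) + c w t] (mod r)"
    if "w \<in> \<W>" "i < d" "t \<in> carrier G" for w i t using c that by blast
  have ker: "cocycle_kernel N (c w) \<lhd> G \<and> openin T (cocycle_kernel N (c w))" if "w \<in> \<W>" for w
    using c that by blast
  have dker: "derived_term (Suc j) \<subseteq> cocycle_kernel N (c w)" if "w \<in> \<W>" for w
    using c that by blast
  define N' where "N' = {g \<in> N. \<forall>w\<in>\<W>. g \<in> cocycle_kernel N (c w)}"
  have N': "N' \<lhd> G" "openin T N'"
    using open_normal_INT[OF fin\<W> ker nN op] by (auto simp: N'_def)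
  have N'N: "N' \<subseteq> N" by (auto simp: N'_def)
  have "derived_term (Suc j) \<subseteq> N"
    using derived_term_antimono[of j "Suc j"] dN by simp
  then have dN': "derived_term (Suc j) \<subseteq> N'" using dker unfolding N'_def by blast
  have cc: "coset_cocycle N G (c w) r" if w: "w \<in> \<W>" for w
    using add[OF w] fin cop[OF n] unfolding n_def[symmetric]
    by (intro coset_cocycle.intro coset_cocycle_axioms.intro nN) (auto simp: n_def)
  have pure': "f \<in> N'" if f: "f \<in> carrier G" "0 < i" "i \<le> k" "f [^] (i::nat) \<in> N'" for f i
  proof -
    have "f \<in> N" using pure f N'N unfolding k_def by blast
    moreover have "f \<in> cocycle_kernel N (c w)" if w: "w \<in> \<W>" for w
    proof (rule coset_cocycle.cocycle_kernel_pure[OF cc[OF w] range[OF w] r(1) \<open>f \<in> N\<close> f(2)])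
      show "int i < r" using f(3) r(4) by simp
      show "f [^] i \<in> cocycle_kernel N (c w)" using f(4) w by (simp add: N'_def)
    qed
    ultimately show ?thesis by (simp add: N'_def)
  qed
  have fix': "c w (g \<otimes> t) = c w t" if "g \<in> N'" "w \<in> \<W>" "t \<in> carrier G" for g w t
    using that by (simp add: N'_def cocycle_kernel_def)
  define ords where "ords s = Q.ord (N #> s)" for s
  define \<Theta> where "\<Theta> = (SIGMA s:S - N'. test_cosets N s)"
  have fin\<Theta>: "finite \<Theta>"
    unfolding \<Theta>_def using finS Sc test_cosets_card(1)[OF nN op] by (intro finite_SigmaI) auto
  have trep: "test_rep N C \<in> carrier G" if s: "s \<in> carrier G" and C: "C \<in> test_cosets N s" for s C
  proof -
    obtain q where q: "q \<in> carrier (G Mod N)" "C = generate (G Mod N) {N #> s} #>\<^bsub>G Mod N\<^esub> q"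
      using C by (auto simp: test_cosets_def RCOSETS_def)
    have sub: "subgroup (generate (G Mod N) {N #> s}) (G Mod N)"
      using s by (intro Q.generate_is_subgroup) (simp add: carrier_FactGroup)
    obtain t where t: "t \<in> carrier G" "q = N #> t" using q(1) by (auto simp: carrier_FactGroup)
    then have "t \<in> carrier G \<and> N #> t \<in> C" using Q.rcos_self[OF q(1) sub] q(2) by simp
    then have "test_rep N C \<in> carrier G \<and> N #> test_rep N C \<in> C"
      unfolding test_rep_def by (rule someI)
    then show ?thesis by blast
  qed
  have "\<forall>C\<in>rcosets N. \<exists>g. g \<in> carrier G \<and> N #> g = C" by (auto simp: RCOSETS_def)
  from bchoice[OF this] obtain rp where rp: "\<forall>C\<in>rcosets N. rp C \<in> carrier G \<and> N #> rp C = C"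
    by (elim exE)
  \<comment> \<open>test values and values on coset representatives, the two data that determine \<open>w\<close>\<close>
  define \<psi> where "\<psi> w = (\<lambda>z\<in>\<Theta>. (c w (fst z [^] ords (fst z) \<otimes> test_rep N (snd z)) - c w (test_rep N (snd z))) mod r)" for w
  define \<kappa> where "\<kappa> w = (\<lambda>C\<in>rcosets N - {N}. c w (rp C))" for w
  have "inj_on (\<lambda>w. (\<psi> w, \<kappa> w)) \<W>"
  proof (rule inj_onI)
    fix w w' assume w: "w \<in> \<W>" and w': "w' \<in> \<W>" and eq: "(\<psi> w, \<kappa> w) = (\<psi> w', \<kappa> w')"
    \<comment> \<open>the difference of two cocycles with the same data is again a cocycle, and all its data vanish\<close>
    define b where "b t = c w t - c w' t" for t
    have b_add: "[b (t \<otimes> m) = b t + b m] (mod r)" if "t \<in> carrier G" "m \<in> N" for t m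
      using cong_diff[OF add[OF w that] add[OF w' that]] by (simp add: b_def algebra_simps)
    have ccb: "coset_cocycle N G b r"
      using b_add fin cop[OF n] unfolding n_def[symmetric]
      by (intro coset_cocycle.intro coset_cocycle_axioms.intro nN) (auto simp: n_def)
    have "[b m = 0] (mod r)" if m: "m \<in> N" for m
    proof (rule cocycle_rigid[OF S ccb N' _ _ m])
      show "[b (g \<otimes> t) = b t] (mod r)" if "g \<in> N'" "t \<in> carrier G" for g t
        using fix'[OF that(1) w that(2)] fix'[OF that(1) w' that(2)] by (simp add: b_def)
      fix s assume s: "s \<in> S"
      then have sc: "s \<in> carrier G" using Sc by auto
      show "\<exists>m::nat. coprime (int m) r \<and> s [^] m \<in> N \<and> (\<forall>t\<in>carrier G. [b (s [^] m \<otimes> t) = b t] (mod r))"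
      proof (cases "s \<in> N'")
        case True
        then show ?thesis
          using N'N fix'[OF True w] fix'[OF True w'] sc
          by (intro exI[of _ "1::nat"]) (auto simp: b_def)
      next
        case False
        have "[b (s [^] Q.ord (N #> s) \<otimes> test_rep N C) = b (test_rep N C)] (mod r)"
          if C: "C \<in> test_cosets N s" for C
        proof -
          have z: "(s, C) \<in> \<Theta>" using C s False by (simp add: \<Theta>_def)
          have "\<psi> w (s, C) = \<psi> w' (s, C)" using eq by simp
          then have "[c w (s [^] ords s \<otimes> test_rep N C) - c w (test_rep N C) =
              c w' (s [^] ords s \<otimes> test_rep N C) - c w' (test_rep N C)] (mod r)"
            using z by (simp add: \<psi>_def cong_def)
          then show ?thesis by (simp add: b_def ords_def cong_iff_dvd_diff algebra_simps)
        qed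
        note van = cocycle_vanishes_by_tests[OF ccb sc this]
        have "0 < Q.ord (N #> s)" using test_cosets_card(3)[OF nN op sc] by simp
        moreover have "Q.ord (N #> s) \<le> n"
          using Q.ord_le_group_order[of "N #> s"] fin sc
          by (simp add: n_def order_def FactGroup_def carrier_FactGroup rcosetsI[OF N.subset])
        ultimately have "coprime (int (Q.ord (N #> s))) r" by (rule cop)
        then show ?thesis using van by blast
      qed
    qed
    note bN = this
    have b0: "[b t = 0] (mod r)" if t: "t \<in> carrier G" for t
    proof -
      define C where "C = N #> t"
      have C: "C \<in> rcosets N" unfolding C_def by (rule rcosetsI[OF N.subset t])
      then have rc: "rp C \<in> carrier G" "N #> rp C = C" using rp by auto
      have "[b (rp C) = 0] (mod r)"
      proof (cases "C = N")
        case True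
        then have "rp C \<in> N" using rcos_self[OF rc(1) N.is_subgroup] rc(2) by simp
        then show ?thesis by (rule bN)
      next
        case False
        have "\<kappa> w C = \<kappa> w' C" using eq by simp
        then show ?thesis using False C by (simp add: \<kappa>_def b_def)
      qed
      moreover have "t \<in> N #> rp C" using rcos_self[OF t N.is_subgroup] rc(2) by (simp add: C_def)
      then obtain m where m: "m \<in> N" "t = m \<otimes> rp C" by (auto simp: r_coset_def)
      define m' where "m' = inv (rp C) \<otimes> m \<otimes> rp C"
      have m': "m' \<in> N" unfolding m'_def by (rule N.inv_op_closed1[OF rc(1) m(1)])
      have "t = rp C \<otimes> m'" using m rc(1) by (simp add: m'_def m_assoc)
      then have "[b t = b (rp C) + b m'] (mod r)" using b_add[OF rc(1) m'] by simp
      ultimately show ?thesis using bN[OF m'] by (metis add.right_neutral cong_add cong_trans)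
    qed
    have wr: "w i C \<in> {0..<r}" "w' i C \<in> {0..<r}" if "i < d" "C \<in> rcosets N" for i C
      using PiE_mem[OF PiE_mem[OF w[unfolded \<W>_def]]] PiE_mem[OF PiE_mem[OF w'[unfolded \<W>_def]]] that
      by auto
    have "w i C = w' i C" if i: "i < d" and C: "C \<in> rcosets N" for i C
    proof -
      define t where "t = rp C"
      have t: "t \<in> carrier G" "N #> t = C" using rp C by (auto simp: t_def)
      have "[c w (x i \<otimes> t) - c w' (x i \<otimes> t) = (w i C + c w t) - (w' i C + c w' t)] (mod r)"
        using gens[OF w i t(1)] gens[OF w' i t(1)] t(2) by (intro cong_diff) simp_all
      moreover have "[b (x i \<otimes> t) = 0] (mod r)" "[b t = 0] (mod r)"
        using b0 t generator_closed[OF i] by simp_all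
      ultimately have dv: "r dvd b (x i \<otimes> t) - (w i C - w' i C + b t)" "r dvd b (x i \<otimes> t)" "r dvd b t"
        by (simp_all add: b_def cong_iff_dvd_diff algebra_simps)
      have "r dvd b (x i \<otimes> t) - b t - (b (x i \<otimes> t) - (w i C - w' i C + b t))"
        by (rule dvd_diff[OF dvd_diff[OF dv(2,3)] dv(1)])
      then have "[w i C = w' i C] (mod r)" by (simp add: cong_iff_dvd_diff)
      then show ?thesis using wr[OF i C] by (simp add: cong_def)
    qed
    then show "w = w'"
      using w w' unfolding \<W>_def
      by (intro PiE_ext[of w "{..<d}" _ w']) (auto intro!: PiE_ext[of _ "rcosets N" "\<lambda>_. {0..<r}"])
  qed
  moreover have "(\<lambda>w. (\<psi> w, \<kappa> w)) ` \<W> \<subseteq> (\<Theta> \<rightarrow>\<^sub>E {0..<r}) \<times> ((rcosets N - {N}) \<rightarrow>\<^sub>E {0..<r})"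
  proof (intro image_subsetI SigmaI)
    fix w assume w: "w \<in> \<W>"
    show "\<psi> w \<in> \<Theta> \<rightarrow>\<^sub>E {0..<r}"
      unfolding \<psi>_def restrict_PiE_iff using r(2) by simp
    show "\<kappa> w \<in> (rcosets N - {N}) \<rightarrow>\<^sub>E {0..<r}"
      unfolding \<kappa>_def restrict_PiE_iff using range[OF w] rp by blast
  qed
  moreover have "finite ((\<Theta> \<rightarrow>\<^sub>E {0..<r}) \<times> ((rcosets N - {N}) \<rightarrow>\<^sub>E {0..<r}))"
    using fin fin\<Theta> by (intro finite_cartesian_product finite_PiE) auto
  ultimately have "card \<W> \<le> card ((\<Theta> \<rightarrow>\<^sub>E {0..<r}) \<times> ((rcosets N - {N}) \<rightarrow>\<^sub>E {0..<r}))"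
    by (rule card_inj_on_le)
  then have "p ^ (n * d) \<le> p ^ (card \<Theta> + (n - 1))"
    using fin fin\<Theta> NQ
    by (simp add: \<W>_def card_PiE card_cartesian_product r_def n_def power_mult power_add card_Diff_singleton)
  then have main: "n * d \<le> card \<Theta> + (n - 1)"
    using prime_gt_1_nat[OF p(1)] by (simp only: power_increasing_iff)
  define A where "A = S \<inter> N - N'"
  define B where "B = S - N"
  have "S - N' = A \<union> B" "A \<inter> B = {}" using N'N by (auto simp: A_def B_def)
  moreover have finAB: "finite A" "finite B" using finS by (auto simp: A_def B_def)
  ultimately have \<Theta>_sum: "card \<Theta> = (\<Sum>s\<in>A. card (test_cosets N s)) + (\<Sum>s\<in>B. card (test_cosets N s))"
    using Sc finS test_cosets_card(1)[OF nN op] unfolding \<Theta>_def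
    by (subst card_SigmaI) (auto simp: sum.union_disjoint)
  have "card (test_cosets N s) \<le> n" if "s \<in> A" for s
  proof -
    have sc: "s \<in> carrier G" using that Sc by (auto simp: A_def)
    have "card (test_cosets N s) * 1 \<le> card (test_cosets N s) * Q.ord (N #> s)"
      by (intro mult_left_mono test_cosets_card(3)[OF nN op sc]) simp
    then show ?thesis using test_cosets_card(2)[OF nN op sc] by (simp add: n_def)
  qed
  then have sumA: "(\<Sum>s\<in>A. card (test_cosets N s)) \<le> card A * n"
    using sum_bounded_above[of A "\<lambda>s. card (test_cosets N s)" n] by simp
  have "card (test_cosets N s) * (k + 1) \<le> n" if "s \<in> B" for s
  proof -
    have sc: "s \<in> carrier G" and sN: "s \<notin> N" using that Sc by (auto simp: B_def)
    have Ns: "N #> s \<in> carrier (G Mod N)" using sc by (simp add: carrier_FactGroup)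
    have "N #> (s [^] ords s) = N"
      using Q.pow_ord_eq_1[OF Ns] N.FactGroup_pow[OF sc] by (simp add: ords_def)
    then have "s [^] ords s \<in> N" using rcos_self[of "s [^] ords s" N] sc N.is_subgroup by simp
    then have "k + 1 \<le> ords s"
      using pure[rule_format, OF sc, of "ords s"] sN test_cosets_card(3)[OF nN op sc]
      unfolding k_def ords_def by linarith
    then have "card (test_cosets N s) * (k + 1) \<le> card (test_cosets N s) * ords s"
      by (rule mult_left_mono) simp
    then show ?thesis using test_cosets_card(2)[OF nN op sc] by (simp add: n_def ords_def)
  qed
  then have "(\<Sum>s\<in>B. card (test_cosets N s) * (k + 1)) \<le> card B * n"
    using sum_bounded_above[of B "\<lambda>s. card (test_cosets N s) * (k + 1)" n] by simp
  then have sumB: "(\<Sum>s\<in>B. card (test_cosets N s)) * (k + 1) \<le> card B * n"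
    by (simp only: sum_distrib_right)
  have "card B \<le> k" unfolding B_def k_def using finS by (intro card_mono) auto
  then have "card B * n \<le> k * n" by (rule mult_right_mono) simp
  with sumB have sumB': "(\<Sum>s\<in>B. card (test_cosets N s)) * (k + 1) \<le> k * n" by (rule le_trans)
  \<comment> \<open>otherwise \<open>B\<close> would account for more than \<open>n\<close> tests, against the bound \<open>k n / (k + 1)\<close>\<close>
  have "d \<le> card A + 1"
  proof (rule ccontr)
    assume "\<not> d \<le> card A + 1"
    then have "n * (card A + 2) \<le> n * d" by (intro mult_left_mono) auto
    then have "card A * n + 2 * n \<le> n * d" by (simp add: algebra_simps)
    then have "n + 1 \<le> (\<Sum>s\<in>B. card (test_cosets N s))"
      using main \<Theta>_sum sumA n by linarith
    then have "(n + 1) * (k + 1) \<le> (\<Sum>s\<in>B. card (test_cosets N s)) * (k + 1)"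
      by (rule mult_right_mono) simp
    then show False using sumB' by (simp add: algebra_simps)
  qed
  moreover have "d \<le> card A" if NG: "N = carrier G"
  proof -
    have "rcosets N = {carrier G}"
    proof
      show "rcosets N \<subseteq> {carrier G}"
        using coset_join2[OF _ subgroup_self] by (auto simp: NG RCOSETS_def)
      show "{carrier G} \<subseteq> rcosets N" using NQ NG by simp
    qed
    then have "n = 1" by (simp add: n_def)
    moreover have "B = {}" using Sc NG by (auto simp: B_def)
    ultimately show ?thesis using main \<Theta>_sum sumA by simp
  qed
  ultimately show ?thesis
    using N' N'N dN' pure' unfolding A_def k_def by (intro exI[of _ N']) auto
qed

text \<open>The parts of \<open>S\<close> that become non-trivial at the successive steps of the tower are disjoint.\<close>

theorem (in free_soluble) card_invariable_generating_set_ge: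
  assumes S: "invariably_generates G T S" and finS: "finite S" and d: "d \<ge> 1" and l: "l \<ge> 1"
  shows "l * (d - 1) + 1 \<le> card S"
proof -
  have Sc: "S \<subseteq> carrier G" using S by (simp add: invariably_generates_def)
  have "j \<le> l \<Longrightarrow> \<exists>N. N \<lhd> G \<and> openin T N \<and> derived_term j \<subseteq> N \<and>
    (\<forall>f\<in>carrier G. \<forall>i::nat. 0 < i \<and> i \<le> card S \<and> f [^] i \<in> N \<longrightarrow> f \<in> N) \<and>
    (if j = 0 then N = carrier G else j * (d - 1) + 1 \<le> card (S - N))" for j
  proof (induction j)
    case 0
    have "openin T (carrier G)" using openin_topspace[of T] by simp
    then show ?case by (intro exI[of _ "carrier G"]) (simp add: normal_self)
  next
    case (Suc j)
    then obtain N where N: "N \<lhd> G" "openin T N" "derived_term j \<subseteq> N"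
      and pure: "\<forall>f\<in>carrier G. \<forall>i::nat. 0 < i \<and> i \<le> card S \<and> f [^] i \<in> N \<longrightarrow> f \<in> N"
      and cnt: "if j = 0 then N = carrier G else j * (d - 1) + 1 \<le> card (S - N)"
      by auto
    have "j < l" using Suc.prems by simp
    obtain N' where N': "N' \<lhd> G" "openin T N'" "N' \<subseteq> N" "derived_term (Suc j) \<subseteq> N'"
      "\<forall>f\<in>carrier G. \<forall>i::nat. 0 < i \<and> i \<le> card S \<and> f [^] i \<in> N' \<longrightarrow> f \<in> N'"
      "d - 1 \<le> card (S \<inter> N - N')" "N = carrier G \<longrightarrow> d \<le> card (S \<inter> N - N')"
      using tower_step[OF S finS N \<open>j < l\<close> pure] by (elim exE conjE)
    have "S - N' = (S - N) \<union> (S \<inter> N - N')" using N'(3) by auto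
    then have "card (S - N') = card (S - N) + card (S \<inter> N - N')"
      using finS by (subst card_Un_disjoint[symmetric]) auto
    then have "Suc j * (d - 1) + 1 \<le> card (S - N')"
      using cnt N'(6,7) d by (cases "j = 0") auto
    then show ?case using N' by (intro exI[of _ N']) auto
  qed
  from this[of l] l obtain N where "l * (d - 1) + 1 \<le> card (S - N)" by auto
  also have "\<dots> \<le> card S" using finS by (intro card_mono) auto
  finally show ?thesis .
qed

theorem theorem2:
  fixes F :: "('a, 'm) monoid_scheme" and T :: "'a topology" and d l :: nat
  assumes "d \<ge> 1" and "l \<ge> 1"
    and "free_soluble_profinite d l F T"
  shows "d_I F T = enat (l * (d - 1) + 1)"
proof -
  obtain x where x: "free_soluble_profinite_on d l F T x"
    using assms(3) by (auto simp: free_soluble_profinite_def)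
  then have prof: "profinite_group F T" by (simp add: free_soluble_profinite_on_def)
  interpret free_soluble F T d l x
  proof (intro free_soluble.intro profinite.intro top_group.intro top_group_axioms.intro
      profinite_axioms.intro free_soluble_axioms.intro)
    show "profinite_group F T" by (rule prof)
    show "free_soluble_profinite_on d l F T x" by (rule x)
    show "topological_group F T" using prof by (simp add: profinite_group_def)
    then show "Group.group F" by (simp add: topological_group_def)
  qed
  obtain S where S: "invariably_generates F T S" "finite S" "card S \<le> l * (d - 1) + 1"
    using exists_small_invariable_generating_set[OF assms(1,2)] by blast
  show ?thesis
  proof (rule antisym)
    have "d_I F T \<le> (if finite S then enat (card S) else \<infinity>)"
      unfolding d_I_def using S(1) by (intro INF_lower) simp
    also have "\<dots> \<le> enat (l * (d - 1) + 1)" using S by simp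
    finally show "d_I F T \<le> enat (l * (d - 1) + 1)" .
    show "enat (l * (d - 1) + 1) \<le> d_I F T"
      unfolding d_I_def
    proof (rule INF_greatest)
      fix S assume "S \<in> {S. invariably_generates F T S}"
      then show "enat (l * (d - 1) + 1) \<le> (if finite S then enat (card S) else \<infinity>)"
        using card_invariable_generating_set_ge[of S] assms by simp
    qed
  qed
qed

end
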